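(* Let $L>0$ and let $\phi_\delta$ be the discrete GFF on $V_\delta$ with alternating boundary condition of height $\lambda$. When $\lambda=\lambda_0$, $$\lim_{\delta\to0}\mathbb{P}\left([a_\delta,b_\delta)\stackrel{\phi_\delta\ge0}{\longleftrightarrow}[c_\delta,d_\delta)\right)=\frac{(\varphi(b)-\varphi(a))(\varphi(d)-\varphi(c))}{(\varphi(c)-\varphi(a))(\varphi(d)-\varphi(b))},$$ where $\varphi$ is any conformal map from $R_L$ onto the upper half-plane $\mathbb{H}$ with $\varphi(a)<\varphi(b)<\varphi(c)<\varphi(d)$. Here $\lambda_0=\lambda_0(\mathbb{Z}^2)>0$ is the constant for which the level line of the discrete GFF with alternating boundary condition of height $\lambda_0$ converges to $\mathrm{SLE}_4(-2;-2)$, as specified in the context.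
   Context: Identify $\mathbb{R}^2$ with $\mathbb{C}$. For $L>0$ let $R_L=\{z: 0<\Re(z)<L,\ 0<\Im(z)<1\}$, with corners $(a,b,c,d)$ in counter-clockwise order and $b=0$. For $\delta>0$ (always $\delta\le (L\wedge 1)/3$) let $V_\delta=R_L\cap\delta\mathbb{Z}^2$. Points $u,v\in\delta\mathbb{Z}^2$ are adjacent, $u\sim v$, if $|u-v|=\delta$. Let $\partial V_\delta=\{v\in V_\delta:\exists u\in\delta\mathbb{Z}^2\setminus V_\delta,\ u\sim v\}$. Let $(a_\delta,b_\delta,c_\delta,d_\delta)$ be the corners of $V_\delta$ in counter-clockwise order, with $b_\delta$ closest to the origin. For $u,v\in\partial V_\delta$, $[u,v)$ is the counter-clockwise arc of $\partial V_\delta$ from $u$ to $v$, containing $u$ but not $v$. Discrete GFF: let $S$ be the continuous-time simple random walk on $\delta\mathbb{Z}^2$ with expected holding time $1$ at each vertex, $\mathbb{E}_v$ the expectation when $S_0=v$, and $\zeta=\inf\{t\ge0:S_t\in\partial V_\delta\}$. A discrete GFF on $V_\delta$ with boundary condition $f:\partial V_\delta\to\mathbb{R}$ is a Gaussian process $\{\phi_\delta(v):v\in V_\delta\}$ with mean $\mathbb{E}_v[f(S_\zeta)]$ and covariance $G(u,v)=\mathbb{E}_u[\int_0^\zeta \mathbf{1}_{\{S_t=v\}}dt]$. The alternating boundary condition of height $\lambda>0$ is $f=\lambda$ on $[a_\delta,b_\delta)\cup[c_\delta,d_\delta)$ and $f=-\lambda$ on $[b_\delta,c_\delta)\cup[d_\delta,a_\delta)$.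 The event $\{A\stackrel{\phi_\delta\ge0}{\longleftrightarrow}B\}$ means that there is a nearest-neighbor path in $V_\delta$ from $A$ to $B$ on which $\phi_\delta\ge0$. Level line: the level line $\eta_\delta$ of $\phi_\delta$ starts from $b_\delta^\diamond=(0,3\delta/2)$, lies on the dual lattice of $\delta\mathbb{Z}^2$, and turns at every dual vertex in such a way that it has vertices with positive value on its left and vertices with negative value on its right; if there is an indetermination when arriving at a dual vertex, it turns left. It stops when it hits the boundary segments $[c_\delta,d_\delta)$ or $[d_\delta,a_\delta)$. Unparametrized continuous planar curves are equipped with the metric $d(\eta_1,\eta_2)=\inf_{u_1,u_2}\sup_{t\in[0,1]}|\eta_1(u_1(t))-\eta_2(u_2(t))|$, the infimum over increasing homeomorphisms $u_1,u_2:[0,1]\to[0,1]$. SLE: for $y^L<0<y^R$, $\mathrm{SLE}_4(-2;-2)$ in $\mathbb{H}$ from $0$ to $\infty$ with force points $(y^L;y^R)$ is the random curve generating the Loewner chain $\partial_tg_t(z)=2/(g_t(z)-W_t)$, $g_0(z)=z$, whose driving function solves $$dW_t=2dB_t+\frac{2dt}{V_t^L-W_t}+\frac{2dt}{V_t^R-W_t},\quad dV_t^L=\frac{2dt}{V_t^L-W_t},\quad dV_t^R=\frac{2dt}{V_t^R-W_t},$$ with $W_0=0$, $V_0^L=y^L$, $V_0^R=y^R$ and $B$ a standard Brownian motion; it is run up to and including the first time $T$ at which $y^L$ or $y^R$ is swallowed. $\mathrm{SLE}_4(-2;-2)$ in $R_L$ from $b$ to $d$ with force points $(a;c)$ is the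 image of this curve under $\varphi^{-1}$, where $\varphi:R_L\to\mathbb{H}$ is conformal with $\varphi(a)=y^L<\varphi(b)=0<\varphi(c)=y^R$, $\varphi(d)=\infty$. The constant $\lambda_0$: $\lambda_0>0$ is a constant depending only on the lattice $\mathbb{Z}^2$ such that, when $\lambda=\lambda_0$, the law of $\eta_\delta$ converges weakly (for the metric $d$) as $\delta\to0$ to $\mathrm{SLE}_4(-2;-2)$ in $R_L$ from $b$ to $d$ with force points $(a;c)$. *)

theory Defs
  imports "HOL-Probability.Probability" "HOL-Complex_Analysis.Complex_Analysis"
begin

section \<open>Rectangles and lattice domains\<close>

definition halfplane :: "complex set" where
  "halfplane = {z. 0 < Im z}"

definition rect :: "real \<Rightarrow> complex set" where
  "rect L = {z. 0 < Re z \<and> Re z < L \<and> 0 < Im z \<and> Im z < 1}"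

text \<open>The corners \<open>(a, b, c, d)\<close> are counter-clockwise and \<open>b\<close> is the origin.\<close>

definition corner_a :: complex where "corner_a = \<i>"
definition corner_b :: complex where "corner_b = 0"
definition corner_c :: "real \<Rightarrow> complex" where "corner_c L = of_real L"
definition corner_d :: "real \<Rightarrow> complex" where "corner_d L = Complex L 1"

definition lattice :: "real \<Rightarrow> complex set" where
  "lattice \<delta> = {Complex (\<delta> * of_int i) (\<delta> * of_int j) | i j. True}"

definition adjacent :: "real \<Rightarrow> complex \<Rightarrow> complex \<Rightarrow> bool" where
  "adjacent \<delta> u v \<longleftrightarrow> u \<in> lattice \<delta> \<and> v \<in> lattice \<delta> \<and> cmod (u - v) = \<delta>"

definition Vset :: "real \<Rightarrow> real \<Rightarrow> complex set" where
  "Vset \<delta> L = rect L \<inter> lattice \<delta>"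

definition bdry :: "real \<Rightarrow> real \<Rightarrow> complex set" where
  "bdry \<delta> L = {v \<in> Vset \<delta> L. \<exists>u \<in> lattice \<delta> - Vset \<delta> L. adjacent \<delta> u v}"

definition dcorner_a :: "real \<Rightarrow> real \<Rightarrow> complex" where
  "dcorner_a \<delta> L = Complex (Min (Re ` Vset \<delta> L)) (Max (Im ` Vset \<delta> L))"

definition dcorner_b :: "real \<Rightarrow> real \<Rightarrow> complex" where
  "dcorner_b \<delta> L = Complex (Min (Re ` Vset \<delta> L)) (Min (Im ` Vset \<delta> L))"

definition dcorner_c :: "real \<Rightarrow> real \<Rightarrow> complex" where
  "dcorner_c \<delta> L = Complex (Max (Re ` Vset \<delta> L)) (Min (Im ` Vset \<delta> L))"

definition dcorner_d :: "real \<Rightarrow> real \<Rightarrow> complex" where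
  "dcorner_d \<delta> L = Complex (Max (Re ` Vset \<delta> L)) (Max (Im ` Vset \<delta> L))"

text \<open>The counter-clockwise successor of a boundary vertex: rightwards along the bottom row,
  upwards along the right column, leftwards along the top row, downwards along the left column.\<close>

definition ccw_next :: "real \<Rightarrow> real \<Rightarrow> complex \<Rightarrow> complex" where
  "ccw_next \<delta> L v =
    (if Im v = Im (dcorner_b \<delta> L) \<and> v \<noteq> dcorner_c \<delta> L then v + of_real \<delta>
     else if Re v = Re (dcorner_c \<delta> L) \<and> v \<noteq> dcorner_d \<delta> L then v + \<i> * of_real \<delta>
     else if Im v = Im (dcorner_d \<delta> L) \<and> v \<noteq> dcorner_a \<delta> L then v - of_real \<delta>
     else v - \<i> * of_real \<delta>)"

text \<open>\<open>ccw_arc \<delta> L u v\<close> is the arc \<open>[u, v)\<close>.\<close>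

definition ccw_arc :: "real \<Rightarrow> real \<Rightarrow> complex \<Rightarrow> complex \<Rightarrow> complex set" where
  "ccw_arc \<delta> L u v =
    {(ccw_next \<delta> L ^^ k) u | k. \<forall>j\<le>k. (ccw_next \<delta> L ^^ j) u \<noteq> v}"

definition arc_ab :: "real \<Rightarrow> real \<Rightarrow> complex set" where
  "arc_ab \<delta> L = ccw_arc \<delta> L (dcorner_a \<delta> L) (dcorner_b \<delta> L)"

definition arc_bc :: "real \<Rightarrow> real \<Rightarrow> complex set" where
  "arc_bc \<delta> L = ccw_arc \<delta> L (dcorner_b \<delta> L) (dcorner_c \<delta> L)"

definition arc_cd :: "real \<Rightarrow> real \<Rightarrow> complex set" where
  "arc_cd \<delta> L = ccw_arc \<delta> L (dcorner_c \<delta> L) (dcorner_d \<delta> L)"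

definition arc_da :: "real \<Rightarrow> real \<Rightarrow> complex set" where
  "arc_da \<delta> L = ccw_arc \<delta> L (dcorner_d \<delta> L) (dcorner_a \<delta> L)"


section \<open>Continuous-time simple random walk\<close>

text \<open>The sample space carries i.i.d. pairs of a uniform unit step and an independent exponential
  holding time of mean 1.\<close>

definition walk_space :: "(nat \<Rightarrow> complex \<times> real) measure" where
  "walk_space = (\<Pi>\<^sub>M n\<in>UNIV. measure_pmf (pmf_of_set {1, \<i>, -1, -\<i>})
                    \<Otimes>\<^sub>M density lborel (\<lambda>t. ennreal (exponential_density 1 t)))"

definition jump_chain :: "real \<Rightarrow> complex \<Rightarrow> (nat \<Rightarrow> complex \<times> real) \<Rightarrow> nat \<Rightarrow> complex" where
  "jump_chain \<delta> v w n = v + of_real \<delta> * (\<Sum>k<n. fst (w k))"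

definition jump_time :: "(nat \<Rightarrow> complex \<times> real) \<Rightarrow> nat \<Rightarrow> real" where
  "jump_time w n = (\<Sum>k<n. snd (w k))"

definition walk :: "real \<Rightarrow> complex \<Rightarrow> (nat \<Rightarrow> complex \<times> real) \<Rightarrow> real \<Rightarrow> complex" where
  "walk \<delta> v w t = jump_chain \<delta> v w (LEAST n. t < jump_time w (Suc n))"

definition hit_time :: "real \<Rightarrow> real \<Rightarrow> complex \<Rightarrow> (nat \<Rightarrow> complex \<times> real) \<Rightarrow> ereal" where
  "hit_time \<delta> L v w = Inf (ereal ` {t. 0 \<le> t \<and> walk \<delta> v w t \<in> bdry \<delta> L})"

definition harm_ext :: "real \<Rightarrow> real \<Rightarrow> (complex \<Rightarrow> real) \<Rightarrow> complex \<Rightarrow> real" where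
  "harm_ext \<delta> L f v = (\<integral>w. f (walk \<delta> v w (real_of_ereal (hit_time \<delta> L v w))) \<partial>walk_space)"

definition green :: "real \<Rightarrow> real \<Rightarrow> complex \<Rightarrow> complex \<Rightarrow> real" where
  "green \<delta> L u v =
    enn2real (\<integral>\<^sup>+ w. (\<integral>\<^sup>+ t. indicator {t. 0 \<le> t \<and> ereal t < hit_time \<delta> L u w
                                     \<and> walk \<delta> u w t = v} t \<partial>lborel) \<partial>walk_space)"


section \<open>Discrete Gaussian free field\<close>

text \<open>Degenerate (almost surely constant) Gaussian variables are allowed; the field is
  deterministic on the boundary.\<close>

definition gaussian_rv :: "'w measure \<Rightarrow> ('w \<Rightarrow> real) \<Rightarrow> bool" where
  "gaussian_rv M X \<longleftrightarrow> X \<in> borel_measurable M \<and>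
    ((\<exists>\<mu> \<sigma>. 0 < \<sigma> \<and> distributed M lborel X (\<lambda>x. ennreal (normal_density \<mu> \<sigma> x)))
     \<or> (\<exists>\<mu>. AE w in M. X w = \<mu>))"

definition gaussian_process ::
  "'w measure \<Rightarrow> 'i set \<Rightarrow> ('i \<Rightarrow> 'w \<Rightarrow> real) \<Rightarrow> ('i \<Rightarrow> real) \<Rightarrow> ('i \<Rightarrow> 'i \<Rightarrow> real) \<Rightarrow> bool" where
  "gaussian_process M I X m C \<longleftrightarrow> prob_space M \<and>
    (\<forall>i\<in>I. X i \<in> borel_measurable M) \<and>
    (\<forall>J a. finite J \<longrightarrow> J \<subseteq> I \<longrightarrow> gaussian_rv M (\<lambda>w. \<Sum>i\<in>J. a i * X i w)) \<and>
    (\<forall>i\<in>I. (\<integral>w. X i w \<partial>M) = m i) \<and>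
    (\<forall>i\<in>I. \<forall>j\<in>I. (\<integral>w. (X i w - m i) * (X j w - m j) \<partial>M) = C i j)"

definition discrete_gff ::
  "real \<Rightarrow> real \<Rightarrow> (complex \<Rightarrow> real) \<Rightarrow> 'w measure \<Rightarrow> (complex \<Rightarrow> 'w \<Rightarrow> real) \<Rightarrow> bool" where
  "discrete_gff \<delta> L f M \<phi> \<longleftrightarrow>
    gaussian_process M (Vset \<delta> L) \<phi> (harm_ext \<delta> L f) (green \<delta> L)"

text \<open>The four arcs partition the boundary, so the second case is \<open>[b, c) \<union> [d, a)\<close>; values off
  the boundary are never used.\<close>

definition alternating_bc :: "real \<Rightarrow> real \<Rightarrow> real \<Rightarrow> complex \<Rightarrow> real" where
  "alternating_bc \<delta> L lam v = (if v \<in> arc_ab \<delta> L \<union> arc_cd \<delta> L then lam else - lam)"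

definition nonneg_connected ::
  "real \<Rightarrow> real \<Rightarrow> (complex \<Rightarrow> real) \<Rightarrow> complex set \<Rightarrow> complex set \<Rightarrow> bool" where
  "nonneg_connected \<delta> L \<phi> A B \<longleftrightarrow>
    (\<exists>vs. vs \<noteq> [] \<and> hd vs \<in> A \<and> last vs \<in> B \<and> set vs \<subseteq> Vset \<delta> L
        \<and> successively (adjacent \<delta>) vs \<and> (\<forall>v\<in>set vs. 0 \<le> \<phi> v))"


section \<open>The discrete level line\<close>

text \<open>A vertex counts as negative only inside the domain, so that the exploration is a function of
  the field on \<open>Vset \<delta> L\<close>; zero values, which have probability 0, count as positive.\<close>

definition negv :: "real \<Rightarrow> real \<Rightarrow> (complex \<Rightarrow> real) \<Rightarrow> complex \<Rightarrow> bool" where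
  "negv \<delta> L \<phi> v \<longleftrightarrow> v \<in> Vset \<delta> L \<and> \<phi> v < 0"

text \<open>A state is a dual vertex \<open>p\<close> with the unit direction \<open>e\<close> of arrival. The vertices behind
  \<open>p\<close> on the left and right are positive and negative. Looking at the two vertices in front of
  \<open>p\<close>, turning left is admissible iff the left one is negative, and has priority; otherwise going
  straight is admissible iff the right one is negative; otherwise the line turns right.\<close>

definition ll_dir :: "real \<Rightarrow> real \<Rightarrow> (complex \<Rightarrow> real) \<Rightarrow> complex \<Rightarrow> complex \<Rightarrow> complex" where
  "ll_dir \<delta> L \<phi> p e =
    (if negv \<delta> L \<phi> (p + of_real \<delta> * (e + \<i> * e) / 2) then \<i> * e
     else if negv \<delta> L \<phi> (p + of_real \<delta> * (e - \<i> * e) / 2) then e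
     else - \<i> * e)"

text \<open>From the starting point \<open>(0, 3\<delta>/2)\<close> the line first reaches the dual vertex
  \<open>(\<delta>/2, 3\<delta>/2)\<close>, in direction \<open>1\<close>.\<close>

primrec ll_state :: "real \<Rightarrow> real \<Rightarrow> (complex \<Rightarrow> real) \<Rightarrow> nat \<Rightarrow> complex \<times> complex" where
  "ll_state \<delta> L \<phi> 0 = (Complex (\<delta> / 2) (3 * \<delta> / 2), 1)"
| "ll_state \<delta> L \<phi> (Suc n) =
    (let (p, e) = ll_state \<delta> L \<phi> n; e' = ll_dir \<delta> L \<phi> p e in (p + of_real \<delta> * e', e'))"

text \<open>The line hits the segments \<open>[c, d)\<close>, \<open>[d, a)\<close> when one of the two vertices flanking
  (on the left and on the right) its last step belongs to them.\<close>

definition ll_hits :: "real \<Rightarrow> real \<Rightarrow> complex \<times> complex \<Rightarrow> bool" where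
  "ll_hits \<delta> L s \<longleftrightarrow> (case s of (p, e) \<Rightarrow>
     p - of_real \<delta> * (e - \<i> * e) / 2 \<in> arc_cd \<delta> L \<union> arc_da \<delta> L \<or>
     p - of_real \<delta> * (e + \<i> * e) / 2 \<in> arc_cd \<delta> L \<union> arc_da \<delta> L)"

fun polyline :: "complex list \<Rightarrow> real \<Rightarrow> complex" where
  "polyline [] = linepath 0 0"
| "polyline [p] = linepath p p"
| "polyline [p, q] = linepath p q"
| "polyline (p # q # r # ps) = linepath p q +++ polyline (q # r # ps)"

definition level_line :: "real \<Rightarrow> real \<Rightarrow> (complex \<Rightarrow> real) \<Rightarrow> real \<Rightarrow> complex" where
  "level_line \<delta> L \<phi> =
    (let K = (LEAST n. ll_hits \<delta> L (ll_state \<delta> L \<phi> n))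
     in polyline (Complex 0 (3 * \<delta> / 2) # map (\<lambda>n. fst (ll_state \<delta> L \<phi> n)) [0..<Suc K]))"


section \<open>Unparametrized curves and weak convergence of their laws\<close>

text \<open>Curves are represented by parametrizations on \<open>{0..1}\<close> and \<open>curve_dist\<close> is a
  pseudometric on them; functionals continuous for it are invariant under reparametrization.\<close>

definition reparams :: "(real \<Rightarrow> real) set" where
  "reparams = {u. strict_mono_on {0..1} u \<and> (\<exists>v. homeomorphism {0..1} {0..1} u v)}"

definition curve_dist :: "(real \<Rightarrow> complex) \<Rightarrow> (real \<Rightarrow> complex) \<Rightarrow> real" where
  "curve_dist \<eta>1 \<eta>2 =
    (INF (u1, u2) \<in> reparams \<times> reparams. SUP t \<in> {0..1}. cmod (\<eta>1 (u1 t) - \<eta>2 (u2 t)))"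

definition curve_functional :: "((real \<Rightarrow> complex) \<Rightarrow> real) \<Rightarrow> bool" where
  "curve_functional F \<longleftrightarrow>
    (\<exists>B. \<forall>\<eta>. path \<eta> \<longrightarrow> \<bar>F \<eta>\<bar> \<le> B) \<and>
    (\<forall>\<eta>. path \<eta> \<longrightarrow> (\<forall>\<epsilon>>0. \<exists>r>0. \<forall>\<eta>'. path \<eta>' \<longrightarrow> curve_dist \<eta> \<eta>' < r \<longrightarrow> \<bar>F \<eta> - F \<eta>'\<bar> < \<epsilon>))"

definition curve_weak_conv ::
  "('i \<Rightarrow> 'w measure) \<Rightarrow> ('i \<Rightarrow> 'w \<Rightarrow> real \<Rightarrow> complex) \<Rightarrow>
   'v measure \<Rightarrow> ('v \<Rightarrow> real \<Rightarrow> complex) \<Rightarrow> 'i filter \<Rightarrow> bool" where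
  "curve_weak_conv M \<eta> N \<gamma> Fi \<longleftrightarrow>
    (\<forall>F. curve_functional F \<longrightarrow> ((\<lambda>i. \<integral>w. F (\<eta> i w) \<partial>M i) \<longlongrightarrow> (\<integral>w. F (\<gamma> w) \<partial>N)) Fi)"

text \<open>Measurability of all coordinates is Borel measurability for the uniform distance, hence
  also for \<open>curve_dist\<close>.\<close>

definition random_curve :: "'w measure \<Rightarrow> ('w \<Rightarrow> real \<Rightarrow> complex) \<Rightarrow> bool" where
  "random_curve N \<eta> \<longleftrightarrow> (\<forall>w\<in>space N. path (\<eta> w)) \<and>
    (\<forall>s\<in>{0..1}. (\<lambda>w. \<eta> w s) \<in> borel_measurable N)"


section \<open>$\mathrm{SLE}_4(-2;-2)$\<close>

definition brownian_motion :: "'w measure \<Rightarrow> (real \<Rightarrow> 'w \<Rightarrow> real) \<Rightarrow> bool" where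
  "brownian_motion N B \<longleftrightarrow> prob_space N \<and>
    (\<forall>t\<ge>0. B t \<in> borel_measurable N) \<and>
    (AE w in N. B 0 w = 0) \<and>
    (AE w in N. continuous_on {0..} (\<lambda>t. B t w)) \<and>
    (\<forall>s t. 0 \<le> s \<longrightarrow> s < t \<longrightarrow>
       distributed N lborel (\<lambda>w. B t w - B s w) (\<lambda>x. ennreal (normal_density 0 (sqrt (t - s)) x))) \<and>
    (\<forall>ts :: nat \<Rightarrow> real. 0 \<le> ts 0 \<longrightarrow> incseq ts \<longrightarrow>
       prob_space.indep_vars N (\<lambda>_. borel) (\<lambda>k w. B (ts (Suc k)) w - B (ts k) w) UNIV)"

text \<open>The SDE with driving path \<open>B\<close>; its noise is additive, so it is a pathwise integral equation
  with locally Lipschitz drift up to \<open>T\<close>, and \<open>W\<close>, \<open>VL\<close>, \<open>VR\<close> are determined by \<open>B\<close> on \<open>{0..T}\<close>.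
  Since \<open>VL\<close> and \<open>VR\<close> solve the Loewner equation started from \<open>yL\<close> and \<open>yR\<close>, these points are
  swallowed when \<open>VL\<close> resp. \<open>VR\<close> meets \<open>W\<close>; \<open>T\<close> is the first such time.\<close>

definition sle_driving ::
  "real \<Rightarrow> real \<Rightarrow> (real \<Rightarrow> real) \<Rightarrow> (real \<Rightarrow> real) \<Rightarrow> (real \<Rightarrow> real) \<Rightarrow> (real \<Rightarrow> real) \<Rightarrow> real \<Rightarrow> bool" where
  "sle_driving yL yR B W VL VR T \<longleftrightarrow> 0 < T \<and>
    continuous_on {0..T} W \<and> continuous_on {0..T} VL \<and> continuous_on {0..T} VR \<and>
    (\<forall>t. 0 \<le> t \<longrightarrow> t < T \<longrightarrow> VL t < W t \<and> W t < VR t \<and>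
       W t = 2 * B t + integral {0..t} (\<lambda>s. 2 / (VL s - W s) + 2 / (VR s - W s)) \<and>
       VL t = yL + integral {0..t} (\<lambda>s. 2 / (VL s - W s)) \<and>
       VR t = yR + integral {0..t} (\<lambda>s. 2 / (VR s - W s))) \<and>
    (VL T = W T \<or> VR T = W T)"

text \<open>The points of the half-plane whose Loewner flow is defined on the whole of \<open>{0..t}\<close>, that is,
  the complement of the hull at time \<open>t\<close>.\<close>

definition loewner_domain :: "(real \<Rightarrow> real) \<Rightarrow> real \<Rightarrow> complex set" where
  "loewner_domain W t =
    {z \<in> halfplane. \<exists>g. g 0 = z \<and> (\<forall>s\<in>{0..t}. g s \<noteq> complex_of_real (W s) \<and>
        (g has_vector_derivative 2 / (g s - complex_of_real (W s))) (at s within {0..t}))}"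

definition generates :: "(real \<Rightarrow> complex) \<Rightarrow> (real \<Rightarrow> real) \<Rightarrow> real \<Rightarrow> bool" where
  "generates \<gamma> W T \<longleftrightarrow> continuous_on {0..T} \<gamma> \<and> \<gamma> ` {0..T} \<subseteq> {z. 0 \<le> Im z} \<and>
    \<gamma> 0 = complex_of_real (W 0) \<and>
    (\<forall>t\<in>{0..T}. loewner_domain W t =
       {z \<in> halfplane - \<gamma> ` {0..t}.
          \<not> bounded (connected_component_set (halfplane - \<gamma> ` {0..t}) z)})"

definition sle4_halfplane ::
  "'w measure \<Rightarrow> real \<Rightarrow> real \<Rightarrow> ('w \<Rightarrow> real \<Rightarrow> complex) \<Rightarrow> ('w \<Rightarrow> real) \<Rightarrow> bool" where
  "sle4_halfplane N yL yR \<gamma> T \<longleftrightarrow> T \<in> borel_measurable N \<and>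
    (\<exists>B W VL VR. brownian_motion N B \<and>
      (\<forall>t\<ge>0. W t \<in> borel_measurable N \<and> VL t \<in> borel_measurable N \<and> VR t \<in> borel_measurable N) \<and>
      (AE w in N. sle_driving yL yR (\<lambda>t. B t w) (\<lambda>t. W t w) (\<lambda>t. VL t w) (\<lambda>t. VR t w) (T w)
                \<and> generates (\<gamma> w) (\<lambda>t. W t w) (T w)))"

definition conformal_onto :: "(complex \<Rightarrow> complex) \<Rightarrow> complex set \<Rightarrow> complex set \<Rightarrow> bool" where
  "conformal_onto f S S' \<longleftrightarrow> f holomorphic_on S \<and> bij_betw f S S'"

text \<open>The curve may touch the real line, so its image under the inverse of \<open>f\<close> is taken with the
  homeomorphic extension of \<open>f\<close> to the closed rectangle without \<open>d\<close>.\<close>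

definition sle4_rect :: "'w measure \<Rightarrow> real \<Rightarrow> ('w \<Rightarrow> real \<Rightarrow> complex) \<Rightarrow> bool" where
  "sle4_rect N L \<eta> \<longleftrightarrow> random_curve N \<eta> \<and>
    (\<exists>yL yR f h \<gamma> T. yL < 0 \<and> 0 < yR \<and>
      conformal_onto f (rect L) halfplane \<and>
      homeomorphism (closure (rect L) - {corner_d L}) {z. 0 \<le> Im z} f h \<and>
      f corner_a = complex_of_real yL \<and> f corner_b = 0 \<and> f (corner_c L) = complex_of_real yR \<and>
      filterlim f at_infinity (at (corner_d L) within rect L) \<and>
      sle4_halfplane N yL yR \<gamma> T \<and>
      (AE w in N. \<forall>s\<in>{0..1}. \<eta> w s = h (\<gamma> w (s * T w))))"


section \<open>The constant $\lambda_0$\<close>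

text \<open>For every rectangle, the level lines of discrete GFFs with alternating boundary condition of
  height \<open>lam\<close> converge in law to SLE. The concrete sample spaces are no restriction: the law of a
  GFF lives on \<open>complex \<Rightarrow> real\<close>, and SLE is a functional of a Brownian path
  \<open>real \<Rightarrow> real\<close>.\<close>

definition level_line_constant :: "real \<Rightarrow> bool" where
  "level_line_constant lam \<longleftrightarrow> 0 < lam \<and>
    (\<forall>L>0. \<exists>(N :: (real \<Rightarrow> real) measure) \<eta>. sle4_rect N L \<eta> \<and>
      (\<forall>(M :: real \<Rightarrow> (complex \<Rightarrow> real) measure) \<phi>.
        (\<forall>\<delta>. 0 < \<delta> \<longrightarrow> \<delta> \<le> min L 1 / 3 \<longrightarrow>
           discrete_gff \<delta> L (alternating_bc \<delta> L lam) (M \<delta>) (\<phi> \<delta>)) \<longrightarrow>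
        curve_weak_conv M (\<lambda>\<delta> w. level_line \<delta> L (\<lambda>v. \<phi> \<delta> v w)) N \<eta> (at_right 0)))"

end

theory Submission
  imports Defs
begin

text \<open>The level line started at \<open>b\<close> has a nonnegative nearest-neighbour chain along its left side and a
  negative diagonal chain along its right side. Hence it ends near the right side of the rectangle if
  \<open>[a, b)\<close> and \<open>[c, d)\<close> are connected, and near the top side otherwise, and in the limit the
  connection probability is at most the probability that SLE ends on the right side, while the
  complementary probability is at most the probability that it ends on the top side.

  With \<open>X = W - VL\<close>, \<open>Y = VR - W\<close> the SDE reads \<open>dX = 2 dB + 2/Y dt\<close>, \<open>dY = - 2 dB + 2/X dt\<close>, and
  \<open>X / (X + Y)\<close> is a martingale. It remains one for the Euler scheme, so that no stochastic integral is
  needed to see that the right force point is swallowed with probability at most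
  \<open>- yL / (yR - yL)\<close> and the left one with probability at most \<open>yR / (yR - yL)\<close>. A curve whose right
  force point is not swallowed cannot end on the right side, because the hull would have to stop growing
  before the end. Both upper bounds add up to 1, so the limit exists and equals
  \<open>- yL / (yR - yL)\<close>, which is the cross-ratio by conformal invariance.\<close>

section \<open>The Loewner flow\<close>

text \<open>Weak convergence controls closed events of the endpoint, and only from above. The closed
  events "end on the right side" and "end on the top side" meet at \<open>d\<close>, and nothing is
  assumed about the law of SLE near their boundaries. This is harmless: every discrete line
  satisfies one of the two conditions up to \<open>2 * \<delta>\<close>, so only one-sided estimates
  with total 1 are required. For the same reason the exit probability is bounded by Markov's
  inequality on grid events of the Brownian path instead of by optional stopping.

  The link between the end of the curve and swallowing is delicate because \<open>generates\<close>
  describes hulls only through unbounded components. It rests on strict growth of the hulls.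
  Trajectories of the singular field 2 / u are handled through a truncated field that is globally
  Lipschitz; on a surviving trajectory the truncation is inactive by compactness.

  The map \<open>f\<close> of the theorem is finite at \<open>d\<close>, whereas the SLE coordinate
  sends \<open>d\<close> to infinity. The two are compared through Cayley transforms, in which
  infinity is an ordinary point.\<close>

lemma gronwall_norm:
  fixes q q' :: "real \<Rightarrow> 'a::real_inner"
  assumes der: "\<And>t. t \<in> {0..T} \<Longrightarrow> (q has_vector_derivative q' t) (at t within {0..T})"
    and bnd: "\<And>t. t \<in> {0..T} \<Longrightarrow> norm (q' t) \<le> K * norm (q t)"
    and t: "t \<in> {0..T}"
  shows "norm (q t) \<le> norm (q 0) * exp (K * t)" and "norm (q 0) \<le> norm (q t) * exp (K * t)"
proof -
  \<comment> \<open>The squared norm is differentiable even where \<open>q\<close> vanishes. By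
    Cauchy-Schwarz its derivative is at most 2 K u in modulus, so u exp (- 2 K t) decreases and u
    exp (2 K t) increases.\<close>
  define u where "u s = inner (q s) (q s)" for s
  have du: "(u has_real_derivative 2 * inner (q s) (q' s)) (at s within {0..T})" if "s \<in> {0..T}" for s
  proof -
    have "(q has_derivative (\<lambda>x. x *\<^sub>R q' s)) (at s within {0..T})"
      using der[OF that] by (simp add: has_vector_derivative_def)
    from has_derivative_inner[OF this this]
    show ?thesis
      by (simp add: u_def[abs_def] has_field_derivative_def inner_commute algebra_simps
          mult_commute_abs)
  qed
  have ip: "\<bar>2 * inner (q s) (q' s)\<bar> \<le> 2 * K * u s" if "s \<in> {0..T}" for s
  proof -
    have "\<bar>inner (q s) (q' s)\<bar> \<le> norm (q s) * norm (q' s)" by (rule Cauchy_Schwarz_ineq2)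
    also have "\<dots> \<le> norm (q s) * (K * norm (q s))"
      by (rule mult_left_mono[OF bnd[OF that]]) simp
    finally show ?thesis by (simp add: u_def power2_norm_eq_inner[symmetric] power2_eq_square mult_ac)
  qed
  have mono: "f 0 \<le> f t" if df: "\<And>s. s \<in> {0..T} \<Longrightarrow> (f has_real_derivative f' s) (at s within {0..T})"
     and nn: "\<And>s. s \<in> {0..T} \<Longrightarrow> 0 \<le> f' s" for f f' :: "real \<Rightarrow> real"
  proof (rule DERIV_nonneg_imp_increasing_open[of 0 t f])
    show "0 \<le> t" using t by simp
    show "\<exists>y. (f has_real_derivative y) (at x) \<and> 0 \<le> y" if "0 < x" "x < t" for x
    proof -
      have x: "x \<in> {0..T}" "x \<in> interior {0..T}" using that t by auto
      have "at x within {0..T} = at x" by (rule at_within_interior[OF x(2)])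
      with df[OF x(1)] nn[OF x(1)] show ?thesis by auto
    qed
    have "continuous_on {0..T} f"
      by (rule DERIV_continuous_on[OF df])
    then show "continuous_on {0..t} f" using t by (auto intro: continuous_on_subset)
  qed
  have "u 0 * exp (- (2 * K * 0)) \<ge> u t * exp (- (2 * K * t))"
  proof -
    have "- (u 0 * exp (- (2 * K * 0))) \<le> - (u t * exp (- (2 * K * t)))"
    proof (rule mono[where f' = "\<lambda>s. (2 * K * u s - 2 * inner (q s) (q' s)) * exp (- (2 * K * s))"])
      fix s assume s: "s \<in> {0..T}"
      show "((\<lambda>s. - (u s * exp (- (2 * K * s)))) has_real_derivative
         (2 * K * u s - 2 * inner (q s) (q' s)) * exp (- (2 * K * s))) (at s within {0..T})"
        using du[OF s] by (auto intro!: derivative_eq_intros simp: algebra_simps)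
      show "0 \<le> (2 * K * u s - 2 * inner (q s) (q' s)) * exp (- (2 * K * s))"
        using ip[OF s] by (auto intro!: mult_nonneg_nonneg)
    qed
    then show ?thesis by simp
  qed
  then have "u t \<le> u 0 * exp (2 * K * t)"
    by (simp add: exp_minus field_simps)
  then have "(norm (q t))\<^sup>2 \<le> (norm (q 0) * exp (K * t))\<^sup>2"
    by (simp add: u_def power2_norm_eq_inner power_mult_distrib mult.assoc flip: exp_double)
  then show "norm (q t) \<le> norm (q 0) * exp (K * t)"
    by (rule power2_le_imp_le) simp
  have "u 0 * exp (2 * K * 0) \<le> u t * exp (2 * K * t)"
  proof (rule mono[where f' = "\<lambda>s. (2 * K * u s + 2 * inner (q s) (q' s)) * exp (2 * K * s)"])
    fix s assume s: "s \<in> {0..T}"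
    show "((\<lambda>s. (u s * exp (2 * K * s))) has_real_derivative
       (2 * K * u s + 2 * inner (q s) (q' s)) * exp (2 * K * s)) (at s within {0..T})"
      using du[OF s] by (auto intro!: derivative_eq_intros simp: algebra_simps)
    show "0 \<le> (2 * K * u s + 2 * inner (q s) (q' s)) * exp (2 * K * s)"
      using ip[OF s] by (auto intro!: mult_nonneg_nonneg)
  qed
  then have "(norm (q 0))\<^sup>2 \<le> (norm (q t) * exp (K * t))\<^sup>2"
    by (simp add: u_def power2_norm_eq_inner power_mult_distrib mult.assoc flip: exp_double)
  then show "norm (q 0) \<le> norm (q t) * exp (K * t)"
    by (rule power2_le_imp_le) simp
qed

text \<open>Banach's fixed point theorem on all of {0..T} at once: unknowns are divided by the
  weight exp (2 K t), and in the resulting norm the integral operator has Lipschitz constant 1/2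
  whatever \<open>T\<close> is, so no short-time solutions are glued.\<close>

lemma picard_lindelof:
  fixes v :: "real \<Rightarrow> 'a::banach \<Rightarrow> 'a"
  assumes T: "0 \<le> T" and K: "0 < K"
    and lip: "\<And>t x y. t \<in> {0..T} \<Longrightarrow> norm (v t x - v t y) \<le> K * norm (x - y)"
    and cont: "\<And>z. continuous_on {0..T} z \<Longrightarrow> continuous_on {0..T} (\<lambda>t. v t (z t))"
  obtains z where "z 0 = w"
    "\<And>t. t \<in> {0..T} \<Longrightarrow> (z has_vector_derivative v t (z t)) (at t within {0..T})"
proof -
  \<comment> \<open>The fixed point is sought among bounded continuous functions on the whole line;
    clamping time to {0..T} brings the values of the operator into that type.\<close>
  define cl where "cl t = max 0 (min T t)" for t
  have cl: "cl t \<in> {0..T}" for t using T by (auto simp: cl_def)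
  have cl_id: "cl t = t" if "t \<in> {0..T}" for t using that by (auto simp: cl_def)
  have ccl: "continuous_on UNIV cl" unfolding cl_def by (intro continuous_intros)
  \<comment> \<open>\<open>up f\<close> restores the weight; \<open>G\<close> applies the integral
    operator and removes the weight again.\<close>
  define up where "up f s = exp (2 * K * s) *\<^sub>R apply_bcontfun f s" for f :: "real \<Rightarrow>\<^sub>C 'a" and s
  define G where "G f t = exp (- 2 * K * t) *\<^sub>R (w + integral {0..t} (\<lambda>s. v s (up f s)))" for f t
  have cup: "continuous_on {0..T} (up f)" for f
    unfolding up_def by (intro continuous_intros continuous_on_subset[OF continuous_on_apply_bcontfun]) auto
  have cv: "continuous_on {0..T} (\<lambda>s. v s (up f s))" for f by (rule cont[OF cup])
  have cG: "continuous_on {0..T} (G f)" for f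
    unfolding G_def
    by (intro continuous_intros indefinite_integral_continuous_1 integrable_continuous_interval cv)
  have bc: "(\<lambda>t. G f (cl t)) \<in> bcontfun" for f
  proof -
    have c: "continuous_on UNIV (\<lambda>t. G f (cl t))"
      by (rule continuous_on_compose2[OF cG ccl]) (use cl in blast)
    have b: "bounded (G f ` {0..T})"
      using cG by (intro compact_imp_bounded compact_continuous_image) auto
    then have "bounded (range (\<lambda>t. G f (cl t)))"
      by (rule bounded_subset) (use cl in blast)
    with c show ?thesis by (simp add: bcontfun_def)
  qed
  define Phi where "Phi f = Bcontfun (\<lambda>t. G f (cl t))" for f
  have Phi: "apply_bcontfun (Phi f) t = G f (cl t)" for f t
    unfolding Phi_def by (simp add: Bcontfun_inverse[OF bc])
  have contr: "dist (Phi f) (Phi g) \<le> (1/2) * dist f g" for f g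
  proof (rule dist_bound)
    fix t0 define t where "t = cl t0"
    have t: "t \<in> {0..T}" using cl by (simp add: t_def)
    have sub: "{0..t} \<subseteq> {0..T}" using t by auto
    have ii: "(\<lambda>s. v s (up f s)) integrable_on {0..t}" for f
      by (rule integrable_continuous_interval[OF continuous_on_subset[OF cv sub]])
    have "((\<lambda>s. K * exp (2 * K * s) * dist f g) has_integral
        (exp (2 * K * t) / 2 * dist f g - exp (2 * K * 0) / 2 * dist f g)) {0..t}"
      using t K
      by (intro fundamental_theorem_of_calculus)
         (auto intro!: derivative_eq_intros simp flip: has_real_derivative_iff_has_vector_derivative)
    then have hi: "((\<lambda>s. K * exp (2 * K * s) * dist f g) has_integral
        ((exp (2 * K * t) - 1) / 2 * dist f g)) {0..t}" by (simp add: algebra_simps diff_divide_distrib)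
    have "norm (integral {0..t} (\<lambda>s. v s (up f s)) - integral {0..t} (\<lambda>s. v s (up g s)))
      = norm (integral {0..t} (\<lambda>s. v s (up f s) - v s (up g s)))"
      by (simp add: integral_diff[OF ii ii])
    also have "\<dots> \<le> integral {0..t} (\<lambda>s. K * exp (2 * K * s) * dist f g)"
    proof (rule integral_norm_bound_integral)
      show "(\<lambda>s. v s (up f s) - v s (up g s)) integrable_on {0..t}" by (intro integrable_diff ii)
      show "(\<lambda>s. K * exp (2 * K * s) * dist f g) integrable_on {0..t}" using hi by blast
      fix s assume "s \<in> {0..t}"
      then have s: "s \<in> {0..T}" using sub by auto
      have "norm (v s (up f s) - v s (up g s)) \<le> K * norm (up f s - up g s)" by (rule lip[OF s])
      also have "norm (up f s - up g s) = exp (2 * K * s) * dist (apply_bcontfun f s) (apply_bcontfun g s)"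
        by (simp add: up_def dist_norm flip: scaleR_right_diff_distrib)
      also have "\<dots> \<le> exp (2 * K * s) * dist f g" by (intro mult_left_mono dist_bounded) auto
      finally show "norm (v s (up f s) - v s (up g s)) \<le> K * exp (2 * K * s) * dist f g"
        using K by (simp add: mult_ac)
    qed
    also have "\<dots> = (exp (2 * K * t) - 1) / 2 * dist f g" using hi by (rule integral_unique)
    finally have *: "norm (integral {0..t} (\<lambda>s. v s (up f s)) - integral {0..t} (\<lambda>s. v s (up g s)))
        \<le> (exp (2 * K * t) - 1) / 2 * dist f g" .
    have "dist (apply_bcontfun (Phi f) t0) (apply_bcontfun (Phi g) t0)
       = exp (- 2 * K * t) * norm (integral {0..t} (\<lambda>s. v s (up f s)) - integral {0..t} (\<lambda>s. v s (up g s)))"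
      by (simp add: Phi G_def dist_norm flip: scaleR_right_diff_distrib t_def)
    also have "\<dots> \<le> exp (- 2 * K * t) * ((exp (2 * K * t) - 1) / 2 * dist f g)"
      by (rule mult_left_mono[OF *]) simp
    also have "\<dots> = (1 - exp (- 2 * K * t)) / 2 * dist f g"
      by (simp add: exp_minus field_simps)
    also have "\<dots> \<le> 1 / 2 * dist f g"
      by (intro mult_right_mono) auto
    finally show "dist (apply_bcontfun (Phi f) t0) (apply_bcontfun (Phi g) t0) \<le> (1/2) * dist f g" .
  qed
  have "\<exists>!f. Phi f = f" by (rule banach_fix_type[where c="1/2"]) (use contr in auto)
  then obtain f where f: "Phi f = f" by blast
  define z where "z t = w + integral {0..t} (\<lambda>s. v s (up f s))" for t
  have zup: "up f t = z t" if "t \<in> {0..T}" for t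
  proof -
    have "apply_bcontfun f t = G f t" using Phi[of f t] f cl_id[OF that] by simp
    then show ?thesis by (simp add: up_def G_def z_def flip: exp_add)
  qed
  show thesis
  proof
    show "z 0 = w" by (simp add: z_def)
    fix t assume t: "t \<in> {0..T}"
    have "((\<lambda>u. integral {0..u} (\<lambda>s. v s (up f s))) has_vector_derivative v t (up f t)) (at t within {0..T})"
      by (rule integral_has_vector_derivative[OF cv t])
    then show "(z has_vector_derivative v t (z t)) (at t within {0..T})"
      unfolding z_def zup[OF t, unfolded z_def, symmetric]
      by (auto intro!: derivative_eq_intros simp: zup[OF t, unfolded z_def])
  qed
qed

text \<open>Since 2 / u = 2 conj(u) / |u|^2, replacing |u| by the maximum of |u| and m > 0 gives a
  bounded, globally Lipschitz field that agrees with 2 / u outside the disc of radius m.\<close>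

definition lfield :: "real \<Rightarrow> complex \<Rightarrow> complex" where
  "lfield m u = 2 * cnj u / of_real ((max (cmod u) m)\<^sup>2)"

lemma lfield_eq: "m \<le> cmod u \<Longrightarrow> lfield m u = 2 / u"
  by (cases "u = 0") (simp_all add: lfield_def max_def complex_norm_square[symmetric] divide_simps mult.commute[of "cnj u"])

lemma norm_lfield_le: "0 < m \<Longrightarrow> cmod (lfield m u) \<le> 2 / m"
proof -
  assume m: "0 < m"
  define M where "M = max (cmod u) m"
  have M: "cmod u \<le> M" "m \<le> M" "0 < M" using m by (auto simp: M_def)
  have "cmod (lfield m u) = 2 * cmod u / M\<^sup>2"
    using M by (simp add: lfield_def norm_divide norm_mult M_def[symmetric] norm_power)
  also have "\<dots> \<le> 2 * M / M\<^sup>2" using M by (intro divide_right_mono) auto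
  also have "\<dots> = 2 / M" using M by (simp add: power2_eq_square)
  also have "\<dots> \<le> 2 / m" using M m by (intro divide_left_mono) auto
  finally show ?thesis .
qed

text \<open>With truncated moduli \<open>M\<close> and \<open>N\<close> the difference is twice
  (conj u - conj v) / M^2 + conj v (1 / M^2 - 1 / N^2). The first summand is at most |u - v| / m^2
  and the second at most twice that, because |v| \<le> N and |N - M| \<le> |u - v|; hence 6 = 2 (1 +
  2).\<close>

lemma lfield_lipschitz:
  assumes m: "0 < m"
  shows "cmod (lfield m u - lfield m v) \<le> 6 / m\<^sup>2 * cmod (u - v)"
proof -
  define M where "M = max (cmod u) m"
  define N where "N = max (cmod v) m"
  have M: "m \<le> M" "0 < M" and N: "cmod v \<le> N" "m \<le> N" "0 < N" using m by (auto simp: M_def N_def)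
  have MN: "\<bar>N - M\<bar> \<le> cmod (u - v)"
    using norm_triangle_ineq3[of u v] norm_ge_zero[of "u - v"] unfolding M_def N_def by linarith
  define w where "w = (cnj u - cnj v) / of_real (M\<^sup>2) + cnj v * of_real ((N - M) * (N + M) / (M\<^sup>2 * N\<^sup>2))"
  have "lfield m u - lfield m v = 2 * w"
  proof -
    have "(of_real ((N - M) * (N + M) / (M\<^sup>2 * N\<^sup>2)) :: complex) = of_real (1 / M\<^sup>2 - 1 / N\<^sup>2)"
      using M N by (intro arg_cong[where f=of_real]) (simp add: field_simps power2_eq_square)
    then have w: "w = (cnj u - cnj v) * (1 / of_real (M\<^sup>2)) + cnj v * (1 / of_real (M\<^sup>2) - 1 / of_real (N\<^sup>2))"
      unfolding w_def by simp
    have l: "lfield m u = 2 * cnj u * (1 / of_real (M\<^sup>2))" "lfield m v = 2 * cnj v * (1 / of_real (N\<^sup>2))"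
      by (simp_all add: lfield_def M_def N_def)
    show ?thesis unfolding w l by (simp only: ring_distribs) simp
  qed
  then have "cmod (lfield m u - lfield m v) = 2 * cmod w" by (simp add: norm_mult)
  also have "cmod w \<le> cmod (u - v) / M\<^sup>2 + cmod v * (\<bar>N - M\<bar> * (N + M) / (M\<^sup>2 * N\<^sup>2))"
  proof -
    have "cmod w \<le> cmod ((cnj u - cnj v) / of_real (M\<^sup>2)) + cmod (cnj v * of_real ((N - M) * (N + M) / (M\<^sup>2 * N\<^sup>2)))"
      unfolding w_def by (rule norm_triangle_ineq)
    also have "\<dots> = cmod (u - v) / M\<^sup>2 + cmod v * (\<bar>N - M\<bar> * (N + M) / (M\<^sup>2 * N\<^sup>2))"
      using M N by (simp add: norm_divide norm_mult norm_power abs_mult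
          del: of_real_diff of_real_add of_real_mult flip: complex_cnj_diff)
    finally show ?thesis .
  qed
  also have "cmod v * (\<bar>N - M\<bar> * (N + M) / (M\<^sup>2 * N\<^sup>2)) \<le> N * (cmod (u - v) * (N + M) / (M\<^sup>2 * N\<^sup>2))"
    using M N MN by (intro mult_mono divide_right_mono) auto
  also have "N * (cmod (u - v) * (N + M) / (M\<^sup>2 * N\<^sup>2)) = cmod (u - v) * (1 / M\<^sup>2 + 1 / (M * N))"
    using M N by (simp add: field_simps power2_eq_square)
  also have "\<dots> \<le> cmod (u - v) * (1 / m\<^sup>2 + 1 / (m * m))"
    using M N m by (intro mult_left_mono add_mono divide_left_mono power_mono mult_mono) auto
  also have "cmod (u - v) / M\<^sup>2 \<le> cmod (u - v) / m\<^sup>2"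
    using M N m by (intro divide_left_mono power_mono) auto
  finally show ?thesis by (simp add: power2_eq_square algebra_simps)
qed

lemma continuous_on_lfield: "0 < m \<Longrightarrow> continuous_on A f \<Longrightarrow> continuous_on A (\<lambda>t. lfield m (f t))"
  unfolding lfield_def
  by (intro continuous_intros) (auto simp: max_def)

text \<open>The start is unrestricted, so real force points are covered as well as points of the
  half-plane.\<close>

definition loewner_solution :: "(real \<Rightarrow> real) \<Rightarrow> real \<Rightarrow> (real \<Rightarrow> complex) \<Rightarrow> bool" where
  "loewner_solution W T g \<longleftrightarrow> (\<forall>s\<in>{0..T}. g s \<noteq> complex_of_real (W s) \<and>
        (g has_vector_derivative 2 / (g s - complex_of_real (W s))) (at s within {0..T}))"

section \<open>Loewner trajectories: uniqueness and stability\<close>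

lemma loewner_domain_eq:
  "loewner_domain W T = {z \<in> halfplane. \<exists>g. g 0 = z \<and> loewner_solution W T g}"
  by (simp add: loewner_domain_def loewner_solution_def)

lemma loewner_solution_continuous: "loewner_solution W T g \<Longrightarrow> continuous_on {0..T} g"
  unfolding loewner_solution_def continuous_on_eq_continuous_within
  by (blast intro: has_vector_derivative_continuous)

lemma loewner_solution_subset:
  "loewner_solution W T g \<Longrightarrow> S \<le> T \<Longrightarrow> loewner_solution W S g"
  unfolding loewner_solution_def
  by (auto intro: has_vector_derivative_within_subset[where S="{0..T}"])

lemma loewner_solution_shift:
  assumes "loewner_solution W T g" "0 \<le> s"
  shows "loewner_solution (\<lambda>t. W (s + t)) (T - s) (\<lambda>t. g (s + t))"
  unfolding loewner_solution_def
proof safe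
  fix t assume t: "t \<in> {0..T - s}"
  then have st: "s + t \<in> {0..T}" using assms by auto
  show "g (s + t) = complex_of_real (W (s + t)) \<Longrightarrow> False"
    using assms st by (auto simp: loewner_solution_def)
  have "(g has_vector_derivative 2 / (g (s + t) - W (s + t))) (at (s + t) within {0..T})"
    using assms st by (auto simp: loewner_solution_def)
  then have g: "(g has_vector_derivative 2 / (g (s + t) - W (s + t))) (at (s + t) within ((+) s ` {0..T-s}))"
    by (rule has_vector_derivative_within_subset) (use assms in auto)
  have "((+) s has_real_derivative 1) (at t within {0..T-s})"
    by (auto intro!: derivative_eq_intros)
  from vector_diff_chain_within[OF this[unfolded has_real_derivative_iff_has_vector_derivative] g]
 show "((\<lambda>t. g (s + t)) has_vector_derivative 2 / (g (s + t) - complex_of_real (W (s + t))))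
          (at t within {0..T - s})" by (simp add: o_def)
qed

text \<open>By compactness; at such a distance \<open>m\<close> the truncated and the true field
  agree along the trajectory.\<close>

lemma loewner_solution_away:
  assumes "loewner_solution W T g" "continuous_on {0..T} W" "0 \<le> T"
  obtains m where "0 < m" "\<And>t. t \<in> {0..T} \<Longrightarrow> m \<le> cmod (g t - W t)"
proof -
  have "continuous_on {0..T} (\<lambda>t. cmod (g t - W t))"
    by (intro continuous_intros loewner_solution_continuous[OF assms(1)] assms)
  then obtain t0 where t0: "t0 \<in> {0..T}" "\<And>t. t \<in> {0..T} \<Longrightarrow> cmod (g t0 - W t0) \<le> cmod (g t - W t)"
    using continuous_attains_inf[of "{0..T}" "\<lambda>t. cmod (g t - W t)"] assms(3) by auto
  have "0 < cmod (g t0 - W t0)" using assms(1) t0(1) by (simp add: loewner_solution_def)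
  with t0 that show thesis by blast
qed

text \<open>Here \<open>f\<close> solves only the truncated equation. As the truncation is inactive
  along \<open>g\<close>, both solve the same Lipschitz equation, and Gronwall applies before
  anything is known about the distance of \<open>f\<close> from the driving function.\<close>

lemma loewner_solution_dist:
  assumes g: "loewner_solution W T g" "\<And>t. t \<in> {0..T} \<Longrightarrow> m \<le> cmod (g t - W t)"
    and f: "\<And>t. t \<in> {0..T} \<Longrightarrow> (f has_vector_derivative lfield m (f t - W t)) (at t within {0..T})"
    and m: "0 < m" and t: "t \<in> {0..T}"
  shows "cmod (f t - g t) \<le> cmod (f 0 - g 0) * exp (6 / m\<^sup>2 * t)"
proof -
  have d: "((\<lambda>t. f t - g t) has_vector_derivative lfield m (f s - W s) - lfield m (g s - W s)) (at s within {0..T})"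
    if "s \<in> {0..T}" for s
    using f[OF that] g(1) that lfield_eq[OF g(2)[OF that]]
    by (auto intro!: derivative_eq_intros simp: loewner_solution_def)
  have b: "cmod (lfield m (f s - W s) - lfield m (g s - W s)) \<le> 6 / m\<^sup>2 * cmod (f s - g s)" for s
    using lfield_lipschitz[OF m, of "f s - W s" "g s - W s"] by simp
  show "cmod (f t - g t) \<le> cmod (f 0 - g 0) * exp (6 / m\<^sup>2 * t)"
    by (rule gronwall_norm(1)[OF d b t])
qed

lemma loewner_solution_lfield:
  assumes "loewner_solution W T g" "\<And>t. t \<in> {0..T} \<Longrightarrow> m \<le> cmod (g t - W t)" "t \<in> {0..T}"
  shows "(g has_vector_derivative lfield m (g t - W t)) (at t within {0..T})"
  using assms lfield_eq[OF assms(2)[OF assms(3)]] by (auto simp: loewner_solution_def)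

lemma lfield_loewner_solution:
  assumes "0 < m" "\<And>t. t \<in> {0..T} \<Longrightarrow> m \<le> cmod (g t - W t)"
    "\<And>t. t \<in> {0..T} \<Longrightarrow> (g has_vector_derivative lfield m (g t - W t)) (at t within {0..T})"
  shows "loewner_solution W T g"
  unfolding loewner_solution_def
proof safe
  fix t assume t: "t \<in> {0..T}"
  show "g t = complex_of_real (W t) \<Longrightarrow> False" using assms(2)[OF t] assms(1) by auto
  show "(g has_vector_derivative 2 / (g t - complex_of_real (W t))) (at t within {0..T})"
    using assms(3)[OF t] lfield_eq[OF assms(2)[OF t]] by simp
qed

lemma loewner_solution_unique:
  assumes f: "loewner_solution W T f" and g: "loewner_solution W T g"
    and W: "continuous_on {0..T} W" and eq: "f 0 = g 0" and t: "t \<in> {0..T}"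
  shows "f t = g t"
proof -
  have T: "0 \<le> T" using t by auto
  obtain m1 where m1: "0 < m1" "\<And>t. t \<in> {0..T} \<Longrightarrow> m1 \<le> cmod (f t - W t)"
    using loewner_solution_away[OF f W T] by blast
  obtain m2 where m2: "0 < m2" "\<And>t. t \<in> {0..T} \<Longrightarrow> m2 \<le> cmod (g t - W t)"
    using loewner_solution_away[OF g W T] by blast
  define m where "m = min m1 m2"
  have m: "0 < m" and fm: "\<And>t. t \<in> {0..T} \<Longrightarrow> m \<le> cmod (f t - W t)"
    and gm: "\<And>t. t \<in> {0..T} \<Longrightarrow> m \<le> cmod (g t - W t)"
    using m1 m2 by (force simp: m_def)+
  have "cmod (f t - g t) \<le> cmod (f 0 - g 0) * exp (6 / m\<^sup>2 * t)"
    by (rule loewner_solution_dist[OF g gm loewner_solution_lfield[OF f fm] m t])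
  then show ?thesis using eq by simp
qed

text \<open>The factor \<open>c\<close> serves both directions of time: 1 for the flow, -1 for its
  reversal. The summand 1 in the Lipschitz constant keeps it positive.\<close>

lemma lfield_flow_exists:
  assumes "0 < m" "0 \<le> T" "continuous_on {0..T} W"
  obtains g where "g 0 = w"
    "\<And>t. t \<in> {0..T} \<Longrightarrow> (g has_vector_derivative c * lfield m (g t - complex_of_real (W t))) (at t within {0..T})"
proof (rule picard_lindelof[of T "(cmod c + 1) * (6 / m\<^sup>2)" "\<lambda>t x. c * lfield m (x - complex_of_real (W t))" w])
  show "0 \<le> T" by fact
  show "0 < (cmod c + 1) * (6 / m\<^sup>2)" using assms
    by (intro mult_pos_pos divide_pos_pos) (auto intro: add_nonneg_pos)
  show "cmod (c * lfield m (x - complex_of_real (W t)) - c * lfield m (y - complex_of_real (W t)))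
      \<le> (cmod c + 1) * (6 / m\<^sup>2) * cmod (x - y)" for t x y
  proof -
    have "cmod (lfield m (x - complex_of_real (W t)) - lfield m (y - complex_of_real (W t))) \<le> 6 / m\<^sup>2 * cmod (x - y)"
      using lfield_lipschitz[OF assms(1), of "x - W t" "y - W t"] by simp
    then have "cmod c * cmod (lfield m (x - complex_of_real (W t)) - lfield m (y - complex_of_real (W t)))
       \<le> (cmod c + 1) * (6 / m\<^sup>2 * cmod (x - y))"
      by (intro mult_mono) auto
    then show ?thesis by (simp only: norm_mult mult.assoc flip: right_diff_distrib)
  qed
  show "continuous_on {0..T} (\<lambda>t. c * lfield m (z t - complex_of_real (W t)))"
    if "continuous_on {0..T} z" for z
    by (intro continuous_intros continuous_on_lfield assms that)
qed (rule that)

text \<open>Survival up to \<open>T\<close> is an open condition. The margin \<open>m\<close> is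
  half the distance of \<open>g\<close> from the driving function: a truncated trajectory started
  within \<open>m / C\<close> of \<open>g 0\<close> stays within \<open>m\<close> of
  \<open>g\<close>, hence at distance at least \<open>m\<close> from the driving function, where it
  is a true solution.\<close>

lemma loewner_solution_stable:
  assumes g: "loewner_solution W T g" and W: "continuous_on {0..T} W" and T: "0 \<le> T"
  obtains r C m where "0 < r" "0 < m" "\<And>t. t \<in> {0..T} \<Longrightarrow> m \<le> cmod (g t - W t)"
    "\<And>w. cmod (w - g 0) < r \<Longrightarrow> \<exists>f. f 0 = w \<and> loewner_solution W T f \<and>
        (\<forall>t\<in>{0..T}. m \<le> cmod (f t - W t) \<and> cmod (f t - g t) \<le> C * cmod (w - g 0))"
proof -
  obtain m' where m': "0 < m'" "\<And>t. t \<in> {0..T} \<Longrightarrow> m' \<le> cmod (g t - W t)"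
    using loewner_solution_away[OF g W T] by blast
  define m where "m = m' / 2"
  have m: "0 < m" "\<And>t. t \<in> {0..T} \<Longrightarrow> 2 * m \<le> cmod (g t - W t)" using m' by (auto simp: m_def)
  then have gm: "\<And>t. t \<in> {0..T} \<Longrightarrow> m \<le> cmod (g t - W t)" by force
  define C where "C = exp (6 / m\<^sup>2 * T)"
  have C: "C > 0" by (simp add: C_def)
  show thesis
  proof (rule that[of "m / C" m C])
    show "0 < m / C" "0 < m" using m C by auto
    show "m \<le> cmod (g t - W t)" if "t \<in> {0..T}" for t using gm that .
    fix w assume w: "cmod (w - g 0) < m / C"
    obtain f where f: "f 0 = w"
      "\<And>t. t \<in> {0..T} \<Longrightarrow> (f has_vector_derivative 1 * lfield m (f t - complex_of_real (W t))) (at t within {0..T})"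
      using lfield_flow_exists[OF m(1) T W, of w 1] by blast
    note f2 = f(2)[unfolded mult_1]
    have d: "cmod (f t - g t) \<le> C * cmod (w - g 0)" if t: "t \<in> {0..T}" for t
    proof -
      have "cmod (f t - g t) \<le> cmod (f 0 - g 0) * exp (6 / m\<^sup>2 * t)"
        by (rule loewner_solution_dist[OF g gm f2 m(1) t])
      also have "\<dots> \<le> cmod (f 0 - g 0) * C"
        unfolding C_def using t m by (intro mult_left_mono) (auto intro!: divide_right_mono)
      finally show ?thesis by (simp add: f mult.commute)
    qed
    have b: "m \<le> cmod (f t - W t)" if t: "t \<in> {0..T}" for t
    proof -
      have "cmod (f t - g t) \<le> m" using d[OF t] w C by (simp add: field_simps)
      moreover have "cmod (g t - W t) \<le> cmod (f t - W t) + cmod (f t - g t)"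
        using norm_triangle_ineq4[of "f t - W t" "f t - g t"] by simp
      ultimately show ?thesis using m(2)[OF t] by linarith
    qed
    show "\<exists>f. f 0 = w \<and> loewner_solution W T f \<and>
        (\<forall>t\<in>{0..T}. m \<le> cmod (f t - W t) \<and> cmod (f t - g t) \<le> C * cmod (w - g 0))"
      using f(1) lfield_loewner_solution[OF m(1) b f2] b d by (intro exI[of _ f]) auto
  qed
qed

text \<open>A nonpositive value would produce a zero, and the lower Gronwall bound at that zero
  would make \<open>q 0\<close> vanish.\<close>

lemma gronwall_pos:
  fixes q q' :: "real \<Rightarrow> real"
  assumes der: "\<And>t. t \<in> {0..T} \<Longrightarrow> (q has_vector_derivative q' t) (at t within {0..T})"
    and bnd: "\<And>t. t \<in> {0..T} \<Longrightarrow> \<bar>q' t\<bar> \<le> K * \<bar>q t\<bar>"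
    and t: "t \<in> {0..T}" and pos: "0 < q 0"
  shows "0 < q t"
proof (rule ccontr)
  assume "\<not> 0 < q t"
  have "continuous_on {0..T} q"
    unfolding continuous_on_eq_continuous_within by (blast intro: has_vector_derivative_continuous der)
  then have "continuous_on {0..t} q" by (rule continuous_on_subset) (use t in auto)
  with IVT2'[of q t 0 0] \<open>\<not> 0 < q t\<close> pos t obtain s where s: "0 \<le> s" "s \<le> t" "q s = 0" by auto
  have "norm (q 0) \<le> norm (q s) * exp (K * s)"
    by (rule gronwall_norm(2)[OF der]) (use bnd s t in auto)
  with s pos show False by simp
qed

section \<open>Imaginary parts, time reversal and distant starting points\<close>

lemma Im_lfield: "Im (lfield m u) = - 2 * Im u / (max (cmod u) m)\<^sup>2"
  unfolding lfield_def by (simp flip: of_real_power)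

text \<open>The imaginary part y satisfies y' = - 2 y / |g - W|^2, with a coefficient bounded by 2 /
  m^2. So it stays positive, and then its derivative is negative.\<close>

lemma loewner_solution_Im:
  assumes g: "loewner_solution W T g" and W: "continuous_on {0..T} W"
    and pos: "0 < Im (g 0)" and t: "t \<in> {0..T}"
  shows "0 < Im (g t)" and "0 < t \<Longrightarrow> Im (g t) < Im (g 0)"
proof -
  have T: "0 \<le> T" using t by auto
  obtain m where m: "0 < m" "\<And>t. t \<in> {0..T} \<Longrightarrow> m \<le> cmod (g t - W t)"
    using loewner_solution_away[OF g W T] by blast
  define q' where "q' t = - (2 * Im (g t) / (cmod (g t - W t))\<^sup>2)" for t
  have der: "((\<lambda>t. Im (g t)) has_vector_derivative q' t) (at t within {0..T})" if "t \<in> {0..T}" for t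
  proof -
    have "max (cmod (g t - W t)) m = cmod (g t - W t)" using m(2)[OF that] by simp
    then have "Im (lfield m (g t - W t)) = q' t"
      by (simp add: q'_def Im_lfield)
    then show ?thesis
      using bounded_linear.has_vector_derivative[OF bounded_linear_Im loewner_solution_lfield[OF g m(2) that]]
      by simp
  qed
  have bnd: "\<bar>q' t\<bar> \<le> 2 / m\<^sup>2 * \<bar>Im (g t)\<bar>" if "t \<in> {0..T}" for t
  proof -
    have "\<bar>q' t\<bar> = 2 * \<bar>Im (g t)\<bar> / (cmod (g t - W t))\<^sup>2" by (simp add: q'_def abs_mult)
    also have "\<dots> \<le> 2 * \<bar>Im (g t)\<bar> / m\<^sup>2"
      using m(1) m(2)[OF that] by (intro divide_left_mono power_mono mult_pos_pos) (auto intro: zero_less_power)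
    finally show ?thesis by simp
  qed
  have ip: "0 < Im (g t)" if "t \<in> {0..T}" for t
    by (rule gronwall_pos[OF der bnd that pos])
  show "0 < Im (g t)" by (rule ip[OF t])
  assume "0 < t"
  show "Im (g t) < Im (g 0)"
  proof (rule DERIV_neg_imp_decreasing_open[OF \<open>0 < t\<close>])
    fix x assume x: "0 < x" "x < t"
    then have xT: "x \<in> {0..T}" "x \<in> interior {0..T}" using t by auto
    have "((\<lambda>t. Im (g t)) has_real_derivative q' x) (at x)"
      using der[OF xT(1)] at_within_interior[OF xT(2)] by (simp add: has_real_derivative_iff_has_vector_derivative)
    moreover have "q' x < 0"
      unfolding q'_def using ip[OF xT(1)] m(1) m(2)[OF xT(1)]
      by (auto simp: intro!: divide_pos_pos zero_less_power)
    ultimately show "\<exists>y. ((\<lambda>t. Im (g t)) has_real_derivative y) (at x) \<and> y < 0" by blast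
  next
    show "continuous_on {0..t} (\<lambda>t. Im (g t))"
      using t by (intro continuous_intros continuous_on_subset[OF loewner_solution_continuous[OF g]]) auto
  qed
qed

text \<open>Backwards in time the imaginary part grows, so the trajectory stays at height at least
  \<open>Im w\<close> and truncation at \<open>m = Im w\<close> never acts. Thus the flow reaches
  every point of the half-plane.\<close>

lemma loewner_solution_reverse:
  assumes T: "0 \<le> T" and W: "continuous_on {0..T} W" and w: "0 < Im w"
  obtains g where "loewner_solution W T g" "g T = w" "0 < Im (g 0)"
proof -
  define m where "m = Im w"
  have m: "0 < m" using w by (simp add: m_def)
  have refl: "continuous_on {0..T} (\<lambda>t. W (T - t))"
    by (rule continuous_on_compose2[OF W]) (auto intro!: continuous_intros)
  obtain z where z: "z 0 = w"
    "\<And>t. t \<in> {0..T} \<Longrightarrow> (z has_vector_derivative (- 1) * lfield m (z t - complex_of_real (W (T - t)))) (at t within {0..T})"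
    using lfield_flow_exists[OF m T refl, of w "-1"] by blast
  define q' where "q' t = 2 * Im (z t) / (max (cmod (z t - W (T - t))) m)\<^sup>2" for t
  have der: "((\<lambda>t. Im (z t)) has_vector_derivative q' t) (at t within {0..T})" if "t \<in> {0..T}" for t
    using bounded_linear.has_vector_derivative[OF bounded_linear_Im z(2)[OF that]]
    by (simp add: q'_def Im_lfield)
  have bnd: "\<bar>q' t\<bar> \<le> 2 / m\<^sup>2 * \<bar>Im (z t)\<bar>" if "t \<in> {0..T}" for t
  proof -
    have "\<bar>q' t\<bar> = 2 * \<bar>Im (z t)\<bar> / (max (cmod (z t - W (T - t))) m)\<^sup>2" by (simp add: q'_def abs_mult)
    also have "\<dots> \<le> 2 * \<bar>Im (z t)\<bar> / m\<^sup>2"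
      using m by (intro divide_left_mono power_mono mult_pos_pos) (auto intro: zero_less_power)
    finally show ?thesis by simp
  qed
  have ip: "0 < Im (z t)" if "t \<in> {0..T}" for t
    by (rule gronwall_pos[OF der bnd that]) (use z w in auto)
  have inc: "m \<le> Im (z t)" if t: "t \<in> {0..T}" for t
  proof -
    have "Im (z 0) \<le> Im (z t)"
    proof (rule DERIV_nonneg_imp_increasing_open[of 0 t "\<lambda>t. Im (z t)"])
      show "0 \<le> t" using t by auto
      fix x assume x: "0 < x" "x < t"
      then have xT: "x \<in> {0..T}" "x \<in> interior {0..T}" using t by auto
      have "((\<lambda>t. Im (z t)) has_real_derivative q' x) (at x)"
        using der[OF xT(1)] at_within_interior[OF xT(2)] by (simp add: has_real_derivative_iff_has_vector_derivative)
      moreover have "0 \<le> q' x"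
        unfolding q'_def using ip[OF xT(1)] by auto
      ultimately show "\<exists>y. ((\<lambda>t. Im (z t)) has_real_derivative y) (at x) \<and> 0 \<le> y" by blast
    next
      have "continuous_on {0..T} (\<lambda>t. Im (z t))"
        unfolding continuous_on_eq_continuous_within by (blast intro: has_vector_derivative_continuous der)
      then show "continuous_on {0..t} (\<lambda>t. Im (z t))" by (rule continuous_on_subset) (use t in auto)
    qed
    then show ?thesis by (simp add: z m_def)
  qed
  define g where "g t = z (T - t)" for t
  have gd: "(g has_vector_derivative lfield m (g t - W t)) (at t within {0..T})" if t: "t \<in> {0..T}" for t
  proof -
    have Tt: "T - t \<in> {0..T}" using t by auto
    have im: "(\<lambda>t. T - t) ` {0..T} = {0..T}" by auto
    have 1: "((\<lambda>t. T - t) has_vector_derivative -1) (at t within {0..T})"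
      by (auto intro!: derivative_eq_intros)
    have 2: "(z has_vector_derivative - 1 * lfield m (z (T - t) - W t)) (at (T - t) within (\<lambda>t. T - t) ` {0..T})"
      using z(2)[OF Tt] by (simp add: im)
    show ?thesis using vector_diff_chain_within[OF 1 2] by (simp add: o_def g_def[abs_def])
  qed
  have gb: "m \<le> cmod (g t - W t)" if t: "t \<in> {0..T}" for t
  proof -
    have "m \<le> Im (g t)" using inc[of "T - t"] t by (auto simp: g_def)
    also have "Im (g t) = Im (g t - W t)" by simp
    also have "\<dots> \<le> cmod (g t - W t)" using abs_Im_le_cmod[of "g t - W t"] by linarith
    finally show ?thesis .
  qed
  show thesis
  proof
    show "loewner_solution W T g" by (rule lfield_loewner_solution[OF m gb gd])
    show "g T = w" by (simp add: g_def z)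
    show "0 < Im (g 0)" using ip[of T] T by (simp add: g_def)
  qed
qed

text \<open>The truncated field is at most 2 / m, so up to time \<open>T\<close> the trajectory
  moves by at most 2 T / m and stays at distance \<open>m\<close> from the driving function. A large
  \<open>m\<close> makes the displacement small.\<close>

lemma loewner_solution_far:
  assumes T: "0 \<le> T" and W: "continuous_on {0..T} W" and C: "\<And>t. t \<in> {0..T} \<Longrightarrow> \<bar>W t\<bar> \<le> C"
    and m: "0 < m" and w: "C + m + 2 / m * T \<le> cmod w"
  obtains g where "loewner_solution W T g" "g 0 = w" "cmod (g T - w) \<le> 2 / m * T"
proof -
  obtain g where g: "g 0 = w"
    "\<And>t. t \<in> {0..T} \<Longrightarrow> (g has_vector_derivative 1 * lfield m (g t - complex_of_real (W t))) (at t within {0..T})"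
    using lfield_flow_exists[OF m T W, of w "1"] by blast
  note g2 = g(2)[unfolded mult_1]
  have d: "cmod (g t - w) \<le> 2 / m * T" if t: "t \<in> {0..T}" for t
  proof -
    have "cmod (g t - g 0) \<le> 2 / m * norm (t - 0)"
    proof (rule differentiable_bound[of "{0..T}" g "\<lambda>t x. x *\<^sub>R lfield m (g t - W t)"])
      show "(g has_derivative (\<lambda>xa. xa *\<^sub>R lfield m (g x - W x))) (at x within {0..T})" if "x \<in> {0..T}" for x
        using g2[OF that] by (simp add: has_vector_derivative_def)
      show "onorm (\<lambda>xa. xa *\<^sub>R lfield m (g x - W x)) \<le> 2 / m" for x
        by (intro onorm_le) (use mult_right_mono[OF norm_lfield_le[OF m, of "g x - W x"] abs_ge_zero] in
            \<open>auto simp: mult.commute\<close>)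
    qed (use t in auto)
    also have "\<dots> \<le> 2 / m * T" using t m by (intro mult_left_mono) auto
    finally show ?thesis by (simp add: g)
  qed
  have b: "m \<le> cmod (g t - W t)" if t: "t \<in> {0..T}" for t
  proof -
    have "cmod w \<le> cmod (g t - W t) + cmod (complex_of_real (W t)) + cmod (w - g t)"
      using norm_triangle_ineq[of "g t - W t + W t" "w - g t"] norm_triangle_ineq[of "g t - W t" "W t"] by simp
    then show ?thesis using d[OF t] C[OF t] w by (simp add: norm_minus_commute)
  qed
  show thesis
    by (rule that[OF lfield_loewner_solution[OF m b g2] g(1) d]) (use T in auto)
qed

text \<open>The difference D of two trajectories satisfies D' = - D h with \<open>h\<close> as in
  the proof, hence D = (w - w0) exp (- I) with I the integral of \<open>h\<close>. The difference
  quotient is therefore exp (- I), and stability of trajectories makes it converge as w tends to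
  w0.\<close>

lemma loewner_flow_holomorphic:
  assumes T: "0 \<le> T" and W: "continuous_on {0..T} W"
    and G: "\<And>w. w \<in> halfplane \<Longrightarrow> loewner_solution W T (G w) \<and> G w 0 = w"
  shows "(\<lambda>w. G w T) holomorphic_on halfplane"
proof -
  have opn: "open halfplane" unfolding halfplane_def by (simp add: open_halfspace_Im_gt)
  have "\<exists>D. ((\<lambda>w. G w T) has_field_derivative D) (at w0)" if w0: "w0 \<in> halfplane" for w0
  proof -
    define g where "g = G w0"
    have g: "loewner_solution W T g" "g 0 = w0" using G[OF w0] by (auto simp: g_def)
    obtain r m C where r: "0 < r" "0 < m" "\<And>t. t \<in> {0..T} \<Longrightarrow> m \<le> cmod (g t - W t)"
    "\<And>w. cmod (w - g 0) < r \<Longrightarrow> \<exists>f. f 0 = w \<and> loewner_solution W T f \<and>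
        (\<forall>t\<in>{0..T}. m \<le> cmod (f t - W t) \<and> cmod (f t - g t) \<le> C * cmod (w - g 0))"
      by (rule loewner_solution_stable[OF g(1) W T]) blast
    define h where "h w s = 2 / ((G w s - W s) * (g s - W s))" for w s
    define I where "I w t = integral {0..t} (h w)" for w t
    define S where "S = ball w0 r \<inter> halfplane"
    have S: "open S" "w0 \<in> S" using opn w0 r(1) by (auto simp: S_def)
    have GS: "m \<le> cmod (G w t - W t)" "cmod (G w t - g t) \<le> C * cmod (w - w0)"
      if "w \<in> S" "t \<in> {0..T}" for w t
    proof -
      have w: "w \<in> halfplane" "cmod (w - g 0) < r"
        using that g(2) by (auto simp: S_def dist_norm norm_minus_commute)
      obtain f where f: "f 0 = w" "loewner_solution W T f"
        "\<forall>t\<in>{0..T}. m \<le> cmod (f t - W t) \<and> cmod (f t - g t) \<le> C * cmod (w - g 0)"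
        using r(4)[OF w(2)] by blast
      have "f t = G w t"
        by (rule loewner_solution_unique[OF f(2) _ W _ that(2)]) (use G[OF w(1)] f(1) in auto)
      then show "m \<le> cmod (G w t - W t)" "cmod (G w t - g t) \<le> C * cmod (w - w0)"
        using f(3)[rule_format, OF that(2)] g(2) by simp_all
    qed
    have hcont: "continuous_on {0..T} (h w)" if "w \<in> S" for w
    proof -
      have "w \<in> halfplane" using that by (auto simp: S_def)
      then have 1: "loewner_solution W T (G w)" using G by auto
      show ?thesis unfolding h_def
        using 1 g(1)
        by (intro continuous_intros loewner_solution_continuous[OF 1] loewner_solution_continuous[OF g(1)] W)
           (auto simp: loewner_solution_def)
    qed
    have quot: "G w T - G w0 T = (w - w0) * exp (- I w T)" if w: "w \<in> S" for w
    proof -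
      have wh: "w \<in> halfplane" using w by (auto simp: S_def)
      have 1: "loewner_solution W T (G w)" "G w 0 = w" using G wh by auto
      define E where "E t = (G w t - g t) * exp (I w t)" for t
      have "(E has_vector_derivative 0) (at t within {0..T})" if t: "t \<in> {0..T}" for t
      proof -
        have nz: "G w t - W t \<noteq> 0" "g t - W t \<noteq> 0" using 1 g(1) t by (auto simp: loewner_solution_def)
        have a: "(I w has_vector_derivative h w t) (at t within {0..T})"
          unfolding I_def by (rule integral_has_vector_derivative[OF hcont[OF w] t])
        have b: "((\<lambda>t. exp (I w t)) has_vector_derivative h w t * exp (I w t)) (at t within {0..T})"
          using field_vector_diff_chain_within[OF a DERIV_exp[THEN has_field_derivative_at_within]] by (simp add: o_def)
        have c: "((\<lambda>t. G w t - g t) has_vector_derivative 2 / (G w t - W t) - 2 / (g t - W t)) (at t within {0..T})"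
          using 1 g(1) t by (auto intro!: derivative_intros simp: loewner_solution_def)
        have d: "2 / (G w t - W t) - 2 / (g t - W t) = - (G w t - g t) * h w t"
          using nz unfolding h_def by (simp add: field_simps)
        have "(E has_vector_derivative ((G w t - g t) * (h w t * exp (I w t)) +
            (2 / (G w t - W t) - 2 / (g t - W t)) * exp (I w t))) (at t within {0..T})"
          unfolding E_def by (rule has_vector_derivative_mult[OF c b])
        then show ?thesis unfolding d by (simp add: algebra_simps)
      qed
      then obtain c where "\<And>t. t \<in> {0..T} \<Longrightarrow> E t = c"
        using has_vector_derivative_zero_constant[of "{0..T}" E] by auto
      then have "E T = E 0" using T by simp
      then have "(G w T - g T) * exp (I w T) = w - w0" using 1 g(2) by (simp add: E_def I_def)
      then show ?thesis by (simp add: g_def exp_minus field_simps)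
    qed
    have Ilip: "cmod (I w T - I w0 T) \<le> 2 * C / (m ^ 3) * cmod (w - w0) * T" if w: "w \<in> S" for w
    proof -
      have "cmod (I w T - I w0 T) = cmod (integral {0..T} (\<lambda>s. h w s - h w0 s))"
        unfolding I_def by (subst integral_diff) (auto intro!: integrable_continuous_interval hcont w S)
      also have "\<dots> \<le> integral {0..T} (\<lambda>s. 2 * C / (m ^ 3) * cmod (w - w0))"
      proof (rule integral_norm_bound_integral)
        show "(\<lambda>s. h w s - h w0 s) integrable_on {0..T}"
          by (intro integrable_continuous_interval continuous_intros hcont w S)
        fix s assume s: "s \<in> {0..T}"
        have b: "m \<le> cmod (G w s - W s)" "m \<le> cmod (g s - W s)" "cmod (G w s - g s) \<le> C * cmod (w - w0)"
          using GS[OF w s] r(3)[OF s] by auto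
        have nz: "G w s - W s \<noteq> 0" "g s - W s \<noteq> 0" using b r(2) by auto
        have "2 / (a * b) - 2 / (b * b) = 2 * (b - a) / (a * b * b)" if "a \<noteq> 0" "b \<noteq> 0" for a b :: complex
          using that by (simp add: field_simps)
        from this[OF nz] have "h w s - h w0 s = 2 * (g s - G w s) / ((G w s - W s) * (g s - W s) * (g s - W s))"
          unfolding h_def g_def[symmetric] by simp
        then have "cmod (h w s - h w0 s) = 2 * cmod (g s - G w s) / (cmod (G w s - W s) * cmod (g s - W s) * cmod (g s - W s))"
          by (simp only: norm_mult norm_divide norm_numeral)
        also have "\<dots> \<le> 2 * (C * cmod (w - w0)) / (m * m * m)"
        proof (rule frac_le)
          show "m * m * m \<le> cmod (G w s - W s) * cmod (g s - W s) * cmod (g s - W s)"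
            using b r(2) by (intro mult_mono mult_nonneg_nonneg) auto
          show "0 < m * m * m" using r(2) by simp
          show "2 * cmod (g s - G w s) \<le> 2 * (C * cmod (w - w0))"
            using b(3) by (simp add: norm_minus_commute)
          show "0 \<le> 2 * (C * cmod (w - w0))" using order_trans[OF norm_ge_zero b(3)] by simp
        qed
        finally show "cmod (h w s - h w0 s) \<le> 2 * C / (m ^ 3) * cmod (w - w0)"
          by (simp add: power3_eq_cube)
      qed (auto intro!: integrable_continuous_interval continuous_intros)
      also have "\<dots> = 2 * C / (m ^ 3) * cmod (w - w0) * T" using T by simp
      finally show ?thesis .
    qed
    have "((\<lambda>w. I w T) \<longlongrightarrow> I w0 T) (at w0)"
    proof (rule Lim_null_comparison[where g = "\<lambda>w. 2 * C / (m ^ 3) * cmod (w - w0) * T", THEN LIM_zero_cancel])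
      show "\<forall>\<^sub>F w in at w0. cmod (I w T - I w0 T) \<le> 2 * C / (m ^ 3) * cmod (w - w0) * T"
        using Ilip S by (auto simp: eventually_at_topological)
      have "((\<lambda>w. 2 * C / (m ^ 3) * cmod (w - w0) * T) \<longlongrightarrow> 2 * C / (m ^ 3) * cmod (w0 - w0) * T) (at w0)"
        by (intro tendsto_intros)
      then show "((\<lambda>w. 2 * C / (m ^ 3) * cmod (w - w0) * T) \<longlongrightarrow> 0) (at w0)" by simp
    qed
    then have "((\<lambda>w. exp (- I w T)) \<longlongrightarrow> exp (- I w0 T)) (at w0)" by (intro tendsto_intros)
    moreover have "\<forall>\<^sub>F w in at w0. exp (- I w T) = (G w T - G w0 T) / (w - w0)"
      unfolding eventually_at_topological
      by (rule exI[of _ S]) (use quot S in auto)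
    ultimately have "((\<lambda>w. (G w T - G w0 T) / (w - w0)) \<longlongrightarrow> exp (- I w0 T)) (at w0)"
      by (rule Lim_transform_eventually)
    then show ?thesis by (auto simp: has_field_derivative_iff)
  qed
  then show ?thesis
    using opn by (auto simp: holomorphic_on_open)
qed

text \<open>If no point were swallowed, the flow \<open>\<Phi>\<close> would be holomorphic on the half-plane, and
  \<open>exp (- \<i> (w - \<Phi> w))\<close> would violate the maximum principle: its modulus
  \<open>exp (Im w - Im (\<Phi> w))\<close> exceeds 1, but tends to 1 at the boundary and at infinity.\<close>

lemma loewner_swallows:
  assumes T: "0 < T" and W: "continuous_on {0..T} W"
  obtains w where "w \<in> halfplane" "\<And>g. loewner_solution W T g \<Longrightarrow> g 0 \<noteq> w"
proof -
  have False if "\<forall>w\<in>halfplane. \<exists>g. loewner_solution W T g \<and> g 0 = w"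
  proof -
    from bchoice[OF that] obtain G where G: "\<And>w. w \<in> halfplane \<Longrightarrow> loewner_solution W T (G w) \<and> G w 0 = w"
      by blast
    define Phi where "Phi w = G w T" for w
    have hol: "Phi holomorphic_on halfplane"
      unfolding Phi_def using T by (intro loewner_flow_holomorphic[OF _ W G]) auto
    have opn: "open halfplane" unfolding halfplane_def by (simp add: open_halfspace_Im_gt)
    have dec: "0 < Im (Phi w)" "Im (Phi w) < Im w" if "w \<in> halfplane" for w
    proof -
      have *: "loewner_solution W T (G w)" "0 < Im (G w 0)" "T \<in> {0..T}"
        using G[OF that] that T by (auto simp: halfplane_def)
      show "0 < Im (Phi w)" "Im (Phi w) < Im w"
        using loewner_solution_Im[OF *(1) W *(2,3)] T G[OF that] by (auto simp: Phi_def)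
    qed
    \<comment> \<open>The drop in height at \<open>\<i>\<close> is \<open>2 * \<epsilon>\<close>,
      while the maximum principle will bound it by \<open>\<epsilon>\<close>.\<close>
    define \<epsilon> where "\<epsilon> = Im (\<i> - Phi \<i>) / 2"
    have i: "\<i> \<in> halfplane" by (simp add: halfplane_def)
    have eps: "0 < \<epsilon>" "\<epsilon> < 1" using dec[OF i] by (auto simp: \<epsilon>_def)
    have "compact (W ` {0..T})" using W by (intro compact_continuous_image) auto
    then have "bounded (W ` {0..T})" by (rule compact_imp_bounded)
    then obtain C where "\<forall>y\<in>W ` {0..T}. norm y \<le> C" unfolding bounded_iff by blast
    then have C: "\<And>t. t \<in> {0..T} \<Longrightarrow> \<bar>W t\<bar> \<le> C" by simp
    \<comment> \<open>Makes the displacement bound 2 T / m for distant points equal to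
      \<open>\<epsilon>\<close>.\<close>
    define m where "m = 2 * T / \<epsilon>"
    have m: "0 < m" "2 / m * T = \<epsilon>" using T eps by (auto simp: m_def)
    define R where "R = \<bar>C\<bar> + m + \<epsilon> + 2"
    have R: "R > 1" "C + m + 2 / m * T \<le> R" using m eps by (auto simp: R_def)
    \<comment> \<open>On the lower edge, at height \<open>\<eta>\<close>, the drop is below
      \<open>\<eta>\<close> because images stay in the half-plane.\<close>
    define \<eta> where "\<eta> = \<epsilon> / 2"
    have eta: "0 < \<eta>" "\<eta> \<le> \<epsilon>" "\<eta> < 1" using eps by (auto simp: \<eta>_def)
    define S where "S = {w. \<eta> < Im w} \<inter> ball 0 R"
    have oS: "open S" unfolding S_def by (intro open_Int open_ball open_halfspace_Im_gt)
    have cS: "closure S \<subseteq> {w. \<eta> \<le> Im w} \<inter> cball 0 R"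
    proof (rule closure_minimal)
      show "S \<subseteq> {w. \<eta> \<le> Im w} \<inter> cball 0 R" by (auto simp: S_def)
      show "closed ({w. \<eta> \<le> Im w} \<inter> cball (0::complex) R)"
        by (intro closed_Int closed_cball closed_halfspace_Im_ge)
    qed
    have cSH: "closure S \<subseteq> halfplane" using cS eta by (force simp: halfplane_def)
    define F where "F w = exp (- \<i> * (w - Phi w))" for w
    have nF: "norm (F w) = exp (Im (w - Phi w))" for w by (simp add: F_def norm_exp_eq_Re)
    have "norm (F \<i>) \<le> exp \<epsilon>"
    proof (rule maximum_modulus_frontier[of F S])
      have holF: "F holomorphic_on halfplane" unfolding F_def by (intro holomorphic_intros hol)
      then show "F holomorphic_on interior S"
        by (rule holomorphic_on_subset) (use cSH closure_subset interior_subset in blast)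
      show "continuous_on (closure S) F"
        by (rule holomorphic_on_imp_continuous_on[OF holomorphic_on_subset[OF holF cSH]])
      show "bounded S" by (auto simp: S_def)
      show "\<i> \<in> S" using R eta by (auto simp: S_def)
      fix w assume w: "w \<in> frontier S"
      then have wc: "w \<in> closure S" "w \<notin> S" using oS by (auto simp: frontier_def interior_open)
      then have wh: "w \<in> halfplane" "\<eta> \<le> Im w" "cmod w \<le> R" using cSH cS by auto
      have "Im (w - Phi w) \<le> \<epsilon>"
      proof (cases "Im w = \<eta>")
        case True
        then show ?thesis using dec(1)[OF wh(1)] eta by simp
      next
        case False
        then have "cmod w = R" using wc wh by (auto simp: S_def)
        then have Rw: "C + m + 2 / m * T \<le> cmod w" using R by simp
        obtain g where g: "loewner_solution W T g" "g 0 = w" "cmod (g T - w) \<le> 2 / m * T"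
          by (rule loewner_solution_far[OF less_imp_le[OF T] W C m(1) Rw])
        have "g T = Phi w"
          unfolding Phi_def by (rule loewner_solution_unique[OF g(1) _ W]) (use G[OF wh(1)] g T in auto)
        then have "cmod (w - Phi w) \<le> \<epsilon>" using g(3) m by (simp add: norm_minus_commute)
        then show ?thesis using abs_Im_le_cmod[of "w - Phi w"] by linarith
      qed
      then show "norm (F w) \<le> exp \<epsilon>" by (simp add: nF)
    qed
    then show False using eps by (simp add: nF \<epsilon>_def)
  qed
  then show thesis using that by blast
qed

text \<open>The driving function restarted at \<open>s\<close> swallows some \<open>w\<close>.
  Reversing the flow from time \<open>s\<close> to 0 gives a start that arrives at \<open>w\<close>
  at time \<open>s\<close>: it survives up to \<open>s\<close> but not up to
  \<open>T\<close>.\<close>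

lemma loewner_domain_strict:
  assumes s: "0 \<le> s" "s < T" and W: "continuous_on {0..T} W"
  shows "loewner_domain W s \<noteq> loewner_domain W T"
proof
  assume eq: "loewner_domain W s = loewner_domain W T"
  have Ws: "continuous_on {0..s} W" using W by (rule continuous_on_subset) (use s in auto)
  have "continuous_on {0..T - s} (\<lambda>t. W (s + t))"
    by (rule continuous_on_compose2[OF W]) (use s in \<open>auto intro!: continuous_intros\<close>)
  then obtain w where w: "w \<in> halfplane" "\<And>g. loewner_solution (\<lambda>t. W (s + t)) (T - s) g \<Longrightarrow> g 0 \<noteq> w"
    using loewner_swallows[of "T - s" "\<lambda>t. W (s + t)"] s by auto
  obtain g where g: "loewner_solution W s g" "g s = w" "0 < Im (g 0)"
    using loewner_solution_reverse[OF s(1) Ws] w(1) by (auto simp: halfplane_def)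
  then have "g 0 \<in> loewner_domain W s" by (auto simp: loewner_domain_eq halfplane_def)
  then obtain f where f: "f 0 = g 0" "loewner_solution W T f"
    unfolding eq by (auto simp: loewner_domain_eq)
  have "f s = g s"
    by (rule loewner_solution_unique[OF loewner_solution_subset[OF f(2)] g(1) Ws f(1)]) (use s in auto)
  moreover have "loewner_solution (\<lambda>t. W (s + t)) (T - s) (\<lambda>t. f (s + t))"
    by (rule loewner_solution_shift[OF f(2) s(1)])
  ultimately show False using w(2) g(2) by fastforce
qed

text \<open>If the curve ended at a real point that is not swallowed, its last stretch would be confined
  to the real line, so that the hull would stop growing.\<close>

lemma generates_endpoint_swallowed:
  fixes V :: "real \<Rightarrow> real"
  assumes gen: "generates \<gamma> W T" and T: "0 < T" and W: "continuous_on {0..T} W"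
    and V: "\<And>t. t \<in> {0..T} \<Longrightarrow> V t \<noteq> W t"
      "\<And>t. t \<in> {0..T} \<Longrightarrow> (V has_vector_derivative 2 / (V t - W t)) (at t within {0..T})"
  shows "\<gamma> T \<noteq> complex_of_real (V 0)"
proof
  assume eq: "\<gamma> T = complex_of_real (V 0)"
  define g where "g t = complex_of_real (V t)" for t
  have "loewner_solution W T g"
    unfolding loewner_solution_def
  proof safe
    fix t assume t: "t \<in> {0..T}"
    show "g t = complex_of_real (W t) \<Longrightarrow> False" using V(1)[OF t] by (simp add: g_def)
    show "(g has_vector_derivative 2 / (g t - complex_of_real (W t))) (at t within {0..T})"
      using bounded_linear.has_vector_derivative[OF bounded_linear_of_real[where 'a = complex] V(2)[OF t]]
      by (simp add: g_def[abs_def])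
  qed
  then obtain r C m where r: "0 < r"
    "\<And>w. cmod (w - g 0) < r \<Longrightarrow> \<exists>f. f 0 = w \<and> loewner_solution W T f \<and>
        (\<forall>t\<in>{0..T}. m \<le> cmod (f t - W t) \<and> cmod (f t - g t) \<le> C * cmod (w - g 0))"
    by (rule loewner_solution_stable[of W T g]) (use W T in auto)
  have cont: "continuous_on {0..T} \<gamma>" and im: "\<gamma> ` {0..T} \<subseteq> {z. 0 \<le> Im z}"
    and dom: "\<And>t. t \<in> {0..T} \<Longrightarrow> loewner_domain W t = {z \<in> halfplane - \<gamma> ` {0..t}.
          \<not> bounded (connected_component_set (halfplane - \<gamma> ` {0..t}) z)}"
    using gen by (auto simp: generates_def)
  \<comment> \<open>In the half-plane, a curve point this close to the surviving end would itself
    survive up to \<open>T\<close> by stability, but \<open>generates\<close> excludes the trace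
    from the surviving points.\<close>
  have near: "\<gamma> t \<notin> halfplane" if tT: "t \<in> {0..T}" and small: "cmod (\<gamma> t - \<gamma> T) < r" for t
  proof
    assume h: "\<gamma> t \<in> halfplane"
    obtain f where "f 0 = \<gamma> t" "loewner_solution W T f"
      using r(2)[of "\<gamma> t"] small eq by (auto simp: g_def)
    then have "\<gamma> t \<in> loewner_domain W T" using h by (auto simp: loewner_domain_eq)
    then have "\<gamma> t \<notin> \<gamma> ` {0..T}" using dom[of T] T by auto
    then show False using tT by blast
  qed
  have "T \<in> {0..T}" using T by simp
  with cont r(1) obtain d where d: "0 < d" "\<And>t. t \<in> {0..T} \<Longrightarrow> dist t T < d \<Longrightarrow> dist (\<gamma> t) (\<gamma> T) < r"
    unfolding continuous_on_iff by blast
  \<comment> \<open>After \<open>s\<close> the curve stays within \<open>r\<close> of its end;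
    \<open>d / 2\<close> secures a distance in time strictly below \<open>d\<close>.\<close>
  define s where "s = max 0 (T - d / 2)"
  have s: "0 \<le> s" "s < T" using d T by (auto simp: s_def)
  have "\<gamma> t \<notin> halfplane" if "s < t" "t \<le> T" for t
  proof (rule near)
    show "t \<in> {0..T}" using that s by auto
    have "dist t T < d" using that d(1) by (auto simp: s_def dist_real_def)
    with d(2) \<open>t \<in> {0..T}\<close> show "cmod (\<gamma> t - \<gamma> T) < r" by (simp add: dist_norm)
  qed
  then have "halfplane - \<gamma> ` {0..s} = halfplane - \<gamma> ` {0..T}"
    using s by (fastforce simp: not_le[symmetric])
  then have "loewner_domain W s = loewner_domain W T"
    using dom[of s] dom[of T] s T by auto
  with loewner_domain_strict[OF s W] show False by blast
qed

text \<open>Truncating the gap to \<open>W\<close> below its minimum \<open>m\<close> along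
  \<open>V\<close> gives a Lipschitz field which \<open>V\<close> itself solves. By
  \<open>gronwall_pos\<close> a solution started to the right of \<open>V\<close> stays to the
  right, so it is not affected by the truncation either.\<close>

lemma real_loewner_right:
  fixes V W :: "real \<Rightarrow> real"
  assumes T: "0 \<le> T" and W: "continuous_on {0..T} W"
    and V: "\<And>t. t \<in> {0..T} \<Longrightarrow> W t < V t"
      "\<And>t. t \<in> {0..T} \<Longrightarrow> (V has_vector_derivative 2 / (V t - W t)) (at t within {0..T})"
    and x: "V 0 \<le> x"
  obtains V' where "V' 0 = x" "\<And>t. t \<in> {0..T} \<Longrightarrow> W t < V' t"
    "\<And>t. t \<in> {0..T} \<Longrightarrow> (V' has_vector_derivative 2 / (V' t - W t)) (at t within {0..T})"
proof (cases "V 0 = x")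
  case True
  then show thesis using that V by blast
next
  case False
  have Vc: "continuous_on {0..T} V"
    unfolding continuous_on_eq_continuous_within by (blast intro: has_vector_derivative_continuous V)
  have "continuous_on {0..T} (\<lambda>t. V t - W t)" by (intro continuous_intros Vc W)
  then obtain t0 where t0: "t0 \<in> {0..T}" "\<And>t. t \<in> {0..T} \<Longrightarrow> V t0 - W t0 \<le> V t - W t"
    using continuous_attains_inf[of "{0..T}" "\<lambda>t. V t - W t"] T by auto
  define m where "m = V t0 - W t0"
  have m: "0 < m" "\<And>t. t \<in> {0..T} \<Longrightarrow> m \<le> V t - W t" using t0 V(1) by (auto simp: m_def)
  define v where "v t u = 2 / max (u - W t) m" for t u
  have lip: "\<bar>v t a - v t b\<bar> \<le> 2 / m\<^sup>2 * \<bar>a - b\<bar>" for t a b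
  proof -
    define A B where "A = max (a - W t) m" and "B = max (b - W t) m"
    have AB: "m \<le> A" "m \<le> B" "\<bar>A - B\<bar> \<le> \<bar>a - b\<bar>" by (auto simp: A_def B_def)
    have "2 / A - 2 / B = 2 * (B - A) / (A * B)" using AB m by (simp add: field_simps)
    then have "\<bar>2 / A - 2 / B\<bar> = 2 * \<bar>A - B\<bar> / (A * B)"
      using AB m by (simp add: abs_mult abs_minus_commute del: right_diff_distrib_numeral)
    also have "\<dots> \<le> 2 * \<bar>a - b\<bar> / (m * m)"
      using AB m by (intro frac_le mult_mono mult_pos_pos) auto
    finally show ?thesis by (simp add: v_def A_def B_def power2_eq_square)
  qed
  obtain U where U: "U 0 = x" "\<And>t. t \<in> {0..T} \<Longrightarrow> (U has_vector_derivative v t (U t)) (at t within {0..T})"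
  proof (rule picard_lindelof[of T "2 / m\<^sup>2" v x])
    show "0 < 2 / m\<^sup>2" using m by simp
    show "continuous_on {0..T} (\<lambda>t. v t (z t))" if "continuous_on {0..T} z" for z
      unfolding v_def using m by (intro continuous_intros that W) (auto simp: max_def)
  qed (use lip T in auto)
  have Vv: "(V has_vector_derivative v t (V t)) (at t within {0..T})" if "t \<in> {0..T}" for t
    using V(2)[OF that] m(2)[OF that] by (simp add: v_def max_def)
  have pos: "0 < U t - V t" if t: "t \<in> {0..T}" for t
  proof (rule gronwall_pos[where q = "\<lambda>t. U t - V t" and K = "2 / m\<^sup>2"])
    show "((\<lambda>t. U t - V t) has_vector_derivative v t (U t) - v t (V t)) (at t within {0..T})" if "t \<in> {0..T}" for t
      by (intro derivative_intros U Vv that)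
    show "0 < U 0 - V 0" using U(1) x False by simp
  qed (use lip t in auto)
  show thesis
  proof
    show "U 0 = x" by fact
    fix t assume t: "t \<in> {0..T}"
    have "m \<le> U t - W t" using pos[OF t] m(2)[OF t] by simp
    then show "W t < U t" "(U has_vector_derivative 2 / (U t - W t)) (at t within {0..T})"
      using U(2)[OF t] m by (auto simp: v_def)
  qed
qed

text \<open>If the force point \<open>V 0\<close> survives, so does every real point to its right,
  and no surviving real point can be the end.\<close>

lemma generates_endpoint_right:
  fixes V :: "real \<Rightarrow> real"
  assumes gen: "generates \<gamma> W T" and T: "0 < T" and W: "continuous_on {0..T} W"
    and V: "\<And>t. t \<in> {0..T} \<Longrightarrow> W t < V t"
      "\<And>t. t \<in> {0..T} \<Longrightarrow> (V has_vector_derivative 2 / (V t - W t)) (at t within {0..T})"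
    and x: "V 0 \<le> x"
  shows "\<gamma> T \<noteq> complex_of_real x"
proof -
  obtain U where "U 0 = x" "\<And>t. t \<in> {0..T} \<Longrightarrow> W t < U t"
    "\<And>t. t \<in> {0..T} \<Longrightarrow> (U has_vector_derivative 2 / (U t - W t)) (at t within {0..T})"
    by (rule real_loewner_right[of T W V x]) (use assms in auto)
  then show ?thesis
    using generates_endpoint_swallowed[OF gen T W, of U] by fastforce
qed

text \<open>By reflection: changing the signs of \<open>V\<close> and \<open>W\<close> preserves the
  real Loewner equation and exchanges the sides.\<close>

lemma generates_endpoint_left:
  fixes V :: "real \<Rightarrow> real"
  assumes gen: "generates \<gamma> W T" and T: "0 < T" and W: "continuous_on {0..T} W"
    and V: "\<And>t. t \<in> {0..T} \<Longrightarrow> V t < W t"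
      "\<And>t. t \<in> {0..T} \<Longrightarrow> (V has_vector_derivative 2 / (V t - W t)) (at t within {0..T})"
    and x: "x \<le> V 0"
  shows "\<gamma> T \<noteq> complex_of_real x"
proof -
  have d: "((\<lambda>t. - V t) has_vector_derivative 2 / (- V t - - W t)) (at t within {0..T})" if "t \<in> {0..T}" for t
  proof -
    have "2 / (- V t - - W t) = - (2 / (V t - W t))" by (simp only: minus_divide_right) simp
    then show ?thesis using has_vector_derivative_minus[OF V(2)[OF that]] by simp
  qed
  obtain U where U: "U 0 = - x" "\<And>t. t \<in> {0..T} \<Longrightarrow> - W t < U t"
    "\<And>t. t \<in> {0..T} \<Longrightarrow> (U has_vector_derivative 2 / (U t - - W t)) (at t within {0..T})"
    by (rule real_loewner_right[of T "\<lambda>t. - W t" "\<lambda>t. - V t" "- x"])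
      (use assms d in \<open>auto intro!: continuous_intros\<close>)
  have "((\<lambda>t. - U t) has_vector_derivative 2 / (- U t - W t)) (at t within {0..T})" if "t \<in> {0..T}" for t
  proof -
    have "2 / (- U t - W t) = - (2 / (U t - - W t))" by (simp only: minus_divide_right) simp
    then show ?thesis using has_vector_derivative_minus[OF U(3)[OF that]] by simp
  qed
  moreover have "- U t \<noteq> W t" if "t \<in> {0..T}" for t using U(2)[OF that] by auto
  ultimately show ?thesis
    using generates_endpoint_swallowed[OF gen T W, of "\<lambda>t. - U t"] U(1) by auto
qed

section \<open>The Euler scheme and its exact martingale\<close>

primrec euler :: "real \<Rightarrow> real \<Rightarrow> real \<Rightarrow> real \<Rightarrow> (nat \<Rightarrow> real) \<Rightarrow> nat \<Rightarrow> real \<times> real" where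
  "euler \<epsilon> h x y d 0 = (x, y)"
| "euler \<epsilon> h x y d (Suc k) = (let (a, b) = euler \<epsilon> h x y d k in
     if a < \<epsilon> \<or> b < \<epsilon> then (a, b) else (a + 2 * d k + 2 * h / b, b - 2 * d k + 2 * h / a))"

definition ratio :: "real \<times> real \<Rightarrow> real" where
  "ratio p = fst p / (fst p + snd p)"

text \<open>The factor of the next increment in the change of the ratio: 2 over the new value of X +
  Y, or 0 after freezing. It depends on the past only.\<close>

definition euler_coeff :: "real \<Rightarrow> real \<Rightarrow> real \<times> real \<Rightarrow> real" where
  "euler_coeff \<epsilon> h p = (if fst p < \<epsilon> \<or> snd p < \<epsilon> then 0
     else 2 / (fst p + snd p + 2 * h / fst p + 2 * h / snd p))"

context
  fixes \<epsilon> h x y :: real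
  assumes eps: "0 < \<epsilon>" and h: "0 < h" and x: "0 < x" and y: "0 < y"
begin

text \<open>The noise cancels in X + Y and the drift is positive, so the denominator of the ratio
  stays away from 0.\<close>

lemma euler_sum_ge: "x + y \<le> fst (euler \<epsilon> h x y d k) + snd (euler \<epsilon> h x y d k)"
proof (induction k)
  case (Suc k)
  obtain a b where ab: "euler \<epsilon> h x y d k = (a, b)" by fastforce
  show ?case
  proof (cases "a < \<epsilon> \<or> b < \<epsilon>")
    case True
    then show ?thesis using Suc by (simp add: ab)
  next
    case False
    then have "0 \<le> 2 * h / a" "0 \<le> 2 * h / b" using eps h by auto
    then show ?thesis using Suc False by (simp add: ab)
  qed
qed simp

text \<open>The Euler scheme for \<open>dX = 2 dB + 2/Y dt\<close>, \<open>dY = - 2 dB + 2/X dt\<close> preserves the martingale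
  \<open>X / (X + Y)\<close> exactly, because \<open>X + 2 h / Y = X (1 + 2 h / (X Y))\<close>.\<close>

lemma ratio_euler_Suc:
  "ratio (euler \<epsilon> h x y d (Suc k)) =
     ratio (euler \<epsilon> h x y d k) + euler_coeff \<epsilon> h (euler \<epsilon> h x y d k) * d k"
proof -
  obtain a b where ab: "euler \<epsilon> h x y d k = (a, b)" by fastforce
  show ?thesis
  proof (cases "a < \<epsilon> \<or> b < \<epsilon>")
    case True
    then show ?thesis by (simp add: ab euler_coeff_def)
  next
    case False
    then have p: "0 < a" "0 < b" using eps by auto
    define q where "q = 1 + 2 * h / (a * b)"
    have q: "0 < q" using p h by (auto simp: q_def intro!: add_pos_pos)
    have 1: "a + 2 * h / b = a * q" "b + 2 * h / a = b * q" using p by (auto simp: q_def field_simps)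
    have s: "a + 2 * d k + 2 * h / b + (b - 2 * d k + 2 * h / a) = (a + b) * q"
      using 1 by (simp add: algebra_simps)
    have s': "a + b + 2 * h / a + 2 * h / b = (a + b) * q"
      using 1 by (simp add: algebra_simps)
    have "ratio (euler \<epsilon> h x y d (Suc k)) = (a + 2 * d k + 2 * h / b) / ((a + b) * q)"
      using False s by (simp add: ab ratio_def)
    also have "a + 2 * d k + 2 * h / b = a * q + 2 * d k" using 1 by simp
    also have "(a * q + 2 * d k) / ((a + b) * q) = a / (a + b) + 2 / ((a + b) * q) * d k"
      using p q by (simp add: add_divide_distrib)
    finally show ?thesis using False s' by (simp add: ab ratio_def euler_coeff_def)
  qed
qed

lemma euler_coeff_bounds:
  "0 \<le> euler_coeff \<epsilon> h (euler \<epsilon> h x y d k)" "euler_coeff \<epsilon> h (euler \<epsilon> h x y d k) \<le> 2 / (x + y)"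
proof -
  obtain a b where ab: "euler \<epsilon> h x y d k = (a, b)" by fastforce
  have s: "x + y \<le> a + b" using euler_sum_ge[of d k] by (simp add: ab)
  have "0 \<le> euler_coeff \<epsilon> h (a, b) \<and> euler_coeff \<epsilon> h (a, b) \<le> 2 / (x + y)"
  proof (cases "a < \<epsilon> \<or> b < \<epsilon>")
    case True
    then show ?thesis using x y by (auto simp: euler_coeff_def)
  next
    case False
    then have p: "0 < a" "0 < b" "0 \<le> 2 * h / a" "0 \<le> 2 * h / b" using eps h by auto
    then have "x + y \<le> a + b + 2 * h / a + 2 * h / b" using s by linarith
    then show ?thesis using False x y p by (auto simp: euler_coeff_def intro!: divide_left_mono)
  qed
  then show "0 \<le> euler_coeff \<epsilon> h (euler \<epsilon> h x y d k)" "euler_coeff \<epsilon> h (euler \<epsilon> h x y d k) \<le> 2 / (x + y)"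
    by (simp_all add: ab)
qed

text \<open>The ratio becomes negative only by overshooting: a step from a \<ge> \<epsilon> below 0
  needs |2 d| > \<epsilon>. It then costs at most |2 d| / (x + y), which is at most (2 d)^4 / ((x +
  y) \<epsilon>^3). The fourth power makes the expected total of order h over a bounded
  time.\<close>

lemma ratio_euler_ge:
  "- (\<Sum>j<k. (2 * d j) ^ 4 / ((x + y) * \<epsilon> ^ 3)) \<le> ratio (euler \<epsilon> h x y d k)"
proof (induction k)
  case 0
  then show ?case using x y by (simp add: ratio_def)
next
  case (Suc k)
  obtain a b where ab: "euler \<epsilon> h x y d k = (a, b)" by fastforce
  have s: "x + y \<le> a + b" using euler_sum_ge[of d k] by (simp add: ab)
  have nn: "0 \<le> (2 * d j) ^ 4 / ((x + y) * \<epsilon> ^ 3)" for j using x y eps by auto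
  have snn: "0 \<le> (\<Sum>j<k. (2 * d j) ^ 4 / ((x + y) * \<epsilon> ^ 3))" by (rule sum_nonneg) (rule nn)
  show ?case
  proof (cases "a < \<epsilon> \<or> b < \<epsilon>")
    case True
    then have "euler \<epsilon> h x y d (Suc k) = euler \<epsilon> h x y d k" by (simp add: ab)
    then show ?thesis using Suc nn[of k] by (simp del: euler.simps)
  next
    case False
    then have p: "0 < a" "0 < b" "\<epsilon> \<le> a" using eps by auto
    show ?thesis
    proof (cases "\<bar>2 * d k\<bar> \<le> \<epsilon>")
      case True
      have "0 \<le> a + 2 * d k" using p True by linarith
      moreover have "0 \<le> 2 * h / b" using p h by simp
      ultimately have "0 \<le> fst (euler \<epsilon> h x y d (Suc k))"
        using False by (simp add: ab)
      then have "0 \<le> ratio (euler \<epsilon> h x y d (Suc k))"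
        using euler_sum_ge[of d "Suc k"] x y unfolding ratio_def by (intro divide_nonneg_nonneg) linarith+
      then show ?thesis using snn nn[of k] by (simp del: euler.simps)
    next
      case big: False
      have "0 \<le> ratio (euler \<epsilon> h x y d k)" using p by (simp add: ratio_def ab)
      moreover have "\<bar>euler_coeff \<epsilon> h (euler \<epsilon> h x y d k) * d k\<bar> \<le> 2 / (x + y) * \<bar>d k\<bar>"
        using euler_coeff_bounds[of d k] mult_right_mono[OF euler_coeff_bounds(2)[of d k] abs_ge_zero[of "d k"]]
        by (simp add: abs_mult)
      moreover have "2 / (x + y) * \<bar>d k\<bar> \<le> (2 * d k) ^ 4 / ((x + y) * \<epsilon> ^ 3)"
      proof -
        have "\<bar>2 * d k\<bar> * \<epsilon> ^ 3 \<le> \<bar>2 * d k\<bar> * \<bar>2 * d k\<bar> ^ 3"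
          using big eps by (intro mult_left_mono power_mono) auto
        also have "\<dots> = (2 * d k) ^ 4" by (simp add: power4_eq_xxxx power3_eq_cube abs_mult)
        finally have "\<bar>2 * d k\<bar> * \<epsilon> ^ 3 / ((x + y) * \<epsilon> ^ 3) \<le> (2 * d k) ^ 4 / ((x + y) * \<epsilon> ^ 3)"
          using x y eps by (intro divide_right_mono) auto
        then show ?thesis using eps by (simp add: abs_mult)
      qed
      ultimately have "- ((2 * d k) ^ 4 / ((x + y) * \<epsilon> ^ 3)) \<le> ratio (euler \<epsilon> h x y d (Suc k))"
        unfolding ratio_euler_Suc by linarith
      then show ?thesis using snn by (simp del: euler.simps)
    qed
  qed
qed

section \<open>Measurability and expectation of the Euler scheme\<close>

lemma measurable_euler_step:
  fixes a b c :: "'w \<Rightarrow> real"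
  assumes [measurable]: "a \<in> borel_measurable M" "b \<in> borel_measurable M" "c \<in> borel_measurable M"
  shows "(\<lambda>w. if a w < \<epsilon> \<or> b w < \<epsilon> then a w else a w + 2 * c w + 2 * h / b w) \<in> borel_measurable M"
    and "(\<lambda>w. if a w < \<epsilon> \<or> b w < \<epsilon> then b w else b w - 2 * c w + 2 * h / a w) \<in> borel_measurable M"
    and "(\<lambda>w. a w / (a w + b w)) \<in> borel_measurable M"
    and "(\<lambda>w. if a w < \<epsilon> \<or> b w < \<epsilon> then 0 else 2 / (a w + b w + 2 * h / a w + 2 * h / b w)) \<in> borel_measurable M"
  by measurable

lemma measurable_euler:
  assumes "\<And>j. j < k \<Longrightarrow> (\<lambda>w. X w j) \<in> borel_measurable M"
  shows "(\<lambda>w. fst (euler \<epsilon> h x y (X w) k)) \<in> borel_measurable M"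
    and "(\<lambda>w. snd (euler \<epsilon> h x y (X w) k)) \<in> borel_measurable M"
proof -
  have "(\<lambda>w. fst (euler \<epsilon> h x y (X w) j)) \<in> borel_measurable M \<and>
    (\<lambda>w. snd (euler \<epsilon> h x y (X w) j)) \<in> borel_measurable M" if "j \<le> k" for j
    using that
  proof (induction j)
    case (Suc j)
    then have m: "(\<lambda>w. fst (euler \<epsilon> h x y (X w) j)) \<in> borel_measurable M"
      "(\<lambda>w. snd (euler \<epsilon> h x y (X w) j)) \<in> borel_measurable M" "(\<lambda>w. X w j) \<in> borel_measurable M"
      using assms by auto
    let ?s = "\<lambda>w. fst (euler \<epsilon> h x y (X w) j) < \<epsilon> \<or> snd (euler \<epsilon> h x y (X w) j) < \<epsilon>"
    have *: "fst (euler \<epsilon> h x y (X w) (Suc j)) = (if ?s w then fst (euler \<epsilon> h x y (X w) j) else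
        fst (euler \<epsilon> h x y (X w) j) + 2 * X w j + 2 * h / snd (euler \<epsilon> h x y (X w) j))"
      "snd (euler \<epsilon> h x y (X w) (Suc j)) = (if ?s w then snd (euler \<epsilon> h x y (X w) j) else
        snd (euler \<epsilon> h x y (X w) j) - 2 * X w j + 2 * h / fst (euler \<epsilon> h x y (X w) j))" for w
      by (simp_all add: case_prod_beta Let_def)
    show ?case unfolding * by (intro conjI measurable_euler_step m)
  qed simp
  from this[of k] show "(\<lambda>w. fst (euler \<epsilon> h x y (X w) k)) \<in> borel_measurable M"
    and "(\<lambda>w. snd (euler \<epsilon> h x y (X w) k)) \<in> borel_measurable M" by auto
qed

lemma measurable_ratio_euler:
  assumes "\<And>j. j < k \<Longrightarrow> (\<lambda>w. X w j) \<in> borel_measurable M"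
  shows "(\<lambda>w. ratio (euler \<epsilon> h x y (X w) k)) \<in> borel_measurable M"
    and "(\<lambda>w. euler_coeff \<epsilon> h (euler \<epsilon> h x y (X w) k)) \<in> borel_measurable M"
proof -
  note m = measurable_euler[where X = X and k = k, OF assms]
  show "(\<lambda>w. ratio (euler \<epsilon> h x y (X w) k)) \<in> borel_measurable M"
    unfolding ratio_def by (rule measurable_euler_step(3)[OF m m(1)])
  show "(\<lambda>w. euler_coeff \<epsilon> h (euler \<epsilon> h x y (X w) k)) \<in> borel_measurable M"
    unfolding euler_coeff_def by (rule measurable_euler_step(4)[OF m m(1)])
qed

lemma euler_cong: "(\<And>j. j < k \<Longrightarrow> d j = d' j) \<Longrightarrow> euler \<epsilon> h x y d k = euler \<epsilon> h x y d' k"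
  by (induction k) (simp_all add: case_prod_beta Let_def)

end

context prob_space
begin

text \<open>The coefficient of a new increment is bounded and a function of the earlier increments,
  hence independent of the new one, which has mean 0. So no step changes the mean of the
  ratio.\<close>

lemma expectation_ratio_euler:
  assumes pos: "0 < \<epsilon>" "0 < h" "0 < x" "0 < y"
    and ind: "indep_vars (\<lambda>_. borel) X (UNIV :: nat set)"
    and int: "\<And>k. integrable M (X k)" and mean: "\<And>k. expectation (X k) = 0"
  shows "integrable M (\<lambda>w. ratio (euler \<epsilon> h x y (\<lambda>j. X j w) k)) \<and>
    expectation (\<lambda>w. ratio (euler \<epsilon> h x y (\<lambda>j. X j w) k)) = x / (x + y)"
proof (induction k)
  case 0
  show ?case by (simp add: ratio_def prob_space)
next
  case (Suc k)
  have X[measurable]: "X j \<in> borel_measurable M" for j using int by auto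
  define C where "C d = euler_coeff \<epsilon> h (euler \<epsilon> h x y d k)" for d
  let ?C = "\<lambda>w. C (\<lambda>j. X j w)"
  have Cm: "C \<in> borel_measurable (PiM {..<k} (\<lambda>_. borel))"
    unfolding C_def by (rule measurable_ratio_euler[OF pos]) auto
  have Cb: "\<bar>C d\<bar> \<le> 2 / (x + y)" for d using euler_coeff_bounds[OF pos, of d k] by (simp add: C_def)
  have Cr: "C (restrict (\<lambda>i. X i w) {..<k}) = ?C w" for w
    unfolding C_def by (rule arg_cong[OF euler_cong[OF pos]]) simp
  have "indep_var (PiM {..<k} (\<lambda>_. borel)) (\<lambda>\<omega>. restrict (\<lambda>i. X i \<omega>) {..<k})
      (PiM {k} (\<lambda>_. borel)) (\<lambda>\<omega>. restrict (\<lambda>i. X i \<omega>) {k})"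
    by (rule indep_var_restrict[OF ind]) auto
  from indep_var_compose[OF this Cm, of "\<lambda>f. f k" borel]
  have iv: "indep_var borel ?C borel (X k)"
    by (simp add: comp_def Cr)
  have Cmeas[measurable]: "?C \<in> borel_measurable M"
    unfolding C_def by (rule measurable_ratio_euler[OF pos]) auto
  have Ci: "integrable M ?C"
    by (rule integrable_const_bound[where B = "2 / (x + y)"]) (use Cb in auto)
  have "integrable M (\<lambda>w. ?C w * X k w)" by (rule indep_var_integrable[OF iv Ci int])
  moreover have "expectation (\<lambda>w. ?C w * X k w) = 0"
    using indep_var_lebesgue_integral[OF iv Ci int] mean by simp
  moreover have "ratio (euler \<epsilon> h x y (\<lambda>j. X j w) (Suc k)) = ratio (euler \<epsilon> h x y (\<lambda>j. X j w) k) + ?C w * X k w" for w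
    unfolding ratio_euler_Suc[OF pos] C_def ..
  ultimately show ?case using Suc by (simp del: euler.simps)
qed

text \<open>Markov's inequality for the nonnegative variable \<open>Z + S\<close>, where
  \<open>S\<close> compensates the overshoots. The constant is 48 = 16 * 3, because a centred
  Gaussian of variance h has fourth moment 3 h^2.\<close>

lemma prob_ratio_euler_le:
  assumes pos: "0 < \<epsilon>" "0 < h" "0 < x" "0 < y" and r: "r < 1"
    and ind: "indep_vars (\<lambda>_. borel) X (UNIV :: nat set)"
    and dist: "\<And>k. distributed M lborel (X k) (\<lambda>t. ennreal (normal_density 0 (sqrt h) t))"
  shows "(1 - r) * prob {w \<in> space M. 1 - r \<le> ratio (euler \<epsilon> h x y (\<lambda>j. X j w) k)}
    \<le> x / (x + y) + real k * 48 * h\<^sup>2 / ((x + y) * \<epsilon> ^ 3)"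
proof -
  have sh: "0 < sqrt h" using pos by simp
  have int: "integrable M (X k)" for k
    by (subst distributed_integrable[OF dist, of "\<lambda>x. x", symmetric])
       (auto intro: integrable_normal_moment_nz_1[OF sh])
  have mean: "expectation (X k) = 0" for k
    by (rule normal_distributed_expectation[OF sh dist])
  have X[measurable]: "X j \<in> borel_measurable M" for j using int by auto
  have m4: "has_bochner_integral lborel (\<lambda>t. normal_density 0 (sqrt h) t * t ^ 4) (3 * h\<^sup>2)"
    using normal_moment_even[OF sh, of 0 2] pos by (simp add: fact_numeral field_simps power2_eq_square)
  have i4: "integrable M (\<lambda>w. X k w ^ 4)" for k
    by (subst distributed_integrable[OF dist, of "\<lambda>x. x ^ 4", symmetric])
       (use m4 in \<open>auto simp: has_bochner_integral_iff\<close>)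
  have e4: "expectation (\<lambda>w. X k w ^ 4) = 3 * h\<^sup>2" for k
    by (subst distributed_integral[OF dist, of "\<lambda>x. x ^ 4", symmetric])
       (use m4 in \<open>auto simp: has_bochner_integral_iff\<close>)
  define Z where "Z w = ratio (euler \<epsilon> h x y (\<lambda>j. X j w) k)" for w
  define S where "S w = (\<Sum>j<k. (2 * X j w) ^ 4 / ((x + y) * \<epsilon> ^ 3))" for w
  have Zi: "integrable M Z" "expectation Z = x / (x + y)"
    using expectation_ratio_euler[OF pos ind int mean, of k] unfolding Z_def[abs_def] by auto
  have Si: "integrable M S" unfolding S_def power_mult_distrib
    by (intro Bochner_Integration.integrable_sum integrable_divide integrable_mult_right i4)
  have Se: "expectation S = real k * 48 * h\<^sup>2 / ((x + y) * \<epsilon> ^ 3)"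
  proof -
    have "expectation S = (\<Sum>j<k. expectation (\<lambda>w. (2 * X j w) ^ 4 / ((x + y) * \<epsilon> ^ 3)))"
      unfolding S_def unfolding power_mult_distrib
      by (intro Bochner_Integration.integral_sum integrable_divide integrable_mult_right i4)
    also have "\<dots> = (\<Sum>j<k. 16 * (3 * h\<^sup>2) / ((x + y) * \<epsilon> ^ 3))"
      by (intro sum.cong refl) (simp add: power_mult_distrib e4)
    finally show ?thesis by simp
  qed
  have ZS: "0 \<le> Z w + S w" for w
    using ratio_euler_ge[OF pos, of "\<lambda>j. X j w" k] by (simp add: Z_def S_def)
  have S0: "0 \<le> S w" for w unfolding S_def using pos by (intro sum_nonneg) auto
  have Zm[measurable]: "Z \<in> borel_measurable M" using Zi by auto
  let ?A = "{w \<in> space M. 1 - r \<le> Z w}"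
  have "(1 - r) * prob ?A = expectation (\<lambda>w. (1 - r) * indicator ?A w)" by simp
  also have "\<dots> \<le> expectation (\<lambda>w. Z w + S w)"
  proof (rule integral_mono)
    show "integrable M (\<lambda>w. (1 - r) * indicator ?A w)" by (simp add: emeasure_eq_measure)
    show "integrable M (\<lambda>w. Z w + S w)" using Zi Si by simp
    show "(1 - r) * indicator ?A w \<le> Z w + S w" for w
      using ZS[of w] S0[of w] by (auto split: split_indicator)
  qed
  also have "\<dots> = x / (x + y) + real k * 48 * h\<^sup>2 / ((x + y) * \<epsilon> ^ 3)"
    using Zi Si Se by simp
  finally show ?thesis by (simp add: Z_def)
qed

text \<open>Fatou's lemma for events: the tail intersections increase, and each lies in all later
  \<open>E n\<close>.\<close>

lemma prob_eventually_le:
  assumes E: "\<And>n. E n \<in> events" and b: "\<And>n. n \<ge> n0 \<Longrightarrow> prob (E n) \<le> b + c n" and c: "c \<longlonglongrightarrow> 0"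
  shows "prob (\<Union>k. \<Inter>n\<in>{k..}. E n) \<le> b"
proof -
  define F where "F k = (\<Inter>n\<in>{k..}. E n)" for k :: nat
  have F: "F k \<in> events" for k unfolding F_def using E by auto
  have "prob (F k) \<le> b" for k
  proof (rule LIMSEQ_le[OF tendsto_const])
    show "(\<lambda>n. b + c n) \<longlonglongrightarrow> b" using tendsto_add[OF tendsto_const c, of b] by simp
    have "prob (F k) \<le> b + c n" if "n \<ge> max k n0" for n
    proof -
      have "prob (F k) \<le> prob (E n)" using that E by (intro finite_measure_mono) (auto simp: F_def)
      then show ?thesis using b[of n] that by simp
    qed
    then show "\<exists>N. \<forall>n\<ge>N. prob (F k) \<le> b + c n" by blast
  qed
  moreover have "(\<lambda>k. prob (F k)) \<longlonglongrightarrow> prob (\<Union>k. F k)"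
    by (rule finite_Lim_measure_incseq) (use F in \<open>auto simp: F_def incseq_def\<close>)
  ultimately have "prob (\<Union>k. F k) \<le> b" by (intro LIMSEQ_le_const2) auto
  then show ?thesis by (simp add: F_def)
qed

end


section \<open>Pathwise comparison of the scheme with the exact solution\<close>

lemma euler_stays:
  assumes "fst (euler \<epsilon> h x y d k) < \<epsilon> \<or> snd (euler \<epsilon> h x y d k) < \<epsilon>" "k \<le> m"
  shows "euler \<epsilon> h x y d m = euler \<epsilon> h x y d k"
  using assms(2)
proof (induction m rule: dec_induct)
  case (step m)
  then show ?case using assms(1) by (simp add: case_prod_beta Let_def)
qed simp

text \<open>Scheme and solution share the noise, so only the drift matters. A step adds at most h (4
  / \<epsilon>^2) (w + error): the solution is at least \<epsilon> / 2, the scheme at least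
  \<epsilon>, which gives the factor 2 / (\<epsilon> / 2 * \<epsilon>), and \<open>w\<close> bounds
  the oscillation of the solution within a step. With q = 1 + 4 h / \<epsilon>^2 this recursion is
  solved by w (q^k - 1).\<close>

lemma euler_error:
  fixes B X Y :: "real \<Rightarrow> real"
  assumes e: "0 < \<epsilon>" and h: "0 < h" and w: "0 \<le> w" and T: "0 \<le> T"
    and cont: "continuous_on {0..T} X" "continuous_on {0..T} Y"
    and eqX: "\<And>t. t \<in> {0..T} \<Longrightarrow> X t = x + 2 * (B t - B 0) + integral {0..t} (\<lambda>s. 2 / Y s)"
    and eqY: "\<And>t. t \<in> {0..T} \<Longrightarrow> Y t = y - 2 * (B t - B 0) + integral {0..t} (\<lambda>s. 2 / X s)"
    and big: "\<And>t. t \<in> {0..T} \<Longrightarrow> \<epsilon> / 2 \<le> X t \<and> \<epsilon> / 2 \<le> Y t"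
    and mod: "\<And>s t. s \<in> {0..T} \<Longrightarrow> t \<in> {0..T} \<Longrightarrow> \<bar>s - t\<bar> \<le> h \<Longrightarrow> \<bar>X s - X t\<bar> \<le> w \<and> \<bar>Y s - Y t\<bar> \<le> w"
    and kT: "real k * h \<le> T"
    and run: "\<And>j. j < k \<Longrightarrow> \<epsilon> \<le> fst (euler \<epsilon> h x y d j) \<and> \<epsilon> \<le> snd (euler \<epsilon> h x y d j)"
    and d: "\<And>j. d j = B (real (Suc j) * h) - B (real j * h)"
  shows "\<bar>fst (euler \<epsilon> h x y d k) - X (real k * h)\<bar> \<le> w * ((1 + 4 / \<epsilon>\<^sup>2 * h) ^ k - 1) \<and>
    \<bar>snd (euler \<epsilon> h x y d k) - Y (real k * h)\<bar> \<le> w * ((1 + 4 / \<epsilon>\<^sup>2 * h) ^ k - 1)"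
  using kT run
proof (induction k)
  case 0
  have "X 0 = x" "Y 0 = y" using eqX[of 0] eqY[of 0] T by auto
  then show ?case by simp
next
  case (Suc k)
  define q where "q = 1 + 4 / \<epsilon>\<^sup>2 * h"
  define s where "s = real k * h"
  define t where "t = real (Suc k) * h"
  have st: "0 \<le> s" "s \<le> t" "t \<le> T" "t - s = h"
    using Suc.prems(1) h by (auto simp: s_def t_def algebra_simps)
  then have sT: "s \<in> {0..T}" and tT: "t \<in> {0..T}" by auto
  obtain a b where ab: "euler \<epsilon> h x y d k = (a, b)" by fastforce
  have run: "\<epsilon> \<le> a" "\<epsilon> \<le> b" using Suc.prems(2)[of k] by (auto simp: ab)
  have IH: "\<bar>a - X s\<bar> \<le> w * (q ^ k - 1)" "\<bar>b - Y s\<bar> \<le> w * (q ^ k - 1)"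
    using Suc.IH Suc.prems st by (auto simp: ab q_def s_def)
  have key: "\<bar>(integral {0..t} (\<lambda>s. 2 / F s) - integral {0..s} (\<lambda>s. 2 / F s)) - 2 * h / c\<bar> \<le> h * (4 / \<epsilon>\<^sup>2 * (w * q ^ k))"
    if F: "continuous_on {0..T} F" "\<And>u. u \<in> {0..T} \<Longrightarrow> \<epsilon> / 2 \<le> F u"
      "\<And>u. u \<in> {0..T} \<Longrightarrow> \<bar>s - u\<bar> \<le> h \<Longrightarrow> \<bar>F s - F u\<bar> \<le> w" and c: "\<epsilon> \<le> c" "\<bar>c - F s\<bar> \<le> w * (q ^ k - 1)" for F c
  proof -
    have ci: "continuous_on {0..T} (\<lambda>s. 2 / F s)"
      using F(2) e by (intro continuous_intros F) force
    have ii: "(\<lambda>s. 2 / F s) integrable_on {u..v}" if "0 \<le> u" "v \<le> T" for u v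
      by (intro integrable_continuous_interval continuous_on_subset[OF ci]) (use that in auto)
    have "integral {0..t} (\<lambda>s. 2 / F s) - integral {0..s} (\<lambda>s. 2 / F s) = integral {s..t} (\<lambda>s. 2 / F s)"
      using Henstock_Kurzweil_Integration.integral_combine[OF st(1,2) ii[of 0 t]] st by simp
    also have "\<dots> - 2 * h / c = integral {s..t} (\<lambda>u. 2 / F u - 2 / c)"
      using st ii[of s t] by (subst integral_diff) auto
    finally have "\<bar>(integral {0..t} (\<lambda>s. 2 / F s) - integral {0..s} (\<lambda>s. 2 / F s)) - 2 * h / c\<bar>
      = norm (integral {s..t} (\<lambda>u. 2 / F u - 2 / c))" by simp
    also have "\<dots> \<le> 4 / \<epsilon>\<^sup>2 * (w * q ^ k) * (t - s)"
    proof (rule integral_bound)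
      show "s \<le> t" by fact
      show "continuous_on {s..t} (\<lambda>u. 2 / F u - 2 / c)"
        using st by (intro continuous_intros continuous_on_subset[OF ci]) auto
      fix u assume u: "u \<in> {s..t}"
      then have uT: "u \<in> {0..T}" "\<bar>s - u\<bar> \<le> h" using st by auto
      have "\<bar>F u - c\<bar> \<le> w * q ^ k" using F(3)[OF uT] c(2) by (simp add: algebra_simps)
      have p: "0 < F u" "0 < c" using F(2)[OF uT(1)] e c by auto
      have "2 / F u - 2 / c = 2 * (c - F u) / (F u * c)" using p by (simp add: field_simps)
      then have "norm (2 / F u - 2 / c) = 2 * \<bar>F u - c\<bar> / (F u * c)"
        using p by (simp add: abs_mult abs_minus_commute del: right_diff_distrib_numeral)
      also have "\<dots> \<le> 2 * (w * q ^ k) / (\<epsilon> / 2 * \<epsilon>)"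
        using p F(2)[OF uT(1)] e c \<open>\<bar>F u - c\<bar> \<le> w * q ^ k\<close>
        by (intro frac_le mult_mono mult_left_mono) (auto intro: order_trans[OF abs_ge_zero])
      also have "\<dots> = 4 / \<epsilon>\<^sup>2 * (w * q ^ k)" by (simp add: power2_eq_square)
      finally show "norm (2 / F u - 2 / c) \<le> 4 / \<epsilon>\<^sup>2 * (w * q ^ k)" .
    qed
    finally show ?thesis using st by (simp add: mult_ac)
  qed
  have fin: "w * (q ^ k - 1) + h * (4 / \<epsilon>\<^sup>2 * (w * q ^ k)) = w * (q ^ Suc k - 1)"
    unfolding q_def by (simp add: algebra_simps)
  have 1: "\<bar>(integral {0..t} (\<lambda>s. 2 / Y s) - integral {0..s} (\<lambda>s. 2 / Y s)) - 2 * h / b\<bar> \<le> h * (4 / \<epsilon>\<^sup>2 * (w * q ^ k))"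
    using big mod[OF sT] run IH by (intro key cont) auto
  have 2: "\<bar>(integral {0..t} (\<lambda>s. 2 / X s) - integral {0..s} (\<lambda>s. 2 / X s)) - 2 * h / a\<bar> \<le> h * (4 / \<epsilon>\<^sup>2 * (w * q ^ k))"
    using big mod[OF sT] run IH by (intro key cont) auto
  have E: "euler \<epsilon> h x y d (Suc k) = (a + 2 * (B t - B s) + 2 * h / b, b - 2 * (B t - B s) + 2 * h / a)"
    using run by (simp add: ab d t_def s_def)
  show ?case
    unfolding E q_def[symmetric] t_def[symmetric] fin[symmetric]
    using 1 2 IH eqX[OF sT] eqX[OF tT] eqY[OF sT] eqY[OF tT] by (simp add: abs_le_iff)
qed


text \<open>While \<open>Y\<close> runs to 0, \<open>X\<close> stays above some c > 0. For small
  \<epsilon>, and then small h, the scheme must freeze with second coordinate below \<epsilon> and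
  first at least c / 2, so its ratio is close to 1.\<close>

lemma euler_ratio_converges:
  fixes B X Y :: "real \<Rightarrow> real"
  assumes T: "0 < T" and x: "0 < x" and y: "0 < y" and r: "0 < r" "r < 1"
    and cont: "continuous_on {0..T} X" "continuous_on {0..T} Y"
    and eqX: "\<And>t. t \<in> {0..<T} \<Longrightarrow> X t = x + 2 * (B t - B 0) + integral {0..t} (\<lambda>s. 2 / Y s)"
    and eqY: "\<And>t. t \<in> {0..<T} \<Longrightarrow> Y t = y - 2 * (B t - B 0) + integral {0..t} (\<lambda>s. 2 / X s)"
    and pos: "\<And>t. t \<in> {0..<T} \<Longrightarrow> 0 < Y t" and posX: "\<And>t. t \<in> {0..T} \<Longrightarrow> 0 < X t" and YT: "Y T = 0"
  obtains \<epsilon>0 where "0 < \<epsilon>0"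
    "\<And>\<epsilon>. 0 < \<epsilon> \<Longrightarrow> \<epsilon> < \<epsilon>0 \<Longrightarrow> \<exists>h0>0. \<forall>h K. 0 < h \<longrightarrow> h < h0 \<longrightarrow> T \<le> real K * h \<longrightarrow>
      1 - r \<le> ratio (euler \<epsilon> h x y (\<lambda>k. B (real (Suc k) * h) - B (real k * h)) K)"
proof -
  obtain t0 where t0: "t0 \<in> {0..T}" "\<And>t. t \<in> {0..T} \<Longrightarrow> X t0 \<le> X t"
    using continuous_attains_inf[of "{0..T}" X] cont T by auto
  define c where "c = X t0"
  have c: "0 < c" "\<And>t. t \<in> {0..T} \<Longrightarrow> c \<le> X t" using t0 posX by (auto simp: c_def)
  \<comment> \<open>Below \<open>y\<close>, the level is under the start of \<open>Y\<close>; below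
    \<open>c / 2\<close>, the first coordinate cannot cause the freezing; below
    \<open>r * c / 2\<close>, the final values satisfy
    \<open>(1 - r) * D \<le> r * A\<close>.\<close>
  define \<epsilon>0 where "\<epsilon>0 = min y (min (c / 2) (r * c / 2))"
  have e0: "0 < \<epsilon>0" using c r y by (auto simp: \<epsilon>0_def)
  show thesis
  proof (rule that[OF e0])
    fix \<epsilon> :: real assume e: "0 < \<epsilon>" "\<epsilon> < \<epsilon>0"
    then have ec: "\<epsilon> < y" "\<epsilon> < c / 2" "\<epsilon> < r * c / 2" by (auto simp: \<epsilon>0_def)
    \<comment> \<open>The first time \<open>T'\<close> with \<open>Y\<close> at most
      \<open>\<epsilon> / 2\<close> is used: up to it the solution is large enough for
      \<open>euler_error\<close>, and by then the scheme must have frozen at level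
      \<open>\<epsilon>\<close>.\<close>
    define S where "S = {t \<in> {0..T}. Y t \<le> \<epsilon> / 2}"
    have "closed S" unfolding S_def
      by (intro continuous_closed_preimage_constant continuous_on_closed_Collect_le cont continuous_intros) auto
    moreover have "bounded S" by (rule bounded_subset[of "{0..T}"]) (auto simp: S_def)
    ultimately have "compact S" by (simp add: compact_eq_bounded_closed)
    moreover have "T \<in> S" using T YT e by (auto simp: S_def)
    ultimately obtain T' where T': "T' \<in> S" "\<And>t. t \<in> S \<Longrightarrow> T' \<le> t"
      using compact_attains_inf[of S] by blast
    have T'b: "0 \<le> T'" "T' \<le> T" "Y T' \<le> \<epsilon> / 2" using T' by (auto simp: S_def)
    have Y0: "Y 0 = y" using eqY[of 0] T by simp
    have before: "\<epsilon> / 2 < Y t" if "0 \<le> t" "t < T'" for t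
      using T'(2)[of t] that T'b by (force simp: S_def)
    have YT': "Y T' = \<epsilon> / 2"
    proof (rule ccontr)
      assume "Y T' \<noteq> \<epsilon> / 2"
      then have lt: "Y T' < \<epsilon> / 2" using T'b by simp
      have "continuous_on {0..T'} Y" by (rule continuous_on_subset[OF cont(2)]) (use T'b in auto)
      then obtain t where t: "0 \<le> t" "t \<le> T'" "Y t = \<epsilon> / 2"
        using IVT2'[of Y T' "\<epsilon> / 2" 0] lt Y0 ec T'b e by auto
      then show False using before[of t] lt by (cases "t = T'") auto
    qed
    have T'T: "T' < T" using YT' YT e T'b by (cases "T' = T") auto
    have sub: "{0..T'} \<subseteq> {0..T}" using T'b by auto
    \<comment> \<open>Cancels the growth of the error:
      \<open>w * exp (4 / \<epsilon>\<^sup>2 * T') = \<epsilon> / 8\<close>.\<close>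
    define w where "w = \<epsilon> / 8 * exp (- (4 / \<epsilon>\<^sup>2 * T'))"
    have w: "0 < w" "w \<le> \<epsilon> / 8"
      using e T'b by (auto simp: w_def mult_le_cancel_left1)
    have "uniformly_continuous_on {0..T'} X" "uniformly_continuous_on {0..T'} Y"
      by (intro compact_uniformly_continuous continuous_on_subset[OF cont(1) sub]
        continuous_on_subset[OF cont(2) sub] compact_Icc)+
    then obtain d1 d2 where d: "0 < d1" "0 < d2"
      "\<And>s t. s \<in> {0..T'} \<Longrightarrow> t \<in> {0..T'} \<Longrightarrow> dist s t < d1 \<Longrightarrow> dist (X s) (X t) < w"
      "\<And>s t. s \<in> {0..T'} \<Longrightarrow> t \<in> {0..T'} \<Longrightarrow> dist s t < d2 \<Longrightarrow> dist (Y s) (Y t) < w"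
      unfolding uniformly_continuous_on_def using w(1) by (metis dist_commute)
    show "\<exists>h0>0. \<forall>h K. 0 < h \<longrightarrow> h < h0 \<longrightarrow> T \<le> real K * h \<longrightarrow>
      1 - r \<le> ratio (euler \<epsilon> h x y (\<lambda>k. B (real (Suc k) * h) - B (real k * h)) K)"
    proof (intro exI[of _ "min d1 d2"] conjI allI impI)
      show "0 < min d1 d2" using d by simp
      fix h :: real and K :: nat assume h: "0 < h" "h < min d1 d2" and K: "T \<le> real K * h"
      define b where "b = (\<lambda>k. B (real (Suc k) * h) - B (real k * h))"
      have mod: "\<bar>X s - X t\<bar> \<le> w \<and> \<bar>Y s - Y t\<bar> \<le> w"
        if "s \<in> {0..T'}" "t \<in> {0..T'}" "\<bar>s - t\<bar> \<le> h" for s t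
        using d(3)[OF that(1,2)] d(4)[OF that(1,2)] that(3) h by (auto simp: dist_real_def)
      have err: "\<bar>fst (euler \<epsilon> h x y b k) - X (real k * h)\<bar> \<le> \<epsilon> / 8 \<and>
          \<bar>snd (euler \<epsilon> h x y b k) - Y (real k * h)\<bar> \<le> \<epsilon> / 8"
        if k: "real k * h \<le> T'" and run: "\<And>j. j < k \<Longrightarrow> \<epsilon> \<le> fst (euler \<epsilon> h x y b j) \<and> \<epsilon> \<le> snd (euler \<epsilon> h x y b j)" for k
      proof -
        have E: "\<bar>fst (euler \<epsilon> h x y b k) - X (real k * h)\<bar> \<le> w * ((1 + 4 / \<epsilon>\<^sup>2 * h) ^ k - 1) \<and>
          \<bar>snd (euler \<epsilon> h x y b k) - Y (real k * h)\<bar> \<le> w * ((1 + 4 / \<epsilon>\<^sup>2 * h) ^ k - 1)"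
        proof (rule euler_error[where T = T' and B = B])
          show "X t = x + 2 * (B t - B 0) + integral {0..t} (\<lambda>s. 2 / Y s)" if "t \<in> {0..T'}" for t
            using eqX[of t] that T'T by auto
          show "Y t = y - 2 * (B t - B 0) + integral {0..t} (\<lambda>s. 2 / X s)" if "t \<in> {0..T'}" for t
            using eqY[of t] that T'T by auto
          show "\<epsilon> / 2 \<le> X t \<and> \<epsilon> / 2 \<le> Y t" if "t \<in> {0..T'}" for t
          proof -
            have "c \<le> X t" using c(2) sub that by blast
            moreover have "\<epsilon> / 2 \<le> Y t" using before[of t] YT' that by (cases "t = T'") auto
            ultimately show ?thesis using ec e c by linarith
          qed
        qed (use e h w T'b continuous_on_subset[OF cont(1) sub] continuous_on_subset[OF cont(2) sub] mod k run
              in \<open>auto simp: b_def\<close>)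
        have "(1 + 4 / \<epsilon>\<^sup>2 * h) ^ k \<le> exp (4 / \<epsilon>\<^sup>2 * h) ^ k"
          using e h by (intro power_mono exp_ge_add_one_self) auto
        also have "\<dots> = exp (4 / \<epsilon>\<^sup>2 * (real k * h))" by (simp add: exp_of_nat_mult[symmetric] mult_ac)
        also have "\<dots> \<le> exp (4 / \<epsilon>\<^sup>2 * T')" using k e by (simp add: divide_right_mono)
        finally have "w * ((1 + 4 / \<epsilon>\<^sup>2 * h) ^ k - 1) \<le> w * exp (4 / \<epsilon>\<^sup>2 * T')"
          using w by (intro mult_left_mono) auto
        also have "\<dots> = \<epsilon> / 8" by (simp add: w_def exp_minus)
        finally show ?thesis using E by linarith
      qed
      define N where "N = nat \<lfloor>T' / h\<rfloor>"
      have "0 \<le> T' / h" using T'b h by simp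
      then have "real N \<le> T' / h" "T' / h < real N + 1" by (simp_all add: N_def)
      then have N: "real N * h \<le> T'" "T' < real N * h + h" using h by (simp_all add: field_simps)
      let ?stop = "\<lambda>k. fst (euler \<epsilon> h x y b k) < \<epsilon> \<or> snd (euler \<epsilon> h x y b k) < \<epsilon>"
      \<comment> \<open>Otherwise the second coordinate at step \<open>N\<close> would be at most
        \<epsilon> / 2 + \<epsilon> / 8 + \<epsilon> / 8 < \<epsilon>.\<close>
      have "\<exists>k\<le>N. ?stop k"
      proof (rule ccontr)
        assume "\<not> (\<exists>k\<le>N. ?stop k)"
        then have run: "\<And>j. j \<le> N \<Longrightarrow> \<epsilon> \<le> fst (euler \<epsilon> h x y b j) \<and> \<epsilon> \<le> snd (euler \<epsilon> h x y b j)"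
          by (auto simp: not_less)
        have "\<bar>snd (euler \<epsilon> h x y b N) - Y (real N * h)\<bar> \<le> \<epsilon> / 8"
          using err[OF N(1)] run by auto
        moreover have "\<bar>Y (real N * h) - Y T'\<bar> \<le> w" using N T'b h by (intro mod[THEN conjunct2]) auto
        ultimately show False using run[of N] YT' w e by (auto simp: abs_le_iff)
      qed
      then obtain k0 where k0: "k0 \<le> N" "?stop k0" by blast
      define k where "k = (LEAST k. ?stop k)"
      have stop: "?stop k" unfolding k_def by (rule LeastI[of ?stop, OF k0(2)])
      have "k \<le> k0" unfolding k_def by (rule Least_le[of ?stop, OF k0(2)])
      then have kN: "k \<le> N" using k0 by simp
      have run: "\<epsilon> \<le> fst (euler \<epsilon> h x y b j) \<and> \<epsilon> \<le> snd (euler \<epsilon> h x y b j)" if "j < k" for j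
        using not_less_Least[of j ?stop] that by (auto simp: k_def not_less)
      have "real k * h \<le> real N * h" using kN h by (intro mult_right_mono) auto
      then have kT: "real k * h \<le> T'" using N(1) by (rule order_trans)
      define A where "A = fst (euler \<epsilon> h x y b k)"
      define D where "D = snd (euler \<epsilon> h x y b k)"
      have "c \<le> X (real k * h)" using kT T'b h by (intro c(2)) auto
      then have A: "c / 2 \<le> A" using err[OF kT run, THEN conjunct1] ec e unfolding A_def[symmetric] by linarith
      then have D: "D < \<epsilon>" using stop ec by (auto simp: A_def D_def)
      have AD: "0 < A + D" using euler_sum_ge[OF e(1) h(1) x y, of b k] x y by (simp add: A_def D_def)
      have "r * (c / 2) \<le> r * A" using A r by (intro mult_left_mono) auto
      moreover have "(1 - r) * D \<le> \<epsilon>"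
      proof (cases "D \<le> 0")
        case True
        then have "(1 - r) * D \<le> 0" using r by (simp add: mult_nonneg_nonpos)
        then show ?thesis using e by simp
      next
        case False
        then have "(1 - r) * D \<le> 1 * D" using r by (intro mult_right_mono) auto
        then show ?thesis using D by simp
      qed
      ultimately have "(1 - r) * (A + D) \<le> A" using ec by (simp add: algebra_simps)
      then have rat: "1 - r \<le> A / (A + D)" using AD by (simp add: pos_le_divide_eq)
      have "real k * h < real K * h" using kT T'T K by linarith
      then have "k \<le> K" using h by simp
      from euler_stays[OF stop this] rat
      show "1 - r \<le> ratio (euler \<epsilon> h x y (\<lambda>k. B (real (Suc k) * h) - B (real k * h)) K)"
        unfolding b_def[symmetric] by (simp add: ratio_def A_def D_def)
    qed
  qed
qed


text \<open>An upper bound suffices: the bounds for the two sides of the quadrant add up to 1.\<close>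

lemma brownian_exit_prob_le:
  assumes B: "brownian_motion N B" and x: "0 < x" and y: "0 < y" and A: "A \<in> sets N"
    and sol: "AE w in N. w \<in> A \<longrightarrow> (\<exists>T X Y. 0 < T \<and> continuous_on {0..T} X \<and> continuous_on {0..T} Y \<and>
      (\<forall>t\<in>{0..<T}. 0 < X t \<and> 0 < Y t \<and>
         X t = x + 2 * (B t w - B 0 w) + integral {0..t} (\<lambda>s. 2 / Y s) \<and>
         Y t = y - 2 * (B t w - B 0 w) + integral {0..t} (\<lambda>s. 2 / X s)) \<and> 0 < X T \<and> Y T = 0)"
  shows "measure N A \<le> x / (x + y)"
proof -
  interpret prob_space N using B by (simp add: brownian_motion_def)
  have Bm[measurable]: "B t \<in> borel_measurable N" if "0 \<le> t" for t
    using B that by (simp add: brownian_motion_def)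
  define inc where "inc h w k = B (real (Suc k) * h) w - B (real k * h) w" for h w k
  define Z where "Z \<epsilon> h K w = ratio (euler \<epsilon> h x y (inc h w) K)" for \<epsilon> h K w
  \<comment> \<open>Level 1 / (m + 1), step 1 / (n + 1) and (m + 1) (n + 1) steps, so the scheme
    runs up to time m + 1. These events involve \<open>B\<close> only on a grid and are therefore
    measurable, although the solutions in \<open>sol\<close> come without any measurability.
    \<open>F\<close> and \<open>G\<close> express "for all large n" and "for all large m".\<close>
  define E where "E r m n = {w \<in> space N. 1 - r \<le> Z (1 / real (Suc m)) (1 / real (Suc n)) (Suc m * Suc n) w}" for r m n
  define F where "F r m = (\<Union>k. \<Inter>n\<in>{k..}. E r m n)" for r m
  define G where "G r = (\<Union>k. \<Inter>m\<in>{k..}. F r m)" for r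
  have Em[measurable]: "E r m n \<in> events" for r m n
  proof -
    have "(\<lambda>w. Z (1 / real (Suc m)) (1 / real (Suc n)) (Suc m * Suc n) w) \<in> borel_measurable N"
      unfolding Z_def by (rule measurable_ratio_euler) (auto simp: x y inc_def)
    then show ?thesis unfolding E_def by measurable
  qed
  have Fm[measurable]: "F r m \<in> events" for r m unfolding F_def by measurable
  have Gm[measurable]: "G r \<in> events" for r unfolding G_def by measurable
  have Eb: "prob (E r m n) \<le> x / (x + y) / (1 - r) + real (Suc m) * 48 / ((x + y) * (1 / real (Suc m)) ^ 3) / (1 - r) * (1 / real (Suc n))"
    if r: "r < 1" for r m n
  proof -
    define h where "h = 1 / real (Suc n)"
    define \<epsilon> where "\<epsilon> = 1 / real (Suc m)"
    have h: "0 < h" and e: "0 < \<epsilon>" by (simp_all add: h_def \<epsilon>_def)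
    have inc: "incseq (\<lambda>k. real k * h)" using h by (auto simp: incseq_def)
    have "(1 - r) * prob {w \<in> space N. 1 - r \<le> ratio (euler \<epsilon> h x y (\<lambda>j. inc h w j) (Suc m * Suc n))}
      \<le> x / (x + y) + real (Suc m * Suc n) * 48 * h\<^sup>2 / ((x + y) * \<epsilon> ^ 3)"
    proof (rule prob_ratio_euler_le[OF e h x y r])
      have "\<forall>ts :: nat \<Rightarrow> real. 0 \<le> ts 0 \<longrightarrow> incseq ts \<longrightarrow>
         indep_vars (\<lambda>_. borel) (\<lambda>k w. B (ts (Suc k)) w - B (ts k) w) UNIV"
        using B by (simp add: brownian_motion_def)
      from this[rule_format, of "\<lambda>k. real k * h", OF _ inc]
      show "indep_vars (\<lambda>_. borel) (\<lambda>j w. inc h w j) UNIV" by (simp add: inc_def)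
      have dB: "distributed N lborel (\<lambda>w. B t w - B s w) (\<lambda>x. ennreal (normal_density 0 (sqrt (t - s)) x))"
        if "0 \<le> s" "s < t" for s t
        using B that by (auto simp: brownian_motion_def)
      show "distributed N lborel (\<lambda>w. inc h w k) (\<lambda>t. ennreal (normal_density 0 (sqrt h) t))" for k
        using dB[of "real k * h" "real (Suc k) * h"] h by (simp add: inc_def algebra_simps)
    qed
    \<comment> \<open>The number of steps times h^2 is (m + 1) h, which vanishes as n grows with m
      fixed; this dictates the order of the two limits.\<close>
    also have "real (Suc m * Suc n) * 48 * h\<^sup>2 / ((x + y) * \<epsilon> ^ 3) = real (Suc m) * 48 / ((x + y) * \<epsilon> ^ 3) * h"
    proof -
      have "real (Suc m * Suc n) * 48 * h\<^sup>2 = real (Suc m) * 48 * h"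
        by (simp only: of_nat_mult h_def power2_eq_square) (simp del: of_nat_Suc)
      then show ?thesis by (simp only: times_divide_eq_left)
    qed
    finally have "(1 - r) * prob (E r m n) \<le> x / (x + y) + real (Suc m) * 48 / ((x + y) * \<epsilon> ^ 3) * h"
      by (simp add: E_def Z_def h_def \<epsilon>_def)
    then have "prob (E r m n) \<le> (x / (x + y) + real (Suc m) * 48 / ((x + y) * \<epsilon> ^ 3) * h) / (1 - r)"
      using r by (simp add: pos_le_divide_eq mult.commute)
    then show ?thesis
      unfolding h_def[symmetric] \<epsilon>_def[symmetric] by (simp only: add_divide_distrib times_divide_eq_left)
  qed
  have Fb: "prob (F r m) \<le> x / (x + y) / (1 - r)" if r: "r < 1" for r m
    unfolding F_def
  proof (rule prob_eventually_le[OF Em Eb[OF r]])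
    show "(\<lambda>n. real (Suc m) * 48 / ((x + y) * (1 / real (Suc m)) ^ 3) / (1 - r) * (1 / real (Suc n))) \<longlonglongrightarrow> 0"
      by (intro tendsto_mult_right_zero LIMSEQ_Suc[OF lim_1_over_n])
  qed
  have Gb: "prob (G r) \<le> x / (x + y) / (1 - r)" if r: "r < 1" for r
    unfolding G_def by (rule prob_eventually_le[where c = "\<lambda>_. 0"]) (use Fm Fb[OF r] in auto)
  have AG: "prob A \<le> prob (G r)" if r: "0 < r" "r < 1" for r
  proof (rule finite_measure_mono_AE[OF _ Gm])
    show "AE w in N. w \<in> A \<longrightarrow> w \<in> G r"
      using sol AE_space
    proof eventually_elim
      case (elim w)
      show ?case
      proof
        assume "w \<in> A"
        with elim obtain T X Y where S: "0 < T" "continuous_on {0..T} X" "continuous_on {0..T} Y"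
          "\<And>t. t \<in> {0..<T} \<Longrightarrow> 0 < X t" "\<And>t. t \<in> {0..<T} \<Longrightarrow> 0 < Y t"
          "\<And>t. t \<in> {0..<T} \<Longrightarrow> X t = x + 2 * (B t w - B 0 w) + integral {0..t} (\<lambda>s. 2 / Y s)"
          "\<And>t. t \<in> {0..<T} \<Longrightarrow> Y t = y - 2 * (B t w - B 0 w) + integral {0..t} (\<lambda>s. 2 / X s)"
          "0 < X T" "Y T = 0" by blast
        have XT: "0 < X t" if "t \<in> {0..T}" for t using S(4)[of t] S(8) that by (cases "t = T") auto
        obtain \<epsilon>0 where e0: "0 < \<epsilon>0"
          "\<And>\<epsilon>. 0 < \<epsilon> \<Longrightarrow> \<epsilon> < \<epsilon>0 \<Longrightarrow> \<exists>h0>0. \<forall>h K. 0 < h \<longrightarrow> h < h0 \<longrightarrow> T \<le> real K * h \<longrightarrow>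
            1 - r \<le> ratio (euler \<epsilon> h x y (\<lambda>k. B (real (Suc k) * h) w - B (real k * h) w) K)"
          using euler_ratio_converges[OF S(1) x y r S(2,3,6,7,5) XT S(9)] by blast
        obtain m1 where m1: "1 / real (Suc m1) < \<epsilon>0" using nat_approx_posE[OF e0(1)] by blast
        obtain m2 :: nat where m2: "T \<le> real m2" using real_arch_simple by blast
        have "w \<in> F r m" if m: "m \<ge> max m1 m2" for m
        proof -
          have "1 / real (Suc m) \<le> 1 / real (Suc m1)" using m by (intro divide_left_mono) auto
          then obtain h0 where h0: "h0 > 0" "\<And>h K. 0 < h \<Longrightarrow> h < h0 \<Longrightarrow> T \<le> real K * h \<Longrightarrow>
            1 - r \<le> ratio (euler (1 / real (Suc m)) h x y (\<lambda>k. B (real (Suc k) * h) w - B (real k * h) w) K)"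
            using e0(2)[of "1 / real (Suc m)"] m1 by auto
          obtain n1 where n1: "1 / real (Suc n1) < h0" using nat_approx_posE[OF h0(1)] by blast
          have "w \<in> E r m n" if n: "n \<ge> n1" for n
          proof -
            have "1 / real (Suc n) \<le> 1 / real (Suc n1)" using n by (intro divide_left_mono) auto
            then have "1 / real (Suc n) < h0" using n1 by linarith
            moreover have "T \<le> real (Suc m * Suc n) * (1 / real (Suc n))"
              using m2 m by (simp only: of_nat_mult) (simp del: of_nat_Suc)
            ultimately have "1 - r \<le> ratio (euler (1 / real (Suc m)) (1 / real (Suc n)) x y
              (\<lambda>k. B (real (Suc k) * (1 / real (Suc n))) w - B (real k * (1 / real (Suc n))) w) (Suc m * Suc n))"
              by (intro h0(2)) auto
            then show ?thesis using elim(2) unfolding E_def Z_def inc_def by blast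
          qed
          then show ?thesis unfolding F_def by blast
        qed
        then show "w \<in> G r" unfolding G_def by blast
      qed
    qed
  qed
  \<comment> \<open>The tolerance r tends to 0 along 1 / (n + 2), which is always below 1.\<close>
  have "(\<lambda>n. x / (x + y) / (1 - 1 / real (Suc (Suc n)))) \<longlonglongrightarrow> x / (x + y) / (1 - 0)"
    by (intro tendsto_intros LIMSEQ_Suc[OF LIMSEQ_Suc[OF lim_1_over_n]]) auto
  moreover have "prob A \<le> x / (x + y) / (1 - 1 / real (Suc (Suc n)))" for n
    using AG[of "1 / real (Suc (Suc n))"] Gb[of "1 / real (Suc (Suc n))"] by simp
  ultimately show ?thesis
    by (intro LIMSEQ_le_const[of "\<lambda>n. x / (x + y) / (1 - 1 / real (Suc (Suc n)))"]) auto
qed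

text \<open>For the top side \<open>X\<close> and \<open>Y\<close> exchange their roles, which
  reverses the sign of the noise.\<close>

lemma brownian_motion_uminus:
  assumes "brownian_motion N B"
  shows "brownian_motion N (\<lambda>t w. - B t w)"
proof -
  interpret prob_space N using assms by (simp add: brownian_motion_def)
  have 1: "distributed N lborel (\<lambda>w. - B t w - - B s w) (\<lambda>x. ennreal (normal_density 0 (sqrt (t - s)) x))"
    if "0 \<le> s" "s < t" for s t
  proof -
    have "distributed N lborel (\<lambda>w. B t w - B s w) (\<lambda>x. ennreal (normal_density 0 (sqrt (t - s)) x))"
      using assms that by (auto simp: brownian_motion_def)
    from normal_density_affine[OF this _, of "-1" 0] that show ?thesis by simp
  qed
  have 2: "indep_vars (\<lambda>_. borel) (\<lambda>k w. - B (ts (Suc k)) w - - B (ts k) w) UNIV"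
    if "0 \<le> ts 0" "incseq ts" for ts :: "nat \<Rightarrow> real"
  proof -
    have "indep_vars (\<lambda>_. borel) (\<lambda>k w. B (ts (Suc k)) w - B (ts k) w) UNIV"
      using assms that by (auto simp: brownian_motion_def)
    from indep_vars_compose2[OF this, of "\<lambda>_. uminus" "\<lambda>_. borel"] show ?thesis by simp
  qed
  have "AE w in N. B 0 w = 0" "AE w in N. continuous_on {0..} (\<lambda>t. B t w)"
    using assms by (auto simp: brownian_motion_def)
  then have 3: "AE w in N. - B 0 w = 0" "AE w in N. continuous_on {0..} (\<lambda>t. - B t w)"
    by (simp, elim eventually_mono, intro continuous_on_minus)
  show ?thesis
    unfolding brownian_motion_def using assms 1 2 3 prob_space_axioms
    by (simp add: brownian_motion_def)
qed

section \<open>Conformal maps of the rectangle\<close>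

text \<open>From |z - conj u|^2 - |z - u|^2 = 4 Im z Im u; it shows that Cayley transforms and their
  inverses map between the half-plane and the disc.\<close>

lemma cmod_diff_cnj_less: "cmod (z - u) < cmod (z - cnj u) \<longleftrightarrow> 0 < Im z * Im u"
proof -
  have "(cmod (z - cnj u))\<^sup>2 - (cmod (z - u))\<^sup>2 = 4 * (Im z * Im u)"
    by (simp only: cmod_power2) (simp add: power2_eq_square algebra_simps)
  moreover have "cmod (z - u) < cmod (z - cnj u) \<longleftrightarrow> (cmod (z - u))\<^sup>2 < (cmod (z - cnj u))\<^sup>2"
    using power_mono_iff[of "cmod (z - cnj u)" "cmod (z - u)" 2] by (simp add: not_le[symmetric])
  ultimately show ?thesis by linarith
qed

text \<open>Schwarz's lemma for \<open>f\<close> and for its left inverse gives |f z| = |z|.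
  Equality at one nonzero point, here 1 / 2, already makes \<open>f\<close> linear.\<close>

lemma disc_automorphism_rotation:
  assumes "f holomorphic_on ball 0 1" "g holomorphic_on ball 0 1"
    and f: "\<And>z. norm z < 1 \<Longrightarrow> norm (f z) < 1" and g: "\<And>z. norm z < 1 \<Longrightarrow> norm (g z) < 1"
    and "f 0 = 0" "g 0 = 0" and gf: "\<And>z. norm z < 1 \<Longrightarrow> g (f z) = z"
  obtains \<alpha> :: complex where "\<And>z. norm z < 1 \<Longrightarrow> f z = \<alpha> * z"
proof -
  have "norm (f z) = norm z" if "norm z < 1" for z
  proof (rule antisym)
    show "norm (f z) \<le> norm z" using assms by (intro Schwarz_Lemma(1) that) auto
    have "norm (g (f z)) \<le> norm (f z)" using assms by (intro Schwarz_Lemma(1) that) (auto simp: that)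
    then show "norm z \<le> norm (f z)" using gf[OF that] by simp
  qed
  moreover have "norm (1 / 2 :: complex) < 1" "(1 / 2 :: complex) \<noteq> 0" by (simp_all add: norm_divide)
  ultimately have "\<exists>z. norm z < 1 \<and> z \<noteq> 0 \<and> norm (f z) = norm z" by blast
  then show thesis using Schwarz_Lemma(3)[of f 0] assms that by auto
qed

text \<open>After Cayley transforms centred at \<open>f p\<close> and \<open>g p\<close>, the
  transition from \<open>g\<close> to \<open>f\<close> is a disc automorphism fixing 0, hence a
  rotation. In this form the Moebius relation has a limit even where \<open>g\<close> tends to
  infinity.\<close>

lemma conformal_pair_relation:
  assumes f: "conformal_onto f S halfplane" and g: "conformal_onto g S halfplane"
    and S: "open S" "p \<in> S"
  obtains u v \<alpha> where "0 < Im u" "0 < Im v"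
    "\<And>z. z \<in> S \<Longrightarrow> (f z - u) / (f z - cnj u) = \<alpha> * ((g z - v) / (g z - cnj v))"
proof -
  \<comment> \<open>\<open>C v\<close> is the Cayley transform sending \<open>v\<close> to 0,
    \<open>Ci v\<close> its inverse.\<close>
  define C where "C v z = (z - v) / (z - cnj v)" for v z :: complex
  define Ci where "Ci v \<zeta> = (v - cnj v * \<zeta>) / (1 - \<zeta>)" for v \<zeta> :: complex
  have C1: "cmod (C v z) < 1" if "0 < Im v" "z \<in> halfplane" for v z
  proof -
    have "cmod (z - v) < cmod (z - cnj v)" using that by (simp add: cmod_diff_cnj_less halfplane_def)
    then show ?thesis unfolding C_def norm_divide by (subst divide_less_eq_1) auto
  qed
  have nz: "z - cnj v \<noteq> 0" if "0 < Im v" "z \<in> halfplane" for v z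
    using that by (auto simp: halfplane_def complex_eq_iff)
  have CCi: "C v (Ci v \<zeta>) = \<zeta>" "Ci v \<zeta> \<in> halfplane" if "0 < Im v" "cmod \<zeta> < 1" for v \<zeta>
  proof -
    have z1: "1 - \<zeta> \<noteq> 0" using that by auto
    have vv: "v - cnj v \<noteq> 0" using that by (auto simp: complex_eq_iff)
    have a: "Ci v \<zeta> - v = \<zeta> * (v - cnj v) / (1 - \<zeta>)" "Ci v \<zeta> - cnj v = (v - cnj v) / (1 - \<zeta>)"
      using z1 by (simp_all add: Ci_def field_simps)
    show "C v (Ci v \<zeta>) = \<zeta>" unfolding C_def a using z1 vv by simp
    have "0 < cmod (v - cnj v) / cmod (1 - \<zeta>)" using z1 vv by simp
    then have "cmod \<zeta> * (cmod (v - cnj v) / cmod (1 - \<zeta>)) < 1 * (cmod (v - cnj v) / cmod (1 - \<zeta>))"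
      using that(2) by (intro mult_strict_right_mono)
    then have "cmod (Ci v \<zeta> - v) < cmod (Ci v \<zeta> - cnj v)" unfolding a by (simp add: norm_mult norm_divide)
    then show "Ci v \<zeta> \<in> halfplane" using that by (simp add: cmod_diff_cnj_less halfplane_def zero_less_mult_iff)
  qed
  have CiC: "Ci v (C v z) = z" if "0 < Im v" "z \<in> halfplane" for v z
  proof -
    have vv: "v - cnj v \<noteq> 0" using that by (auto simp: complex_eq_iff)
    have a: "1 - C v z = (v - cnj v) / (z - cnj v)" "v - cnj v * C v z = z * (v - cnj v) / (z - cnj v)"
      using nz[OF that] by (simp_all add: C_def field_simps)
    show ?thesis unfolding Ci_def a using vv nz[OF that] by simp
  qed
  have inv: "\<exists>k. k holomorphic_on halfplane \<and> (\<forall>z\<in>S. k (F z) = z) \<and> (\<forall>w\<in>halfplane. k w \<in> S \<and> F (k w) = w)"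
    if "conformal_onto F S halfplane" for F
  proof -
    have F: "F holomorphic_on S" "inj_on F S" "F ` S = halfplane"
      using that by (auto simp: conformal_onto_def bij_betw_def)
    obtain k where "k holomorphic_on F ` S" "\<And>z. z \<in> S \<Longrightarrow> k (F z) = z"
      by (rule holomorphic_has_inverse[OF F(1) S(1) F(2)]) blast
    then show ?thesis by (intro exI[of _ k]) (auto simp flip: F(3))
  qed
  obtain fi where fi: "fi holomorphic_on halfplane" "\<forall>z\<in>S. fi (f z) = z" "\<forall>w\<in>halfplane. fi w \<in> S \<and> f (fi w) = w"
    using inv[OF f] by blast
  obtain gi where gi: "gi holomorphic_on halfplane" "\<forall>z\<in>S. gi (g z) = z" "\<forall>w\<in>halfplane. gi w \<in> S \<and> g (gi w) = w"
    using inv[OF g] by blast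
  have fS: "f z \<in> halfplane" "g z \<in> halfplane" if "z \<in> S" for z
    using f g that by (auto simp: conformal_onto_def bij_betw_def)
  have fh: "f holomorphic_on S" "g holomorphic_on S" using f g by (auto simp: conformal_onto_def)
  define u v where "u = f p" and "v = g p"
  have uv: "0 < Im u" "0 < Im v" using fS[OF S(2)] by (auto simp: u_def v_def halfplane_def)
  have holC: "(\<lambda>z. C v (F z)) holomorphic_on A" if "F holomorphic_on A" "F ` A \<subseteq> halfplane" "0 < Im v" for F A v
    unfolding C_def using nz[OF that(3)] that(2) by (intro holomorphic_intros that(1)) blast
  have holCi: "Ci v holomorphic_on ball 0 1" for v
    unfolding Ci_def by (intro holomorphic_intros) auto
  define K1 where "K1 \<zeta> = C u (f (gi (Ci v \<zeta>)))" for \<zeta>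
  define K2 where "K2 \<zeta> = C v (g (fi (Ci u \<zeta>)))" for \<zeta>
  have Cih: "Ci v ` ball 0 1 \<subseteq> halfplane" if "0 < Im v" for v
    using CCi(2)[OF that] by auto
  have hol1: "(\<lambda>\<zeta>. F (k (Ci v \<zeta>))) holomorphic_on ball 0 1"
    if "F holomorphic_on S" "k holomorphic_on halfplane" "\<forall>w\<in>halfplane. k w \<in> S" "0 < Im v" for F k v
  proof -
    have "(k \<circ> Ci v) holomorphic_on ball 0 1"
      by (rule holomorphic_on_compose_gen[OF holCi that(2) Cih[OF that(4)]])
    then have "(F \<circ> (k \<circ> Ci v)) holomorphic_on ball 0 1"
      by (rule holomorphic_on_compose_gen[OF _ that(1)]) (use Cih[OF that(4)] that(3) in auto)
    then show ?thesis by (simp add: o_def)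
  qed
  obtain \<alpha> where \<alpha>: "\<And>\<zeta>. norm \<zeta> < 1 \<Longrightarrow> K1 \<zeta> = \<alpha> * \<zeta>"
  proof (rule disc_automorphism_rotation[of K1 K2])
    have im1: "f (gi (Ci v \<zeta>)) \<in> halfplane" "g (fi (Ci u \<zeta>)) \<in> halfplane" if "norm \<zeta> < 1" for \<zeta>
      using fS gi(3) fi(3) CCi(2)[OF uv(1) that] CCi(2)[OF uv(2) that] by auto
    show "K1 holomorphic_on ball 0 1" unfolding K1_def
      using gi(3) im1(1) by (intro holC[OF hol1[OF fh(1) gi(1) _ uv(2)] _ uv(1)]) auto
    show "K2 holomorphic_on ball 0 1" unfolding K2_def
      using fi(3) im1(2) by (intro holC[OF hol1[OF fh(2) fi(1) _ uv(1)] _ uv(2)]) auto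
    show "norm (K1 \<zeta>) < 1" "norm (K2 \<zeta>) < 1" if "norm \<zeta> < 1" for \<zeta>
      unfolding K1_def K2_def using C1 uv im1[OF that] by auto
    have "Ci v 0 = v" "Ci u 0 = u" by (simp_all add: Ci_def)
    then show "K1 0 = 0" "K2 0 = 0"
      using fi(2) gi(2) S(2) by (simp_all add: K1_def K2_def C_def u_def v_def)
    fix \<zeta> :: complex assume z: "norm \<zeta> < 1"
    have "Ci u (K1 \<zeta>) = f (gi (Ci v \<zeta>))" unfolding K1_def using CiC uv im1[OF z] by auto
    then have "fi (Ci u (K1 \<zeta>)) = gi (Ci v \<zeta>)" using fi(2) gi(3) CCi(2)[OF uv(2) z] by auto
    then show "K2 (K1 \<zeta>) = \<zeta>" unfolding K2_def using gi(3) CCi[OF uv(2) z] by auto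
  qed (rule that)
  show thesis
  proof (rule that[OF uv])
    fix z assume z: "z \<in> S"
    have "K1 (C v (g z)) = \<alpha> * C v (g z)" by (rule \<alpha>) (use C1 uv fS[OF z] in auto)
    moreover have "K1 (C v (g z)) = C u (f z)"
      unfolding K1_def using CiC[OF uv(2)] fS[OF z] gi(2) z by auto
    ultimately show "(f z - u) / (f z - cnj u) = \<alpha> * ((g z - v) / (g z - cnj v))" by (simp add: C_def)
  qed
qed

section \<open>Cross-ratios of the corners of the rectangle\<close>

lemma rect_eq_box: "rect L = box 0 (Complex L 1)"
  by (auto simp: rect_def in_box_complex_iff)

lemma open_rect: "open (rect L)" by (simp only: rect_eq_box open_box)

lemma closure_rect: "0 < L \<Longrightarrow> closure (rect L) = {z. 0 \<le> Re z \<and> Re z \<le> L \<and> 0 \<le> Im z \<and> Im z \<le> 1}"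
proof -
  assume L: "0 < L"
  have "Complex (L/2) (1/2) \<in> box 0 (Complex L 1)" using L by (simp add: in_box_complex_iff)
  then have "box 0 (Complex L 1) \<noteq> {}" by blast
  then have *: "closure (rect L) = cbox 0 (Complex L 1)"
    unfolding rect_eq_box by (rule closure_box)
  show ?thesis unfolding * by (rule set_eqI) (simp add: in_cbox_complex_iff conj_ac)
qed

lemma at_within_rect_neq_bot:
  assumes "0 < L" "z \<in> closure (rect L)" "z \<notin> rect L"
  shows "at z within rect L \<noteq> bot"
  using assms by (simp add: trivial_limit_within islimpt_in_closure)

text \<open>The Moebius relation passes to the limit at the corners, and cross-ratios are Moebius
  invariant. With \<open>F\<close> infinite at \<open>d\<close>, the two factors containing
  \<open>d\<close> cancel.\<close>

lemma cross_ratio_eq: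
  fixes xa xb xc xd ya yc :: real
  assumes L: "0 < L" and f: "conformal_onto f (rect L) halfplane" and F: "conformal_onto F (rect L) halfplane"
    and fa: "(f \<longlongrightarrow> complex_of_real xa) (at corner_a within rect L)"
    and fb: "(f \<longlongrightarrow> complex_of_real xb) (at corner_b within rect L)"
    and fc: "(f \<longlongrightarrow> complex_of_real xc) (at (corner_c L) within rect L)"
    and fd: "(f \<longlongrightarrow> complex_of_real xd) (at (corner_d L) within rect L)"
    and Fa: "(F \<longlongrightarrow> complex_of_real ya) (at corner_a within rect L)"
    and Fb: "(F \<longlongrightarrow> complex_of_real yb) (at corner_b within rect L)"
    and Fc: "(F \<longlongrightarrow> complex_of_real yc) (at (corner_c L) within rect L)"
    and Fd: "filterlim F at_infinity (at (corner_d L) within rect L)"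
    and ne: "xa \<noteq> xc" "xb \<noteq> xd"
  shows "((xb - xa) * (xd - xc)) / ((xc - xa) * (xd - xb)) = (yb - ya) / (yc - ya)"
proof -
  have p: "Complex (L/2) (1/2) \<in> rect L" using L by (simp add: rect_def)
  obtain u v \<alpha> where uv: "0 < Im u" "0 < Im v"
    and rel: "\<And>z. z \<in> rect L \<Longrightarrow> (f z - u) / (f z - cnj u) = \<alpha> * ((F z - v) / (F z - cnj v))"
    by (rule conformal_pair_relation[OF f F open_rect p]) blast
  define s where "s x = (complex_of_real x - u) / (complex_of_real x - cnj u)" for x
  define r where "r y = (complex_of_real y - v) / (complex_of_real y - cnj v)" for y
  have nu: "complex_of_real x - u \<noteq> 0" "complex_of_real x - cnj u \<noteq> 0" for x
    using uv by (auto simp: complex_eq_iff)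
  have nv: "complex_of_real x - v \<noteq> 0" "complex_of_real x - cnj v \<noteq> 0" for x
    using uv by (auto simp: complex_eq_iff)
  have cl: "corner_a \<in> closure (rect L)" "corner_b \<in> closure (rect L)" "corner_c L \<in> closure (rect L)" "corner_d L \<in> closure (rect L)"
    "corner_a \<notin> rect L" "corner_b \<notin> rect L" "corner_c L \<notin> rect L" "corner_d L \<notin> rect L"
    unfolding closure_rect[OF L] using L
    by (auto simp: corner_a_def corner_b_def corner_c_def corner_d_def rect_def)
  have ev: "\<forall>\<^sub>F z in at w within rect L. (f z - u) / (f z - cnj u) = \<alpha> * ((F z - v) / (F z - cnj v))" for w
    using rel by (auto simp: eventually_at_filter)
  have sr: "s x = \<alpha> * r y" if "(f \<longlongrightarrow> complex_of_real x) (at w within rect L)" "(F \<longlongrightarrow> complex_of_real y) (at w within rect L)"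
    "w \<in> closure (rect L)" "w \<notin> rect L" for x y w
  proof -
    have 1: "((\<lambda>z. (f z - u) / (f z - cnj u)) \<longlongrightarrow> s x) (at w within rect L)"
      unfolding s_def by (intro tendsto_intros that nu)
    have "((\<lambda>z. \<alpha> * ((F z - v) / (F z - cnj v))) \<longlongrightarrow> \<alpha> * r y) (at w within rect L)"
      unfolding r_def by (intro tendsto_intros that nv)
    then have 2: "((\<lambda>z. (f z - u) / (f z - cnj u)) \<longlongrightarrow> \<alpha> * r y) (at w within rect L)"
      by (rule Lim_transform_eventually) (use ev[of w] in \<open>simp add: eq_commute\<close>)
    show ?thesis by (rule tendsto_unique[OF at_within_rect_neq_bot[OF L that(3,4)] 1 2])
  qed
  \<comment> \<open>The Cayley transform of \<open>F\<close> tends to 1 as \<open>F\<close> tends to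
    infinity, so 1 plays the part of the missing value of \<open>r\<close> at
    \<open>d\<close>.\<close>
  have sd: "s xd = \<alpha>"
  proof -
    let ?A = "at (corner_d L) within rect L"
    have 1: "((\<lambda>z. (f z - u) / (f z - cnj u)) \<longlongrightarrow> s xd) ?A"
      unfolding s_def by (intro tendsto_intros fd nu)
    have "((\<lambda>z. inverse (F z)) \<longlongrightarrow> 0) ?A" using tendsto_inverse_0 Fd by (rule filterlim_compose)
    then have "((\<lambda>z. \<alpha> * ((1 - v * inverse (F z)) / (1 - cnj v * inverse (F z)))) \<longlongrightarrow> \<alpha> * ((1 - v * 0) / (1 - cnj v * 0))) ?A"
      by (intro tendsto_intros) auto
    moreover have "\<forall>\<^sub>F z in ?A. \<alpha> * ((1 - v * inverse (F z)) / (1 - cnj v * inverse (F z))) = (f z - u) / (f z - cnj u)"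
    proof -
      have "\<forall>\<^sub>F z in ?A. F z \<noteq> 0" using Fd by (rule filterlim_at_infinity_imp_eventually_ne)
      then show ?thesis using ev[of "corner_d L"]
      proof eventually_elim
        case (elim z)
        have "F z * (1 - v * inverse (F z)) = F z - v" "F z * (1 - cnj v * inverse (F z)) = F z - cnj v"
          using elim(1) by (simp_all add: field_simps)
        then have "(F z - v) / (F z - cnj v) = (1 - v * inverse (F z)) / (1 - cnj v * inverse (F z))"
          using elim(1) mult_divide_mult_cancel_left[of "F z" "1 - v * inverse (F z)" "1 - cnj v * inverse (F z)"]
          by simp
        then show ?case using elim(2) by simp
      qed
    qed
    ultimately have "((\<lambda>z. (f z - u) / (f z - cnj u)) \<longlongrightarrow> \<alpha>) ?A"
      using Lim_transform_eventually by fastforce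
    with 1 show ?thesis using at_within_rect_neq_bot[OF L cl(4,8)] tendsto_unique by blast
  qed
  note sa = sr[OF fa Fa cl(1,5)] and sb = sr[OF fb Fb cl(2,6)] and sc = sr[OF fc Fc cl(3,7)]
  have ds: "s x - s x' = complex_of_real (x - x') * (u - cnj u) / ((complex_of_real x - cnj u) * (complex_of_real x' - cnj u))" for x x'
    unfolding s_def using nu by (simp add: field_simps)
  have dr: "r x - r x' = complex_of_real (x - x') * (v - cnj v) / ((complex_of_real x - cnj v) * (complex_of_real x' - cnj v))" for x x'
    unfolding r_def using nv by (simp add: field_simps)
  have dr1: "1 - r x = (v - cnj v) / (complex_of_real x - cnj v)" for x
    unfolding r_def using nv by (simp add: field_simps)
  have uu: "u - cnj u \<noteq> 0" and vv: "v - cnj v \<noteq> 0" using uv by (auto simp: complex_eq_iff)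
  have a0: "\<alpha> \<noteq> 0" using sd nu by (auto simp: s_def)
  have cancel: "X * K / (Y * K) = X / Y" if "K \<noteq> 0" for X Y K :: complex
    using that by simp
  define pa pb pc pd where "pa = complex_of_real xa - cnj u" and "pb = complex_of_real xb - cnj u"
    and "pc = complex_of_real xc - cnj u" and "pd = complex_of_real xd - cnj u"
  define qa qb qc where "qa = complex_of_real ya - cnj v" and "qb = complex_of_real yb - cnj v"
    and "qc = complex_of_real yc - cnj v"
  have pnz: "pa \<noteq> 0" "pb \<noteq> 0" "pc \<noteq> 0" "pd \<noteq> 0" "qa \<noteq> 0" "qb \<noteq> 0" "qc \<noteq> 0"
    using nu nv by (auto simp: pa_def pb_def pc_def pd_def qa_def qb_def qc_def)
  \<comment> \<open>By \<open>ds\<close> each difference is a real difference times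
    \<open>u - cnj u\<close> over two of the factors \<open>pa\<close>, \<open>pb\<close>,
    \<open>pc\<close>, \<open>pd\<close>. Every corner occurs once above and once below, which
    leaves a common factor.\<close>
  have "(s xb - s xa) * (s xd - s xc) / ((s xc - s xa) * (s xd - s xb)) =
      (complex_of_real (xb - xa) * complex_of_real (xd - xc)) * ((u - cnj u) * (u - cnj u) / (pa * pb * pc * pd)) /
      ((complex_of_real (xc - xa) * complex_of_real (xd - xb)) * ((u - cnj u) * (u - cnj u) / (pa * pb * pc * pd)))"
    unfolding ds pa_def[symmetric] pb_def[symmetric] pc_def[symmetric] pd_def[symmetric]
    by (simp add: mult_ac)
  also have "\<dots> = complex_of_real (((xb - xa) * (xd - xc)) / ((xc - xa) * (xd - xb)))"
    using pnz uu by (subst cancel) auto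
  finally have 1: "complex_of_real (((xb - xa) * (xd - xc)) / ((xc - xa) * (xd - xb))) =
      (s xb - s xa) * (s xd - s xc) / ((s xc - s xa) * (s xd - s xb))" ..
  have sd1: "s xb - s xa = \<alpha> * (r yb - r ya)" "s xc - s xa = \<alpha> * (r yc - r ya)"
      "s xd - s xc = \<alpha> * (1 - r yc)" "s xd - s xb = \<alpha> * (1 - r yb)"
    by (simp_all add: sa sb sc sd right_diff_distrib)
  have "(s xb - s xa) * (s xd - s xc) / ((s xc - s xa) * (s xd - s xb)) =
     (r yb - r ya) * (1 - r yc) * (\<alpha> * \<alpha>) / ((r yc - r ya) * (1 - r yb) * (\<alpha> * \<alpha>))"
    unfolding sd1 by (simp only: mult_ac)
  also have "\<dots> = (r yb - r ya) * (1 - r yc) / ((r yc - r ya) * (1 - r yb))"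
    using a0 by (intro cancel) auto
  also have "\<dots> = complex_of_real (yb - ya) * ((v - cnj v) * (v - cnj v) / (qa * qb * qc)) /
      (complex_of_real (yc - ya) * ((v - cnj v) * (v - cnj v) / (qa * qb * qc)))"
    unfolding dr dr1 qa_def[symmetric] qb_def[symmetric] qc_def[symmetric]
    by (simp add: mult_ac)
  also have "\<dots> = complex_of_real ((yb - ya) / (yc - ya))"
    using pnz vv by (subst cancel) auto
  finally show ?thesis using 1 by (simp only: of_real_eq_iff)
qed

section \<open>The endpoint of SLE\<close>

text \<open>\<open>F\<close> maps \<open>S\<close> onto the whole open half-plane and is injective
  on \<open>K\<close>, so only the real axis is left for other points.\<close>

lemma boundary_real:
  assumes F: "conformal_onto F S halfplane" and hom: "homeomorphism K {z. 0 \<le> Im z} F h"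
    and z: "z \<in> K" "z \<notin> S" and S: "S \<subseteq> K"
  shows "F z = complex_of_real (Re (F z))"
proof -
  have "0 \<le> Im (F z)" using hom z by (auto simp: homeomorphism_def)
  moreover have "F z \<notin> halfplane"
  proof
    assume "F z \<in> halfplane"
    then have "F z \<in> F ` S" using F by (simp add: conformal_onto_def bij_betw_def)
    then obtain y where y: "y \<in> S" "F y = F z" unfolding image_iff by metis
    then have "y = z" using hom z(1) S by (metis homeomorphism_apply1 subsetD)
    then show False using y z by simp
  qed
  ultimately show ?thesis by (simp add: halfplane_def complex_eq_iff)
qed

text \<open>A continuous injective real function on an interval is strictly monotone; this orders
  boundary images without a formula for \<open>F\<close>.\<close>

lemma boundary_monotone:
  fixes p :: "real \<Rightarrow> complex"
  assumes F: "conformal_onto F S halfplane" and hom: "homeomorphism K {z. 0 \<le> Im z} F h" and S: "S \<subseteq> K"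
    and p: "continuous_on {0..b} p" "inj_on p {0..b}" "p ` {0..b} \<subseteq> K - S"
    and t: "0 < t" "t < b"
  shows "(Re (F (p 0)) < Re (F (p t)) \<and> Re (F (p t)) < Re (F (p b))) \<or>
         (Re (F (p b)) < Re (F (p t)) \<and> Re (F (p t)) < Re (F (p 0)))"
proof (rule continuous_inj_imp_mono[OF t, where f = "\<lambda>t. Re (F (p t))"])
  have "continuous_on K F" using hom by (simp add: homeomorphism_def)
  then show "continuous_on {0..b} (\<lambda>t. Re (F (p t)))"
    using p(3) by (intro continuous_intros continuous_on_compose2[OF _ p(1), of K F]) auto
  show "inj_on (\<lambda>t. Re (F (p t))) {0..b}"
  proof (rule inj_onI)
    fix s u assume su: "s \<in> {0..b}" "u \<in> {0..b}" "Re (F (p s)) = Re (F (p u))"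
    have K: "p s \<in> K" "p s \<notin> S" "p u \<in> K" "p u \<notin> S" using su(1,2) p(3) by (auto simp: image_subset_iff)
    have "F (p s) = F (p u)"
      using boundary_real[OF F hom K(1,2) S] boundary_real[OF F hom K(3,4) S] su(3) by metis
    then have "p s = p u" using hom K by (metis homeomorphism_apply1)
    then show "s = u" using p(2) su by (auto dest: inj_onD)
  qed
qed

lemma rect_subset_closure: "rect L \<subseteq> closure (rect L) - {corner_d L}"
proof -
  have "corner_d L \<notin> rect L" by (simp add: corner_d_def rect_def)
  then show ?thesis using closure_subset[of "rect L"] by blast
qed

lemma rect_boundary_right:
  assumes L: "0 < L" and F: "conformal_onto F (rect L) halfplane"
    and hom: "homeomorphism (closure (rect L) - {corner_d L}) {z. 0 \<le> Im z} F h"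
    and Fb: "F corner_b = 0" and Fc: "F (corner_c L) = complex_of_real yR" and yR: "0 < yR"
    and z: "z \<in> closure (rect L)" "z \<noteq> corner_d L" "Re z = L"
  obtains x where "yR \<le> x" "F z = complex_of_real x"
proof (cases "Im z = 0")
  case True
  then have "z = corner_c L" using z by (simp add: corner_c_def complex_eq_iff)
  then show thesis using that Fc by auto
next
  case False
  have zb: "0 < Im z" "Im z < 1"
    using z False L unfolding closure_rect[OF L] by (auto simp: corner_d_def complex_eq_iff)
  \<comment> \<open>Runs from \<open>b\<close> along the bottom, reaches \<open>c\<close> at time
    \<open>L\<close>, then climbs to \<open>z\<close>. The image of \<open>c\<close> lies to the
    right of that of \<open>b\<close>, so images increase.\<close>
  define p where "p t = Complex (min t L) (max 0 (t - L))" for t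
  have sub: "rect L \<subseteq> closure (rect L) - {corner_d L}"
    by (rule rect_subset_closure)
  have "(Re (F (p 0)) < Re (F (p L)) \<and> Re (F (p L)) < Re (F (p (L + Im z)))) \<or>
         (Re (F (p (L + Im z))) < Re (F (p L)) \<and> Re (F (p L)) < Re (F (p 0)))"
  proof (rule boundary_monotone[OF F hom sub])
    show "continuous_on {0..L + Im z} p" unfolding p_def by (intro continuous_intros)
    show "inj_on p {0..L + Im z}"
      by (rule inj_onI) (auto simp: p_def min_def max_def split: if_splits)
    show "p ` {0..L + Im z} \<subseteq> closure (rect L) - {corner_d L} - rect L"
      using L zb unfolding closure_rect[OF L] by (auto simp: p_def rect_def corner_d_def min_def max_def split: if_splits)
  qed (use L zb in auto)
  moreover have "p 0 = corner_b" "p L = corner_c L" "p (L + Im z) = z"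
    using L z zb by (auto simp: p_def corner_b_def corner_c_def complex_eq_iff)
  ultimately have "yR < Re (F z)" using Fb Fc yR by auto
  moreover have "F z = complex_of_real (Re (F z))"
    by (rule boundary_real[OF F hom _ _ sub]) (use z in \<open>auto simp: rect_def\<close>)
  ultimately show thesis by (intro that[of "Re (F z)"]) auto
qed

lemma rect_boundary_top:
  assumes L: "0 < L" and F: "conformal_onto F (rect L) halfplane"
    and hom: "homeomorphism (closure (rect L) - {corner_d L}) {z. 0 \<le> Im z} F h"
    and Fb: "F corner_b = 0" and Fa: "F corner_a = complex_of_real yL" and yL: "yL < 0"
    and z: "z \<in> closure (rect L)" "z \<noteq> corner_d L" "Im z = 1"
  obtains x where "x \<le> yL" "F z = complex_of_real x"
proof (cases "Re z = 0")
  case True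
  then have "z = corner_a" using z by (simp add: corner_a_def complex_eq_iff)
  then show thesis using that Fa by auto
next
  case False
  have zb: "0 < Re z" "Re z < L"
    using z False L unfolding closure_rect[OF L] by (auto simp: corner_d_def complex_eq_iff)
  \<comment> \<open>Runs from \<open>b\<close> up the left side, reaches \<open>a\<close> at time 1,
    then follows the top to \<open>z\<close>; here images decrease.\<close>
  define p where "p t = Complex (max 0 (t - 1)) (min t 1)" for t :: real
  have sub: "rect L \<subseteq> closure (rect L) - {corner_d L}"
    by (rule rect_subset_closure)
  have "(Re (F (p 0)) < Re (F (p 1)) \<and> Re (F (p 1)) < Re (F (p (1 + Re z)))) \<or>
         (Re (F (p (1 + Re z))) < Re (F (p 1)) \<and> Re (F (p 1)) < Re (F (p 0)))"
  proof (rule boundary_monotone[OF F hom sub])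
    show "continuous_on {0..1 + Re z} p" unfolding p_def by (intro continuous_intros)
    show "inj_on p {0..1 + Re z}"
      by (rule inj_onI) (auto simp: p_def min_def max_def split: if_splits)
    show "p ` {0..1 + Re z} \<subseteq> closure (rect L) - {corner_d L} - rect L"
      using L zb unfolding closure_rect[OF L] by (auto simp: p_def rect_def corner_d_def min_def max_def split: if_splits)
  qed (use L zb in auto)
  moreover have "p 0 = corner_b" "p 1 = corner_a" "p (1 + Re z) = z"
    using L z zb by (auto simp: p_def corner_b_def corner_a_def complex_eq_iff)
  ultimately have "Re (F z) < yL" using Fb Fa yL by auto
  moreover have "F z = complex_of_real (Re (F z))"
    by (rule boundary_real[OF F hom _ _ sub]) (use z in \<open>auto simp: rect_def\<close>)
  ultimately show thesis by (intro that[of "Re (F z)"]) auto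
qed

text \<open>\<open>sle_driving\<close> states order and equations only before \<open>T\<close>; this
  carries weak inequalities to \<open>T\<close>.\<close>

lemma continuous_le_at_endpoint:
  fixes f g :: "real \<Rightarrow> real"
  assumes "0 < T" "continuous_on {0..T} f" "continuous_on {0..T} g" "\<And>t. t \<in> {0..<T} \<Longrightarrow> f t \<le> g t"
  shows "f T \<le> g T"
proof -
  have "closed {t \<in> {0..T}. f t \<le> g t}"
    by (intro continuous_on_closed_Collect_le assms) auto
  then have "closure {0..<T} \<subseteq> {t \<in> {0..T}. f t \<le> g t}"
    by (rule closure_minimal[rotated]) (use assms in auto)
  then have "{0..T} \<subseteq> {t \<in> {0..T}. f t \<le> g t}" using assms(1) by (simp add: closure_atLeastLessThan)
  then show ?thesis using assms(1) by (auto dest!: subsetD[of _ _ T])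
qed

text \<open>\<open>VR\<close> stays above \<open>yR\<close> and \<open>VL\<close> below
  \<open>yL\<close>, so at most one of them meets \<open>W\<close> at \<open>T\<close>. One that
  does not meet \<open>W\<close> solves the Loewner equation on the closed interval, as the endpoint
  lemmas require.\<close>

lemma sle_driving_system:
  assumes sle: "sle_driving yL yR B W VL VR T" and y: "yL < yR"
  shows "\<And>t. t \<in> {0..<T} \<Longrightarrow> VL t < W t \<and> W t < VR t \<and>
      W t - VL t = - yL + 2 * B t + integral {0..t} (\<lambda>s. 2 / (VR s - W s)) \<and>
      VR t - W t = yR - 2 * B t + integral {0..t} (\<lambda>s. 2 / (W s - VL s))"
    and "VL T < VR T"
    and "VR T \<noteq> W T \<Longrightarrow> t \<in> {0..T} \<Longrightarrow> W t < VR t \<and> (VR has_vector_derivative 2 / (VR t - W t)) (at t within {0..T})"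
    and "VL T \<noteq> W T \<Longrightarrow> t \<in> {0..T} \<Longrightarrow> VL t < W t \<and> (VL has_vector_derivative 2 / (VL t - W t)) (at t within {0..T})"
    and "VL 0 = yL" "VR 0 = yR" "VL T \<le> W T" "W T \<le> VR T"
proof -
  have T: "0 < T" and c: "continuous_on {0..T} W" "continuous_on {0..T} VL" "continuous_on {0..T} VR"
    and ord: "\<And>t. t \<in> {0..<T} \<Longrightarrow> VL t < W t" "\<And>t. t \<in> {0..<T} \<Longrightarrow> W t < VR t"
    and eqW: "\<And>t. t \<in> {0..<T} \<Longrightarrow> W t = 2 * B t + integral {0..t} (\<lambda>s. 2 / (VL s - W s) + 2 / (VR s - W s))"
    and eqL: "\<And>t. t \<in> {0..<T} \<Longrightarrow> VL t = yL + integral {0..t} (\<lambda>s. 2 / (VL s - W s))"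
    and eqR: "\<And>t. t \<in> {0..<T} \<Longrightarrow> VR t = yR + integral {0..t} (\<lambda>s. 2 / (VR s - W s))"
    using sle by (auto simp: sle_driving_def)
  have sub: "continuous_on {0..t} W" "continuous_on {0..t} VL" "continuous_on {0..t} VR" if "t \<in> {0..<T}" for t
    using that c by (auto intro: continuous_on_subset)
  have iL: "(\<lambda>s. 2 / (VL s - W s)) integrable_on {0..t}" if "t \<in> {0..<T}" for t
    using that ord(1) by (intro integrable_continuous_interval continuous_intros sub) force+
  have iR: "(\<lambda>s. 2 / (VR s - W s)) integrable_on {0..t}" if "t \<in> {0..<T}" for t
    using that ord(2) by (intro integrable_continuous_interval continuous_intros sub) force+
  have neg: "integral {0..t} (\<lambda>s. 2 / (W s - VL s)) = - integral {0..t} (\<lambda>s. 2 / (VL s - W s))" for t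
  proof -
    have "2 / (W s - VL s) = - (2 / (VL s - W s))" for s by (simp only: minus_divide_right minus_diff_eq)
    then show ?thesis by (simp add: integral_neg del: minus_divide_right)
  qed
  have eW: "W t = 2 * B t + (integral {0..t} (\<lambda>s. 2 / (VL s - W s)) + integral {0..t} (\<lambda>s. 2 / (VR s - W s)))"
    if "t \<in> {0..<T}" for t
    using eqW[OF that] integral_add[OF iL[OF that] iR[OF that]] by simp
  show "\<And>t. t \<in> {0..<T} \<Longrightarrow> VL t < W t \<and> W t < VR t \<and>
      W t - VL t = - yL + 2 * B t + integral {0..t} (\<lambda>s. 2 / (VR s - W s)) \<and>
      VR t - W t = yR - 2 * B t + integral {0..t} (\<lambda>s. 2 / (W s - VL s))"
  proof -
    fix t assume t: "t \<in> {0..<T}"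
    show "VL t < W t \<and> W t < VR t \<and>
      W t - VL t = - yL + 2 * B t + integral {0..t} (\<lambda>s. 2 / (VR s - W s)) \<and>
      VR t - W t = yR - 2 * B t + integral {0..t} (\<lambda>s. 2 / (W s - VL s))"
      using ord[OF t] eW[OF t] eqL[OF t] eqR[OF t] neg[of t] by linarith
  qed
  have iR0: "0 \<le> integral {0..t} (\<lambda>s. 2 / (VR s - W s))" if t: "t \<in> {0..<T}" for t
    by (rule Henstock_Kurzweil_Integration.integral_nonneg[OF iR[OF t]]) (use ord(2) t in \<open>force intro: less_imp_le\<close>)
  have iL0: "0 \<le> integral {0..t} (\<lambda>s. 2 / (W s - VL s))" if t: "t \<in> {0..<T}" for t
  proof (rule Henstock_Kurzweil_Integration.integral_nonneg)
    show "(\<lambda>s. 2 / (W s - VL s)) integrable_on {0..t}"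
      using that ord(1) by (intro integrable_continuous_interval continuous_intros sub) force+
  qed (use ord(1) t in \<open>force intro: less_imp_le\<close>)
  have "yR \<le> VR T"
    by (rule continuous_le_at_endpoint[OF T continuous_on_const c(3), of yR]) (use eqR iR0 in auto)
  moreover have "VL T \<le> yL"
    by (rule continuous_le_at_endpoint[OF T c(2) continuous_on_const, of yL]) (use eqL iL0 neg in force)
  ultimately show "VL T < VR T" using y by simp
  show VLT: "VL T \<le> W T" by (rule continuous_le_at_endpoint[OF T c(2,1)]) (use ord in \<open>auto intro: less_imp_le\<close>)
  show VRT: "W T \<le> VR T" by (rule continuous_le_at_endpoint[OF T c(1,3)]) (use ord in \<open>auto intro: less_imp_le\<close>)
  show "VL 0 = yL" "VR 0 = yR" using eqL[of 0] eqR[of 0] T by auto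
  \<comment> \<open>If \<open>V\<close> avoids \<open>W\<close> up to and including
    \<open>T\<close>, the integrand is continuous on {0..T}, so the integral equation extends to
    \<open>T\<close> and may be differentiated there.\<close>
  have ext: "V t \<noteq> W t \<and> (V has_vector_derivative 2 / (V t - W t)) (at t within {0..T})"
    if ne: "\<And>s. s \<in> {0..T} \<Longrightarrow> V s \<noteq> W s" and cV: "continuous_on {0..T} V" and t: "t \<in> {0..T}"
     and eq: "\<And>t. t \<in> {0..<T} \<Longrightarrow> V t = v + integral {0..t} (\<lambda>s. 2 / (V s - W s))" for V v t
  proof -
    have ci: "continuous_on {0..T} (\<lambda>s. 2 / (V s - W s))" by (intro continuous_intros cV c) (use ne in auto)
    define U where "U t = v + integral {0..t} (\<lambda>s. 2 / (V s - W s))" for t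
    have cU: "continuous_on {0..T} U" unfolding U_def
      by (intro continuous_intros indefinite_integral_continuous_1 integrable_continuous_interval ci)
    have "V T = U T"
      by (intro antisym continuous_le_at_endpoint[OF T cV cU] continuous_le_at_endpoint[OF T cU cV])
        (use eq in \<open>auto simp: U_def\<close>)
    then have VU: "V s = U s" if "s \<in> {0..T}" for s using eq[of s] that by (cases "s = T") (auto simp: U_def)
    have "(U has_vector_derivative 0 + 2 / (V t - W t)) (at t within {0..T})"
      unfolding U_def by (intro has_vector_derivative_add has_vector_derivative_const integral_has_vector_derivative[OF ci t])
    then have "(V has_vector_derivative 0 + 2 / (V t - W t)) (at t within {0..T})"
      by (rule has_vector_derivative_transform[OF t, rotated]) (use VU in auto)
    then show ?thesis using ne[OF t] by simp
  qed
  show "W t < VR t \<and> (VR has_vector_derivative 2 / (VR t - W t)) (at t within {0..T})" if "VR T \<noteq> W T" "t \<in> {0..T}"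
  proof -
    have *: "W s < VR s" if "s \<in> {0..T}" for s
      using ord(2)[of s] VRT \<open>VR T \<noteq> W T\<close> that by (cases "s = T") auto
    show ?thesis using ext[OF _ c(3) that(2) eqR] * that(2) by force
  qed
  show "VL t < W t \<and> (VL has_vector_derivative 2 / (VL t - W t)) (at t within {0..T})" if "VL T \<noteq> W T" "t \<in> {0..T}"
  proof -
    have *: "VL s < W s" if "s \<in> {0..T}" for s
      using ord(1)[of s] VLT \<open>VL T \<noteq> W T\<close> that by (cases "s = T") auto
    show ?thesis using ext[OF _ c(2) that(2) eqL] * that(2) by force
  qed
qed

text \<open>An end on the right side has a real image at or beyond \<open>yR\<close>, so the right
  force point was swallowed and \<open>brownian_exit_prob_le\<close> applies; the top side is
  symmetric. Both events are closed conditions on the endpoint, the kind that weak convergence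
  controls.\<close>

lemma sle4_endpoint_prob:
  assumes L: "0 < L" and sle: "sle4_rect N L \<eta>"
  obtains F yL yR where "prob_space N" "yL < 0" "0 < yR" "conformal_onto F (rect L) halfplane"
    "(F \<longlongrightarrow> complex_of_real yL) (at corner_a within rect L)" "(F \<longlongrightarrow> 0) (at corner_b within rect L)"
    "(F \<longlongrightarrow> complex_of_real yR) (at (corner_c L) within rect L)"
    "filterlim F at_infinity (at (corner_d L) within rect L)"
    "(\<lambda>w. \<eta> w 1) \<in> borel_measurable N"
    "measure N {w \<in> space N. L \<le> Re (\<eta> w 1)} \<le> - yL / (yR - yL)"
    "measure N {w \<in> space N. 1 \<le> Im (\<eta> w 1)} \<le> yR / (yR - yL)"
proof -
  obtain yL yR F h \<gamma> T where y: "yL < 0" "0 < yR" and F: "conformal_onto F (rect L) halfplane"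
    and hom: "homeomorphism (closure (rect L) - {corner_d L}) {z. 0 \<le> Im z} F h"
    and Fv: "F corner_a = complex_of_real yL" "F corner_b = 0" "F (corner_c L) = complex_of_real yR"
    and Fd: "filterlim F at_infinity (at (corner_d L) within rect L)"
    and hp: "sle4_halfplane N yL yR \<gamma> T"
    and eta: "AE w in N. \<forall>s\<in>{0..1}. \<eta> w s = h (\<gamma> w (s * T w))"
    using sle by (auto simp: sle4_rect_def)
  obtain B W VL VR where B: "brownian_motion N B"
    and drv: "AE w in N. sle_driving yL yR (\<lambda>t. B t w) (\<lambda>t. W t w) (\<lambda>t. VL t w) (\<lambda>t. VR t w) (T w)
                \<and> generates (\<gamma> w) (\<lambda>t. W t w) (T w)"
    using hp by (auto simp: sle4_halfplane_def)
  interpret prob_space N using B by (simp add: brownian_motion_def)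
  have em[measurable]: "(\<lambda>w. \<eta> w 1) \<in> borel_measurable N"
    using sle by (auto simp: sle4_rect_def random_curve_def)
  define K where "K = closure (rect L) - {corner_d L}"
  have homK: "homeomorphism K {z. 0 \<le> Im z} F h" using hom by (simp add: K_def)
  have cF: "continuous_on K F" using homK by (simp add: homeomorphism_def)
  have KS: "rect L \<subseteq> K"
    unfolding K_def by (rule rect_subset_closure)
  have lim: "(F \<longlongrightarrow> F p) (at p within rect L)" if "p \<in> K" for p
    using cF that KS by (meson continuous_on_def tendsto_within_subset)
  have corners: "corner_a \<in> K" "corner_b \<in> K" "corner_c L \<in> K"
    unfolding K_def closure_rect[OF L] using L by (auto simp: corner_a_def corner_b_def corner_c_def corner_d_def complex_eq_iff)
  \<comment> \<open>As \<open>h\<close> takes values in \<open>K\<close>, the curve never ends at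
    the corner \<open>d\<close>.\<close>
  have pt: "h x \<in> K \<and> F (h x) = x" if "0 \<le> Im x" for x
    using homK that by (auto simp: homeomorphism_def)
  have B0: "AE w in N. B 0 w = 0" using B by (simp add: brownian_motion_def)
  define good where "good w \<longleftrightarrow> sle_driving yL yR (\<lambda>t. B t w) (\<lambda>t. W t w) (\<lambda>t. VL t w) (\<lambda>t. VR t w) (T w)
     \<and> generates (\<gamma> w) (\<lambda>t. W t w) (T w) \<and> \<eta> w 1 = h (\<gamma> w (T w)) \<and> B 0 w = 0" for w
  have good: "AE w in N. good w"
    using drv eta B0 by eventually_elim (auto simp: good_def)
  have gT: "0 < T w" "0 \<le> Im (\<gamma> w (T w))" "\<eta> w 1 \<in> K" "F (\<eta> w 1) = \<gamma> w (T w)" if "good w" for w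
  proof -
    show "0 < T w" using that by (auto simp: good_def sle_driving_def)
    then show "0 \<le> Im (\<gamma> w (T w))" using that by (auto simp: good_def generates_def image_subset_iff)
    then show "\<eta> w 1 \<in> K" "F (\<eta> w 1) = \<gamma> w (T w)" using pt that by (auto simp: good_def)
  qed
  have Kc: "Re z \<le> L" "Im z \<le> 1" "z \<in> closure (rect L)" "z \<noteq> corner_d L" if "z \<in> K" for z
    using that unfolding K_def closure_rect[OF L] by auto
  have yy: "yL < yR" using y by simp
  show thesis
  proof (rule that[OF prob_space_axioms y F _ _ _ Fd em])
    show "(F \<longlongrightarrow> complex_of_real yL) (at corner_a within rect L)" "(F \<longlongrightarrow> 0) (at corner_b within rect L)"
      "(F \<longlongrightarrow> complex_of_real yR) (at (corner_c L) within rect L)"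
      using lim[OF corners(1)] lim[OF corners(2)] lim[OF corners(3)] Fv by simp_all
    have "measure N {w \<in> space N. L \<le> Re (\<eta> w 1)} \<le> - yL / (- yL + yR)"
    proof (rule brownian_exit_prob_le[OF B])
      show "0 < - yL" "0 < yR" using y by auto
      show "{w \<in> space N. L \<le> Re (\<eta> w 1)} \<in> sets N" by measurable
      show "AE w in N. w \<in> {w \<in> space N. L \<le> Re (\<eta> w 1)} \<longrightarrow> (\<exists>T X Y. 0 < T \<and> continuous_on {0..T} X \<and> continuous_on {0..T} Y \<and>
        (\<forall>t\<in>{0..<T}. 0 < X t \<and> 0 < Y t \<and>
         X t = - yL + 2 * (B t w - B 0 w) + integral {0..t} (\<lambda>s. 2 / Y s) \<and>
         Y t = yR - 2 * (B t w - B 0 w) + integral {0..t} (\<lambda>s. 2 / X s)) \<and> 0 < X T \<and> Y T = 0)"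
        using good
      proof eventually_elim
        case (elim w)
        show ?case
        proof
        assume wA: "w \<in> {w \<in> space N. L \<le> Re (\<eta> w 1)}"
        note g = gT[OF elim]
        have sd: "sle_driving yL yR (\<lambda>t. B t w) (\<lambda>t. W t w) (\<lambda>t. VL t w) (\<lambda>t. VR t w) (T w)"
          and gen: "generates (\<gamma> w) (\<lambda>t. W t w) (T w)" using elim by (auto simp: good_def)
        have c: "continuous_on {0..T w} (\<lambda>t. W t w)" "continuous_on {0..T w} (\<lambda>t. VL t w)" "continuous_on {0..T w} (\<lambda>t. VR t w)"
          using sd by (auto simp: sle_driving_def)
        note sys = sle_driving_system[OF sd yy]
        have "Re (\<eta> w 1) = L" using Kc(1)[OF g(3)] wA by simp
        then obtain x where x: "yR \<le> x" "F (\<eta> w 1) = complex_of_real x"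
          using rect_boundary_right[OF L F hom Fv(2,3) y(2) Kc(3,4)[OF g(3)]] by blast
        have "VR (T w) w = W (T w) w"
        proof (rule ccontr)
          assume "VR (T w) w \<noteq> W (T w) w"
          then have "\<gamma> w (T w) \<noteq> complex_of_real x"
            using sys(3) x sys(6) by (intro generates_endpoint_right[OF gen g(1) c(1), of "\<lambda>t. VR t w"]) auto
          then show False using x g by simp
        qed
        show "\<exists>T X Y. 0 < T \<and> continuous_on {0..T} X \<and> continuous_on {0..T} Y \<and>
        (\<forall>t\<in>{0..<T}. 0 < X t \<and> 0 < Y t \<and>
         X t = - yL + 2 * (B t w - B 0 w) + integral {0..t} (\<lambda>s. 2 / Y s) \<and>
         Y t = yR - 2 * (B t w - B 0 w) + integral {0..t} (\<lambda>s. 2 / X s)) \<and> 0 < X T \<and> Y T = 0"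
        proof (rule exI[of _ "T w"], rule exI[of _ "\<lambda>t. W t w - VL t w"], rule exI[of _ "\<lambda>t. VR t w - W t w"], intro conjI ballI)
          have B0w: "B 0 w = 0" using elim by (simp add: good_def)
          fix t assume t: "t \<in> {0..<T w}"
          note st = sys(1)[OF t]
          show "0 < W t w - VL t w" "0 < VR t w - W t w" using st by auto
          show "W t w - VL t w = - yL + 2 * (B t w - B 0 w) + integral {0..t} (\<lambda>s. 2 / (VR s w - W s w))"
            "VR t w - W t w = yR - 2 * (B t w - B 0 w) + integral {0..t} (\<lambda>s. 2 / (W s w - VL s w))"
            using st B0w by auto
        qed (use sys(2) c g(1) \<open>VR (T w) w = W (T w) w\<close> in \<open>auto intro!: continuous_intros\<close>)
        qed
      qed
    qed
    then show "measure N {w \<in> space N. L \<le> Re (\<eta> w 1)} \<le> - yL / (yR - yL)" by (simp add: add.commute)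
    \<comment> \<open>The pair is now (VR - W, W - VL) with noise - B, so that again the second
      coordinate is the one that vanishes.\<close>
    have "measure N {w \<in> space N. 1 \<le> Im (\<eta> w 1)} \<le> yR / (yR + - yL)"
    proof (rule brownian_exit_prob_le[OF brownian_motion_uminus[OF B]])
      show "0 < - yL" "0 < yR" using y by auto
      show "{w \<in> space N. 1 \<le> Im (\<eta> w 1)} \<in> sets N" by measurable
      show "AE w in N. w \<in> {w \<in> space N. 1 \<le> Im (\<eta> w 1)} \<longrightarrow> (\<exists>T X Y. 0 < T \<and> continuous_on {0..T} X \<and> continuous_on {0..T} Y \<and>
        (\<forall>t\<in>{0..<T}. 0 < X t \<and> 0 < Y t \<and>
         X t = yR + 2 * (- B t w - - B 0 w) + integral {0..t} (\<lambda>s. 2 / Y s) \<and>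
         Y t = - yL - 2 * (- B t w - - B 0 w) + integral {0..t} (\<lambda>s. 2 / X s)) \<and> 0 < X T \<and> Y T = 0)"
        using good
      proof eventually_elim
        case (elim w)
        show ?case
        proof
        assume wA: "w \<in> {w \<in> space N. 1 \<le> Im (\<eta> w 1)}"
        note g = gT[OF elim]
        have sd: "sle_driving yL yR (\<lambda>t. B t w) (\<lambda>t. W t w) (\<lambda>t. VL t w) (\<lambda>t. VR t w) (T w)"
          and gen: "generates (\<gamma> w) (\<lambda>t. W t w) (T w)" using elim by (auto simp: good_def)
        have c: "continuous_on {0..T w} (\<lambda>t. W t w)" "continuous_on {0..T w} (\<lambda>t. VL t w)" "continuous_on {0..T w} (\<lambda>t. VR t w)"
          using sd by (auto simp: sle_driving_def)
        note sys = sle_driving_system[OF sd yy]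
        have "Im (\<eta> w 1) = 1" using Kc(2)[OF g(3)] wA by simp
        then obtain x where x: "x \<le> yL" "F (\<eta> w 1) = complex_of_real x"
          using rect_boundary_top[OF L F hom Fv(2,1) y(1) Kc(3,4)[OF g(3)]] by blast
        have "VL (T w) w = W (T w) w"
        proof (rule ccontr)
          assume "VL (T w) w \<noteq> W (T w) w"
          then have "\<gamma> w (T w) \<noteq> complex_of_real x"
            using sys(4) x sys(5) by (intro generates_endpoint_left[OF gen g(1) c(1), of "\<lambda>t. VL t w"]) auto
          then show False using x g by simp
        qed
        show "\<exists>T X Y. 0 < T \<and> continuous_on {0..T} X \<and> continuous_on {0..T} Y \<and>
        (\<forall>t\<in>{0..<T}. 0 < X t \<and> 0 < Y t \<and>
         X t = yR + 2 * (- B t w - - B 0 w) + integral {0..t} (\<lambda>s. 2 / Y s) \<and>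
         Y t = - yL - 2 * (- B t w - - B 0 w) + integral {0..t} (\<lambda>s. 2 / X s)) \<and> 0 < X T \<and> Y T = 0"
        proof (rule exI[of _ "T w"], rule exI[of _ "\<lambda>t. VR t w - W t w"], rule exI[of _ "\<lambda>t. W t w - VL t w"], intro conjI ballI)
          have B0w: "B 0 w = 0" using elim by (simp add: good_def)
          fix t assume t: "t \<in> {0..<T w}"
          note st = sys(1)[OF t]
          show "0 < VR t w - W t w" "0 < W t w - VL t w" using st by auto
          show "VR t w - W t w = yR + 2 * (- B t w - - B 0 w) + integral {0..t} (\<lambda>s. 2 / (W s w - VL s w))"
            "W t w - VL t w = - yL - 2 * (- B t w - - B 0 w) + integral {0..t} (\<lambda>s. 2 / (VR s w - W s w))"
            using st B0w by auto
        qed (use sys(2) c g(1) \<open>VL (T w) w = W (T w) w\<close> in \<open>auto intro!: continuous_intros\<close>)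
        qed
      qed
    qed
    then show "measure N {w \<in> space N. 1 \<le> Im (\<eta> w 1)} \<le> yR / (yR - yL)" by simp
  qed
qed

section \<open>The exploration of a sign pattern\<close>

locale rect_lattice =
  fixes \<delta> L :: real
  assumes delta: "0 < \<delta>" "3 * \<delta> \<le> L" "3 * \<delta> \<le> 1"
begin

text \<open>The rectangle is open, so the largest index is a ceiling minus one rather than a
  floor.\<close>

definition nx :: int where "nx = \<lceil>L / \<delta>\<rceil> - 1"
definition ny :: int where "ny = \<lceil>1 / \<delta>\<rceil> - 1"

definition pt :: "int \<times> int \<Rightarrow> complex" where
  "pt v = Complex (\<delta> * of_int (fst v)) (\<delta> * of_int (snd v))"

definition inbox :: "int \<times> int \<Rightarrow> bool" where
  "inbox v \<longleftrightarrow> 1 \<le> fst v \<and> fst v \<le> nx \<and> 1 \<le> snd v \<and> snd v \<le> ny"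

section \<open>Integer coordinates for the lattice rectangle\<close>

lemma nx_iff: "\<delta> * of_int i < L \<longleftrightarrow> i \<le> nx"
proof -
  have "\<delta> * of_int i < L \<longleftrightarrow> of_int i < L / \<delta>" using delta by (simp add: field_simps)
  also have "\<dots> \<longleftrightarrow> i < \<lceil>L / \<delta>\<rceil>" by (simp add: less_ceiling_iff)
  finally show ?thesis by (auto simp: nx_def)
qed

lemma ny_iff: "\<delta> * of_int i < 1 \<longleftrightarrow> i \<le> ny"
proof -
  have "\<delta> * of_int i < 1 \<longleftrightarrow> of_int i < 1 / \<delta>" using delta by (simp add: field_simps)
  also have "\<dots> \<longleftrightarrow> i < \<lceil>1 / \<delta>\<rceil>" by (simp add: less_ceiling_iff)
  finally show ?thesis by (auto simp: ny_def)
qed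

lemma nx_ge: "2 \<le> nx" and ny_ge: "2 \<le> ny"
  using nx_iff[of 2] ny_iff[of 2] delta by auto

lemma nx_lower: "L - \<delta> \<le> \<delta> * of_int nx" and ny_lower: "1 - \<delta> \<le> \<delta> * of_int ny"
  using nx_iff[of "nx + 1"] ny_iff[of "ny + 1"] by (auto simp: algebra_simps)

lemma pt_eq_iff [simp]: "pt u = pt v \<longleftrightarrow> u = v"
  using delta by (auto simp: pt_def prod_eq_iff)

lemma pt_in_lattice: "pt v \<in> lattice \<delta>" by (auto simp: pt_def lattice_def)

lemma lattice_pt: "z \<in> lattice \<delta> \<Longrightarrow> \<exists>v. z = pt v"
  unfolding lattice_def pt_def by force

lemma pt_in_Vset [simp]: "pt v \<in> Vset \<delta> L \<longleftrightarrow> inbox v"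
proof -
  have "0 < \<delta> * of_int k \<longleftrightarrow> 1 \<le> k" for k :: int using delta by (simp add: zero_less_mult_iff int_one_le_iff_zero_less)
  then show ?thesis
    using pt_in_lattice[of v] by (simp add: Vset_def rect_def pt_def inbox_def nx_iff ny_iff)
qed

lemma Vset_eq: "Vset \<delta> L = pt ` {v. inbox v}"
proof
  show "Vset \<delta> L \<subseteq> pt ` {v. inbox v}"
  proof
    fix z assume z: "z \<in> Vset \<delta> L"
    then have "z \<in> lattice \<delta>" by (simp add: Vset_def)
    from lattice_pt[OF this] obtain v where "z = pt v" by blast
    with z show "z \<in> pt ` {v. inbox v}" by auto
  qed
qed auto

lemma inbox_eq: "{v. inbox v} = {1..nx} \<times> {1..ny}" by (auto simp: inbox_def)

lemma finite_Vset: "finite (Vset \<delta> L)" by (simp add: Vset_eq inbox_eq)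

lemma Re_image: "Re ` Vset \<delta> L = (\<lambda>i. \<delta> * of_int i) ` {1..nx}"
proof -
  have "Re ` Vset \<delta> L = (\<lambda>i. \<delta> * of_int i) ` fst ` ({1..nx} \<times> {1..ny})"
    unfolding Vset_eq inbox_eq image_image by (simp add: pt_def)
  then show ?thesis using ny_ge by (simp only: fst_image_times) simp
qed

lemma Im_image: "Im ` Vset \<delta> L = (\<lambda>i. \<delta> * of_int i) ` {1..ny}"
proof -
  have "Im ` Vset \<delta> L = (\<lambda>i. \<delta> * of_int i) ` snd ` ({1..nx} \<times> {1..ny})"
    unfolding Vset_eq inbox_eq image_image by (simp add: pt_def)
  then show ?thesis using nx_ge by (simp only: snd_image_times) simp
qed

lemma Min_Max_scaled:
  assumes "1 \<le> n"
  shows "Min ((\<lambda>i. \<delta> * of_int i) ` {1..n}) = \<delta> * of_int 1" "Max ((\<lambda>i. \<delta> * of_int i) ` {1..n}) = \<delta> * of_int n"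
proof -
  show "Min ((\<lambda>i. \<delta> * of_int i) ` {1..n}) = \<delta> * of_int 1"
    by (rule Min_eqI) (use assms delta in \<open>auto simp del: of_int_1\<close>)
  show "Max ((\<lambda>i. \<delta> * of_int i) ` {1..n}) = \<delta> * of_int n"
    by (rule Max_eqI) (use assms delta in auto)
qed

lemma corners: "dcorner_a \<delta> L = pt (1, ny)" "dcorner_b \<delta> L = pt (1, 1)" "dcorner_c \<delta> L = pt (nx, 1)" "dcorner_d \<delta> L = pt (nx, ny)"
  using Min_Max_scaled[of nx] Min_Max_scaled[of ny] nx_ge ny_ge
  by (simp_all add: dcorner_a_def dcorner_b_def dcorner_c_def dcorner_d_def Re_image Im_image pt_def)

lemma ccw_next_pt:
  "ccw_next \<delta> L (pt (i, j)) =
    (if j = 1 \<and> i \<noteq> nx then pt (i + 1, j)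
     else if i = nx \<and> j \<noteq> ny then pt (i, j + 1)
     else if j = ny \<and> i \<noteq> 1 then pt (i - 1, j) else pt (i, j - 1))"
proof -
  have 1: "Im (pt (i, j)) = Im (pt (i', j')) \<longleftrightarrow> j = j'" "Re (pt (i, j)) = Re (pt (i', j')) \<longleftrightarrow> i = i'" for i' j'
    using delta by (auto simp: pt_def)
  have 2: "pt (i, j) + of_real \<delta> = pt (i + 1, j)" "pt (i, j) - of_real \<delta> = pt (i - 1, j)"
    "pt (i, j) + \<i> * of_real \<delta> = pt (i, j + 1)" "pt (i, j) - \<i> * of_real \<delta> = pt (i, j - 1)"
    by (auto simp: pt_def complex_eq_iff algebra_simps)
  show ?thesis unfolding ccw_next_def corners 1 2 pt_eq_iff prod.inject
    by (cases "j = 1"; cases "i = nx"; cases "j = ny"; cases "i = 1"; simp)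
qed

lemma ccw_arc_eq:
  assumes "(ccw_next \<delta> L ^^ n) u = v" "\<And>k. k < n \<Longrightarrow> (ccw_next \<delta> L ^^ k) u \<noteq> v"
  shows "ccw_arc \<delta> L u v = {(ccw_next \<delta> L ^^ k) u | k. k < n}"
proof -
  have "(\<forall>j\<le>k. (ccw_next \<delta> L ^^ j) u \<noteq> v) \<longleftrightarrow> k < n" for k
  proof
    assume "\<forall>j\<le>k. (ccw_next \<delta> L ^^ j) u \<noteq> v"
    then show "k < n" using assms(1) by (metis not_less)
  qed (use assms(2) in auto)
  then show ?thesis by (simp add: ccw_arc_def)
qed

text \<open>The successor map descends the left column from \<open>a\<close> and reaches
  \<open>b\<close> after \<open>ny - 1\<close> steps. The arc omits \<open>b\<close>, so its rows
  start at 2.\<close>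

lemma arc_ab_eq: "arc_ab \<delta> L = {pt (1, j) | j. 2 \<le> j \<and> j \<le> ny}"
proof -
  have it: "(ccw_next \<delta> L ^^ k) (pt (1, ny)) = pt (1, ny - int k)" if "int k \<le> ny - 1" for k
    using that nx_ge by (induction k) (auto simp: ccw_next_pt)
  have "ccw_arc \<delta> L (pt (1, ny)) (pt (1, 1)) = {(ccw_next \<delta> L ^^ k) (pt (1, ny)) | k. k < nat (ny - 1)}"
    by (rule ccw_arc_eq) (use ny_ge it in auto)
  also have "\<dots> = {pt (1, ny - int k) | k. k < nat (ny - 1)}" using it by (intro Collect_cong ex_cong1) auto
  also have "\<dots> = {pt (1, j) | j. 2 \<le> j \<and> j \<le> ny}"
  proof safe
    fix j assume "2 \<le> j" "j \<le> ny"
    then show "\<exists>k. pt (1, j) = pt (1, ny - int k) \<and> k < nat (ny - 1)" by (intro exI[of _ "nat (ny - j)"]) auto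
  qed force
  finally show ?thesis by (simp add: arc_ab_def corners)
qed

lemma arc_cd_eq: "arc_cd \<delta> L = {pt (nx, j) | j. 1 \<le> j \<and> j \<le> ny - 1}"
proof -
  have it: "(ccw_next \<delta> L ^^ k) (pt (nx, 1)) = pt (nx, 1 + int k)" if "int k \<le> ny - 1" for k
    using that nx_ge by (induction k) (auto simp: ccw_next_pt)
  have "ccw_arc \<delta> L (pt (nx, 1)) (pt (nx, ny)) = {(ccw_next \<delta> L ^^ k) (pt (nx, 1)) | k. k < nat (ny - 1)}"
    by (rule ccw_arc_eq) (use ny_ge it in auto)
  also have "\<dots> = {pt (nx, 1 + int k) | k. k < nat (ny - 1)}" using it by (intro Collect_cong ex_cong1) auto
  also have "\<dots> = {pt (nx, j) | j. 1 \<le> j \<and> j \<le> ny - 1}"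
  proof safe
    fix j assume "1 \<le> j" "j \<le> ny - 1"
    then show "\<exists>k. pt (nx, j) = pt (nx, 1 + int k) \<and> k < nat (ny - 1)" by (intro exI[of _ "nat (j - 1)"]) auto
  qed force
  finally show ?thesis by (simp add: arc_cd_def corners)
qed

lemma arc_da_eq: "arc_da \<delta> L = {pt (i, ny) | i. 2 \<le> i \<and> i \<le> nx}"
proof -
  have it: "(ccw_next \<delta> L ^^ k) (pt (nx, ny)) = pt (nx - int k, ny)" if "int k \<le> nx - 1" for k
    using that ny_ge by (induction k) (auto simp: ccw_next_pt)
  have "ccw_arc \<delta> L (pt (nx, ny)) (pt (1, ny)) = {(ccw_next \<delta> L ^^ k) (pt (nx, ny)) | k. k < nat (nx - 1)}"
    by (rule ccw_arc_eq) (use nx_ge it in auto)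
  also have "\<dots> = {pt (nx - int k, ny) | k. k < nat (nx - 1)}" using it by (intro Collect_cong ex_cong1) auto
  also have "\<dots> = {pt (i, ny) | i. 2 \<le> i \<and> i \<le> nx}"
  proof safe
    fix j assume "2 \<le> j" "j \<le> nx"
    then show "\<exists>k. pt (j, ny) = pt (nx - int k, ny) \<and> k < nat (nx - 1)" by (intro exI[of _ "nat (nx - j)"]) auto
  qed force
  finally show ?thesis by (simp add: arc_da_def corners)
qed

text \<open>Over the integers a^2 + b^2 = 1 amounts to |a| + |b| = 1, because |x| \<le> x^2.\<close>

lemma adjacent_pt: "adjacent \<delta> (pt u) (pt v) \<longleftrightarrow> \<bar>fst u - fst v\<bar> + \<bar>snd u - snd v\<bar> = 1"
proof -
  define a b where "a = fst u - fst v" and "b = snd u - snd v"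
  have "cmod (pt u - pt v) = \<delta> \<longleftrightarrow> (cmod (pt u - pt v))\<^sup>2 = \<delta>\<^sup>2"
    using delta by (simp add: power2_eq_iff_nonneg)
  also have "(cmod (pt u - pt v))\<^sup>2 = \<delta>\<^sup>2 * of_int (a\<^sup>2 + b\<^sup>2)"
    unfolding cmod_power2 by (simp add: pt_def a_def b_def power2_eq_square algebra_simps)
  also have "\<dots> = \<delta>\<^sup>2 \<longleftrightarrow> (of_int (a\<^sup>2 + b\<^sup>2) :: real) = of_int 1" using delta by simp
  also have "\<dots> \<longleftrightarrow> a\<^sup>2 + b\<^sup>2 = 1" by (simp only: of_int_eq_iff)
  also have "\<dots> \<longleftrightarrow> \<bar>a\<bar> + \<bar>b\<bar> = 1"
  proof
    assume e: "a\<^sup>2 + b\<^sup>2 = 1"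
    have sq: "\<bar>x\<bar> \<le> x\<^sup>2" for x :: int
    proof (cases "x = 0")
      case False
      then have "\<bar>x\<bar> * 1 \<le> \<bar>x\<bar> * \<bar>x\<bar>" by (intro mult_left_mono) auto
      then show ?thesis by (simp add: power2_eq_square)
    qed simp
    have "\<bar>a\<bar> + \<bar>b\<bar> \<le> 1" using sq[of a] sq[of b] e by linarith
    moreover have "a \<noteq> 0 \<or> b \<noteq> 0" using e by auto
    ultimately show "\<bar>a\<bar> + \<bar>b\<bar> = 1" by linarith
  next
    assume "\<bar>a\<bar> + \<bar>b\<bar> = 1"
    then have "(a = 0 \<and> (b = 1 \<or> b = -1)) \<or> (b = 0 \<and> (a = 1 \<or> a = -1))" by linarith
    then show "a\<^sup>2 + b\<^sup>2 = 1" by auto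
  qed
  finally show ?thesis using pt_in_lattice by (simp add: adjacent_def a_def b_def)
qed

lemma bdry_pt:
  assumes "inbox v" "fst v = 1 \<or> fst v = nx \<or> snd v = 1 \<or> snd v = ny"
  shows "pt v \<in> bdry \<delta> L"
proof -
  obtain i j where v: "v = (i, j)" by fastforce
  obtain u where "\<not> inbox u" "\<bar>fst u - fst v\<bar> + \<bar>snd u - snd v\<bar> = 1"
  proof -
    consider "i = 1" | "i = nx" | "j = 1" | "j = ny" using assms v by auto
    then show thesis
    proof cases
      case 1 then show ?thesis using that[of "(0, j)"] v by (auto simp: inbox_def)
    next
      case 2 then show ?thesis using that[of "(nx + 1, j)"] v by (auto simp: inbox_def)
    next
      case 3 then show ?thesis using that[of "(i, 0)"] v by (auto simp: inbox_def)
    next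
      case 4 then show ?thesis using that[of "(i, ny + 1)"] v by (auto simp: inbox_def)
    qed
  qed
  then have "pt u \<in> lattice \<delta> - Vset \<delta> L" "adjacent \<delta> (pt u) (pt v)"
    using pt_in_lattice[of u] by (simp_all add: adjacent_pt)
  then show ?thesis using assms(1) unfolding bdry_def by auto
qed

text \<open>An exploration state is a pair \<open>((x, y), (ex, ey))\<close> standing for the dual vertex
  \<open>(x + 1/2, y + 1/2) \<delta>\<close> and the direction of arrival; the four functions give the vertices in
  front of and behind it, to its left and right.\<close>

definition front_left :: "(int \<times> int) \<times> (int \<times> int) \<Rightarrow> int \<times> int" where
  "front_left = (\<lambda>((x, y), (ex, ey)). (x + (1 + ex - ey) div 2, y + (1 + ey + ex) div 2))"
definition front_right :: "(int \<times> int) \<times> (int \<times> int) \<Rightarrow> int \<times> int" where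
  "front_right = (\<lambda>((x, y), (ex, ey)). (x + (1 + ex + ey) div 2, y + (1 + ey - ex) div 2))"
definition back_left :: "(int \<times> int) \<times> (int \<times> int) \<Rightarrow> int \<times> int" where
  "back_left = (\<lambda>((x, y), (ex, ey)). (x + (1 - ex - ey) div 2, y + (1 - ey + ex) div 2))"
definition back_right :: "(int \<times> int) \<times> (int \<times> int) \<Rightarrow> int \<times> int" where
  "back_right = (\<lambda>((x, y), (ex, ey)). (x + (1 - ex + ey) div 2, y + (1 - ey - ex) div 2))"

definition directions :: "(int \<times> int) set" where
  "directions = {(1, 0), (0, 1), (-1, 0), (0, -1)}"

definition turn :: "(int \<times> int \<Rightarrow> bool) \<Rightarrow> (int \<times> int) \<times> (int \<times> int) \<Rightarrow> int \<times> int" where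
  "turn N s = (case s of ((x, y), (ex, ey)) \<Rightarrow>
     if N (front_left s) then (- ey, ex) else if N (front_right s) then (ex, ey) else (ey, - ex))"

definition explore :: "(int \<times> int \<Rightarrow> bool) \<Rightarrow> (int \<times> int) \<times> (int \<times> int) \<Rightarrow> (int \<times> int) \<times> (int \<times> int)" where
  "explore N s = (case turn N s of (ex, ey) \<Rightarrow> ((fst (fst s) + ex, snd (fst s) + ey), (ex, ey)))"

text \<open>Its dual vertex is \<open>(\<delta>/2, 3\<delta>/2)\<close>, still to the left of the
  box; interior states begin one step later.\<close>

definition start :: "(int \<times> int) \<times> (int \<times> int)" where
  "start = ((0, 1), (1, 0))"

definition dual :: "int \<times> int \<Rightarrow> complex" where
  "dual p = Complex (\<delta> * (of_int (fst p) + 1/2)) (\<delta> * (of_int (snd p) + 1/2))"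

definition dir :: "int \<times> int \<Rightarrow> complex" where
  "dir e = Complex (of_int (fst e)) (of_int (snd e))"

text \<open>The arcs \<open>[c, d)\<close> and \<open>[d, a)\<close> in integer coordinates:
  \<open>c\<close> and \<open>d\<close> belong to them, \<open>a\<close> does not.\<close>

definition exit_arc :: "int \<times> int \<Rightarrow> bool" where
  "exit_arc v \<longleftrightarrow> (fst v = nx \<and> 1 \<le> snd v \<and> snd v \<le> ny - 1) \<or> (snd v = ny \<and> 2 \<le> fst v \<and> fst v \<le> nx)"

definition hits :: "(int \<times> int) \<times> (int \<times> int) \<Rightarrow> bool" where
  "hits s \<longleftrightarrow> exit_arc (back_left s) \<or> exit_arc (back_right s)"

text \<open>A unit direction has exactly one nonzero component, so the numerators 1 + ex - ey and
  the like are even and the integer divisions exact.\<close>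

lemma pt_flanks:
  assumes "e \<in> directions"
  shows "pt (front_left (p, e)) = dual p + of_real \<delta> * (dir e + \<i> * dir e) / 2"
    "pt (front_right (p, e)) = dual p + of_real \<delta> * (dir e - \<i> * dir e) / 2"
    "pt (back_left (p, e)) = dual p - of_real \<delta> * (dir e - \<i> * dir e) / 2"
    "pt (back_right (p, e)) = dual p - of_real \<delta> * (dir e + \<i> * dir e) / 2"
  using assms
  by (cases p; auto simp: directions_def front_left_def front_right_def back_left_def back_right_def
    pt_def dual_def dir_def complex_eq_iff algebra_simps)+

lemma turn_directions: "snd s \<in> directions \<Longrightarrow> turn N s \<in> directions"
  by (cases s) (auto simp: directions_def turn_def)

lemma explore_directions: "snd s \<in> directions \<Longrightarrow> snd (explore N s) \<in> directions"
  using turn_directions[of s N] by (simp add: explore_def case_prod_beta)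

lemma iterate_directions: "snd ((explore N ^^ n) start) \<in> directions"
proof (induction n)
  case 0
  show ?case by (simp add: start_def directions_def)
next
  case (Suc n)
  then show ?case by (simp add: explore_directions)
qed

lemma ll_state_eq:
  assumes N: "\<And>v. N v \<longleftrightarrow> negv \<delta> L \<phi> (pt v)"
  shows "ll_state \<delta> L \<phi> n = (dual (fst ((explore N ^^ n) start)), dir (snd ((explore N ^^ n) start)))"
proof (induction n)
  case 0
  show ?case by (simp add: start_def dual_def dir_def complex_eq_iff)
next
  case (Suc n)
  obtain x y ex ey where s: "(explore N ^^ n) start = ((x, y), (ex, ey))" by (metis surj_pair)
  have e: "(ex, ey) \<in> directions" using iterate_directions[where N = N and n = n] by (simp add: s)
  have t: "dir (turn N ((x, y), (ex, ey))) = ll_dir \<delta> L \<phi> (dual (x, y)) (dir (ex, ey))"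
    unfolding ll_dir_def turn_def N pt_flanks[OF e]
    by (auto simp: dir_def complex_eq_iff)
  have d: "dual (x, y) + of_real \<delta> * dir e' = dual (x + fst e', y + snd e')" for e'
    by (simp add: dual_def dir_def complex_eq_iff algebra_simps)
  have "(explore N ^^ Suc n) start = explore N ((x, y), (ex, ey))" by (simp add: s)
  also have "\<dots> = ((x + fst (turn N ((x, y), (ex, ey))), y + snd (turn N ((x, y), (ex, ey)))), turn N ((x, y), (ex, ey)))"
    by (simp add: explore_def case_prod_beta)
  finally show ?case
    using Suc d[of "turn N ((x, y), (ex, ey))"] by (simp add: s Let_def t[symmetric])
qed

lemma exit_arc_iff: "pt v \<in> arc_cd \<delta> L \<union> arc_da \<delta> L \<longleftrightarrow> exit_arc v"
  by (cases v) (auto simp: arc_cd_eq arc_da_eq exit_arc_def)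

lemma ll_hits_eq:
  assumes N: "\<And>v. N v \<longleftrightarrow> negv \<delta> L \<phi> (pt v)"
  shows "ll_hits \<delta> L (ll_state \<delta> L \<phi> n) \<longleftrightarrow> hits ((explore N ^^ n) start)"
proof -
  obtain p e where s: "(explore N ^^ n) start = (p, e)" by (metis surj_pair)
  have e: "e \<in> directions" using iterate_directions[where N = N and n = n] by (simp add: s)
  show ?thesis unfolding ll_state_eq[OF N] s ll_hits_def hits_def
    by (simp only: fst_conv snd_conv case_prod_conv exit_arc_iff pt_flanks[OF e, symmetric])
qed

end

text \<open>\<open>N\<close> marks the negative vertices of a field with alternating boundary values.\<close>

locale sign_pattern = rect_lattice +
  fixes N :: "int \<times> int \<Rightarrow> bool"
  assumes N_inbox: "N v \<Longrightarrow> inbox v"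
    and N_left: "2 \<le> j \<Longrightarrow> j \<le> ny \<Longrightarrow> \<not> N (1, j)"
    and N_right: "1 \<le> j \<Longrightarrow> j \<le> ny - 1 \<Longrightarrow> \<not> N (nx, j)"
    and N_bottom: "1 \<le> i \<Longrightarrow> i \<le> nx - 1 \<Longrightarrow> N (i, 1)"
    and N_top: "2 \<le> i \<Longrightarrow> i \<le> nx \<Longrightarrow> N (i, ny)"
begin

definition state :: "nat \<Rightarrow> (int \<times> int) \<times> (int \<times> int)" where
  "state n = (explore N ^^ n) start"

text \<open>Vertices outside the box also satisfy \<open>\<not> N\<close>, hence the explicit
  condition on the left one; on the right \<open>N\<close> implies it.\<close>

definition flanked :: "(int \<times> int) \<times> (int \<times> int) \<Rightarrow> bool" where
  "flanked s \<longleftrightarrow> snd s \<in> directions \<and> inbox (back_left s) \<and> \<not> N (back_left s) \<and> N (back_right s)"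

text \<open>The bounds put all four vertices around the dual vertex inside the box.\<close>

definition interior_state :: "(int \<times> int) \<times> (int \<times> int) \<Rightarrow> bool" where
  "interior_state s \<longleftrightarrow> flanked s \<and> 1 \<le> fst (fst s) \<and> fst (fst s) \<le> nx - 1 \<and> 1 \<le> snd (fst s) \<and> snd (fst s) \<le> ny - 1"

text \<open>The turning rule keeps signs correct on both sides, and the boundary signs leave only
  the exit arcs. A step leaving eastwards has an exit vertex on its left, a step leaving northwards
  one on its right. Leaving westwards would require a negative vertex in the nonnegative left
  column, and leaving southwards a nonnegative vertex in the negative part of the bottom row or the
  exit vertex \<open>c\<close>.\<close>

lemma explore_flanked:
  assumes "interior_state s"
  shows "flanked (explore N s)"
    and "inbox (front_left s)" "inbox (front_right s)"
    and "\<not> hits (explore N s) \<Longrightarrow> interior_state (explore N s)"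
proof -
  obtain x y ex ey where s: "s = ((x, y), (ex, ey))" by (metis surj_pair)
  have xy: "1 \<le> x" "x \<le> nx - 1" "1 \<le> y" "y \<le> ny - 1" using assms by (auto simp: interior_state_def s)
  have e: "(ex, ey) \<in> directions" using assms by (auto simp: interior_state_def flanked_def s)
  have fl: "\<not> N (back_left s)" "N (back_right s)" using assms by (auto simp: interior_state_def flanked_def)
  show F: "flanked (explore N s)"
    using e xy fl
    by (auto simp: s flanked_def explore_def turn_def directions_def inbox_def
      front_left_def front_right_def back_left_def back_right_def)
  show "inbox (front_left s)" "inbox (front_right s)"
    using e xy by (auto simp: s directions_def inbox_def front_left_def front_right_def)
  assume h: "\<not> hits (explore N s)"
  obtain x' y' ex' ey' where s': "explore N s = ((x', y'), (ex', ey'))" by (metis surj_pair)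
  have xy': "x' = x + ex'" "y' = y + ey'" using s' by (auto simp: explore_def s split: prod.splits)
  have e': "(ex', ey') \<in> directions" and fl': "\<not> N (back_left (explore N s))" "N (back_right (explore N s))"
    using F s' by (auto simp: flanked_def)
  have h': "\<not> exit_arc (back_left (explore N s))" "\<not> exit_arc (back_right (explore N s))"
    using h by (auto simp: hits_def)
  consider (east) "ex' = 1" "ey' = 0" | (north) "ex' = 0" "ey' = 1" | (west) "ex' = -1" "ey' = 0" | (south) "ex' = 0" "ey' = -1"
    using e' by (auto simp: directions_def)
  then have "1 \<le> x' \<and> x' \<le> nx - 1 \<and> 1 \<le> y' \<and> y' \<le> ny - 1"
  proof cases
    case east
    then have b: "back_left (explore N s) = (x + 1, y + 1)" "back_right (explore N s) = (x + 1, y)"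
      by (simp_all add: s' xy' back_left_def back_right_def)
    have "x + 1 \<noteq> nx"
    proof
      assume "x + 1 = nx"
      moreover from this have "y + 1 = ny" using h'(1) xy unfolding b by (simp add: exit_arc_def)
      ultimately show False using N_top[of nx] fl'(1) nx_ge unfolding b by simp
    qed
    then show ?thesis using east xy xy' by linarith
  next
    case north
    then have b: "back_right (explore N s) = (x + 1, y + 1)"
      by (simp add: s' xy' back_right_def)
    have "y + 1 \<noteq> ny" using h'(2) xy unfolding b by (auto simp: exit_arc_def)
    then show ?thesis using north xy xy' by linarith
  next
    case west
    then have b: "back_right (explore N s) = (x, y + 1)"
      by (simp add: s' xy' back_right_def)
    have "x \<noteq> 1" using N_left[of "y + 1"] fl'(2) xy unfolding b by auto
    then show ?thesis using west xy xy' by linarith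
  next
    case south
    then have b: "back_left (explore N s) = (x + 1, y)"
      by (simp add: s' xy' back_left_def)
    have "y \<noteq> 1"
    proof
      assume y: "y = 1"
      then have "x + 1 \<noteq> nx" using h'(1) ny_ge unfolding b by (auto simp: exit_arc_def)
      then show False using N_bottom[of "x + 1"] fl'(1) xy y unfolding b by simp
    qed
    then show ?thesis using south xy xy' by linarith
  qed
  then show "interior_state (explore N s)" using F s' by (simp add: interior_state_def)
qed

text \<open>Ahead of \<open>start\<close> are the nonnegative (1, 2) on the left and the negative
  (1, 1) on the right, so the line goes straight in.\<close>

lemma state_1: "state 1 = ((1, 1), (1, 0))" "interior_state (state 1)" "\<not> hits (state 1)" "\<not> hits (state 0)"
proof -
  show 1: "state 1 = ((1, 1), (1, 0))"
    using N_left[of 2] N_bottom[of 1] nx_ge ny_ge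
    by (simp add: state_def start_def explore_def turn_def front_left_def front_right_def)
  show "interior_state (state 1)" "\<not> hits (state 1)"
    unfolding 1 using N_left[of 2] N_bottom[of 1] nx_ge ny_ge
    by (simp_all add: interior_state_def flanked_def directions_def hits_def exit_arc_def back_left_def back_right_def inbox_def)
  have "state 0 = start" by (simp add: state_def)
  then show "\<not> hits (state 0)"
    using nx_ge by (simp add: start_def hits_def exit_arc_def back_left_def back_right_def)
qed

lemma state_Suc: "state (Suc n) = explore N (state n)" by (simp add: state_def)

lemma state_interior:
  assumes "\<And>k. k \<le> n \<Longrightarrow> \<not> hits (state k)"
  shows "interior_state (state (Suc n)) \<or> (flanked (state (Suc n)) \<and> hits (state (Suc n)))"
  using assms
proof (induction n)
  case 0
  show ?case using state_1(2) by simp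
next
  case (Suc n)
  then have i: "interior_state (state (Suc n))" by auto
  show ?case using explore_flanked(1,4)[OF i] state_Suc[of "Suc n"] by auto
qed

text \<open>The exploration is reversible: the signs around a dual vertex admit a single incoming
  edge, except at a saddle, where both incoming edges turn left and leave along different
  edges.\<close>

lemma explore_inj:
  assumes "interior_state s" "interior_state t" "explore N s = explore N t"
  shows "s = t"
proof -
  obtain x y ex ey where s: "s = ((x, y), (ex, ey))" by (metis surj_pair)
  obtain x' y' ex' ey' where t: "t = ((x', y'), (ex', ey'))" by (metis surj_pair)
  have tu: "turn N s = turn N t" using assms(3) by (auto simp: explore_def split: prod.splits)
  have xy: "x' = x" "y' = y" using assms(3) tu by (auto simp: explore_def s t split: prod.splits)
  have e: "(ex, ey) \<in> directions" "(ex', ey') \<in> directions"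
    "\<not> N (back_left s)" "N (back_right s)" "\<not> N (back_left t)" "N (back_right t)"
    using assms by (auto simp: interior_state_def flanked_def s t)
  have "(ex, ey) = (ex', ey')"
    using e tu unfolding s t xy directions_def
    by (elim insertE emptyE;
      simp add: turn_def front_left_def front_right_def back_left_def back_right_def split: if_splits)
  then show ?thesis by (simp add: s t xy)
qed

text \<open>Without a hit, an injective step on finitely many interior states would be periodic and
  return to state 1, but the only predecessor position of state 1 lies outside the interior.\<close>

lemma exploration_hits: "\<exists>n. hits (state n)"
proof (rule ccontr)
  assume "\<not> ?thesis"
  then have h: "\<not> hits (state n)" for n by blast
  then have i: "interior_state (state (Suc n))" for n using state_interior[of n] by auto
  have "finite {s. interior_state s}"
  proof (rule finite_subset)
    show "{s. interior_state s} \<subseteq> ({1..nx} \<times> {1..ny}) \<times> directions"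
      by (auto simp: interior_state_def flanked_def)
    show "finite (({1..nx} \<times> {1..ny}) \<times> directions)" by (simp add: directions_def)
  qed
  moreover have "range (\<lambda>n. state (Suc n)) \<subseteq> {s. interior_state s}" using i by auto
  ultimately have "finite (range (\<lambda>n. state (Suc n)))" by (rule finite_subset[rotated])
  then have "\<not> inj (\<lambda>n. state (Suc n))" using finite_imageD infinite_UNIV_nat by blast
  then obtain a b where ab: "a < b" "state (Suc a) = state (Suc b)"
    unfolding inj_def by (metis linorder_neqE_nat)
  \<comment> \<open>Injectivity cancels common steps and moves the repetition back to state
    1.\<close>
  have "state 1 = state (Suc (b - a))"
    using ab
  proof (induction a arbitrary: b)
    case (Suc a)
    then obtain b' where b: "b = Suc b'" "a < b'" by (cases b) auto
    have "explore N (state (Suc a)) = explore N (state (Suc b'))"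
      using Suc.prems(2) state_Suc[of "Suc a"] state_Suc[of "Suc b'"] b by simp
    then have "state (Suc a) = state (Suc b')" using explore_inj i by blast
    from Suc.IH[OF b(2) this] show ?case by (simp add: b)
  qed simp
  moreover obtain m where m: "b - a = Suc m" using ab(1) by (cases "b - a") auto
  \<comment> \<open>State 1 is entered eastwards at x = 1, so its predecessor would have x =
    0.\<close>
  ultimately have eq: "explore N (state (Suc m)) = ((1, 1), (1, 0))" using state_1(1) state_Suc[of "Suc m"] by simp
  then have "fst (fst (state (Suc m))) = 0" by (auto simp: explore_def split: prod.splits)
  then show False using i[of m] by (simp add: interior_state_def)
qed

definition hit_index :: nat where "hit_index = (LEAST n. hits (state n))"

lemma hit_index: "hits (state hit_index)" "n < hit_index \<Longrightarrow> \<not> hits (state n)"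
  using exploration_hits unfolding hit_index_def by (auto intro: LeastI dest: not_less_Least)

lemma hit_index_ge: "2 \<le> hit_index"
proof -
  have "hit_index \<noteq> 0" "hit_index \<noteq> 1" using hit_index(1) state_1 by metis+
  then show ?thesis by linarith
qed

lemma state_before_hit:
  assumes "1 \<le> n" "n \<le> hit_index"
  shows "flanked (state n)" and "n < hit_index \<Longrightarrow> interior_state (state n)"
proof -
  obtain m where n: "n = Suc m" using assms(1) by (cases n) auto
  have "\<And>k. k \<le> m \<Longrightarrow> \<not> hits (state k)" using hit_index(2) n assms(2) by auto
  from state_interior[OF this] show "flanked (state n)" "n < hit_index \<Longrightarrow> interior_state (state n)"
    using hit_index(2)[of n] n by (auto simp: interior_state_def)
qed

definition pos_adj :: "int \<times> int \<Rightarrow> int \<times> int \<Rightarrow> bool" where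
  "pos_adj u v \<longleftrightarrow> inbox u \<and> inbox v \<and> \<not> N u \<and> \<not> N v \<and> \<bar>fst u - fst v\<bar> + \<bar>snd u - snd v\<bar> = 1"

text \<open>King moves, the matching adjacency of nearest neighbours: a negative chain with
  diagonals is what blocks a nearest-neighbour nonnegative chain.\<close>

definition neg_adj :: "int \<times> int \<Rightarrow> int \<times> int \<Rightarrow> bool" where
  "neg_adj u v \<longleftrightarrow> N u \<and> N v \<and> \<bar>fst u - fst v\<bar> \<le> 1 \<and> \<bar>snd u - snd v\<bar> \<le> 1"

text \<open>On a left turn the left vertex stays and the right one moves diagonally; straight ahead
  both advance; on a right turn the left one passes through both front vertices. Priority to left
  turns is what keeps the nonnegative side free of diagonal moves.\<close>

lemma explore_adj:
  assumes "interior_state s"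
  shows "pos_adj\<^sup>*\<^sup>* (back_left s) (back_left (explore N s))"
    and "neg_adj\<^sup>*\<^sup>* (back_right s) (back_right (explore N s))"
proof -
  obtain x y ex ey where s: "s = ((x, y), (ex, ey))" by (metis surj_pair)
  have e: "(ex, ey) \<in> directions" "inbox (back_left s)" "\<not> N (back_left s)" "N (back_right s)"
    using assms by (auto simp: interior_state_def flanked_def s)
  have fin: "inbox (front_left s)" "inbox (front_right s)" using explore_flanked(2,3)[OF assms] by auto
  have d: "\<bar>fst (back_left s) - fst (front_left s)\<bar> + \<bar>snd (back_left s) - snd (front_left s)\<bar> = 1"
    "\<bar>fst (front_left s) - fst (front_right s)\<bar> + \<bar>snd (front_left s) - snd (front_right s)\<bar> = 1"
    "\<bar>fst (back_right s) - fst (front_left s)\<bar> \<le> 1" "\<bar>snd (back_right s) - snd (front_left s)\<bar> \<le> 1"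
    "\<bar>fst (back_right s) - fst (front_right s)\<bar> \<le> 1" "\<bar>snd (back_right s) - snd (front_right s)\<bar> \<le> 1"
    using e(1) by (auto simp: s directions_def front_left_def front_right_def back_left_def back_right_def)
  consider (left) "N (front_left s)" | (straight) "\<not> N (front_left s)" "N (front_right s)"
    | (right) "\<not> N (front_left s)" "\<not> N (front_right s)" by blast
  then show "pos_adj\<^sup>*\<^sup>* (back_left s) (back_left (explore N s))"
    and "neg_adj\<^sup>*\<^sup>* (back_right s) (back_right (explore N s))"
  proof (atomize (full), cases)
    case left
    then have "back_left (explore N s) = back_left s" "back_right (explore N s) = front_left s"
      using e(1) by (auto simp: s explore_def turn_def directions_def front_left_def back_left_def back_right_def)
    then show "pos_adj\<^sup>*\<^sup>* (back_left s) (back_left (explore N s)) \<and> neg_adj\<^sup>*\<^sup>* (back_right s) (back_right (explore N s))"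
      using e d left by (auto simp: neg_adj_def)
  next
    case straight
    then have "back_left (explore N s) = front_left s" "back_right (explore N s) = front_right s"
      using e(1) by (auto simp: s explore_def turn_def directions_def front_left_def front_right_def back_left_def back_right_def)
    then show "pos_adj\<^sup>*\<^sup>* (back_left s) (back_left (explore N s)) \<and> neg_adj\<^sup>*\<^sup>* (back_right s) (back_right (explore N s))"
      using e d straight fin by (auto simp: neg_adj_def pos_adj_def)
  next
    case right
    then have "back_left (explore N s) = front_right s" "back_right (explore N s) = back_right s"
      using e(1) by (auto simp: s explore_def turn_def directions_def front_left_def front_right_def back_left_def back_right_def)
    moreover have "pos_adj (back_left s) (front_left s)" "pos_adj (front_left s) (front_right s)"
      using e d right fin by (auto simp: pos_adj_def)
    ultimately show "pos_adj\<^sup>*\<^sup>* (back_left s) (back_left (explore N s)) \<and> neg_adj\<^sup>*\<^sup>* (back_right s) (back_right (explore N s))"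
      by (metis r_into_rtranclp rtranclp.rtrancl_into_rtrancl rtranclp.rtrancl_refl)
  qed
qed

lemma state_chains:
  assumes "1 \<le> n" "n \<le> hit_index"
  shows "pos_adj\<^sup>*\<^sup>* (1, 2) (back_left (state n)) \<and> neg_adj\<^sup>*\<^sup>* (1, 1) (back_right (state n))"
  using assms
proof (induction n rule: dec_induct)
  case base
  have "back_left (state 1) = (1, 2)" "back_right (state 1) = (1, 1)"
    unfolding state_1(1) by (simp_all add: back_left_def back_right_def)
  then show ?case by simp
next
  case (step n)
  then have "interior_state (state n)" using state_before_hit(2) by auto
  from explore_adj[OF this] step show ?case unfolding state_Suc by (auto intro: rtranclp_trans)
qed

text \<open>The left vertex is not negative, so it cannot lie on the exit part of the top row; the
  right vertex is negative, so it cannot lie on the exit part of the right column.\<close>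

lemma hit_cases:
  "(\<exists>j. 1 \<le> j \<and> j \<le> ny - 1 \<and> back_left (state hit_index) = (nx, j) \<and> pos_adj\<^sup>*\<^sup>* (1, 2) (nx, j)) \<or>
   (\<exists>i. 2 \<le> i \<and> i \<le> nx \<and> back_right (state hit_index) = (i, ny) \<and> neg_adj\<^sup>*\<^sup>* (1, 1) (i, ny))"
proof -
  have f: "flanked (state hit_index)" using state_before_hit(1)[of hit_index] hit_index_ge by simp
  have c: "pos_adj\<^sup>*\<^sup>* (1, 2) (back_left (state hit_index))" "neg_adj\<^sup>*\<^sup>* (1, 1) (back_right (state hit_index))"
    using state_chains[of hit_index] hit_index_ge by auto
  obtain a b a' b' where ab: "back_left (state hit_index) = (a, b)" "back_right (state hit_index) = (a', b')" by (metis surj_pair)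
  show ?thesis
    using hit_index(1) f c N_right[of b'] N_top[of a] unfolding hits_def exit_arc_def flanked_def ab by auto
qed

end

section \<open>Planarity\<close>

text \<open>The polygonal path through a chain. The alternative \<open>a = u \<and> b = u\<close>
  provides for the trivial chain, whose path is constant.\<close>

lemma rtranclp_path:
  fixes q :: "'a \<Rightarrow> 'b::real_normed_vector"
  assumes "R\<^sup>*\<^sup>* u v"
  obtains g where "path g" "pathstart g = q u" "pathfinish g = q v"
    "\<And>z. z \<in> path_image g \<Longrightarrow> \<exists>a b. (R a b \<or> (a = u \<and> b = u)) \<and> z \<in> closed_segment (q a) (q b)"
proof -
  have "\<exists>g. path g \<and> pathstart g = q u \<and> pathfinish g = q v \<and>
    (\<forall>z\<in>path_image g. \<exists>a b. (R a b \<or> (a = u \<and> b = u)) \<and> z \<in> closed_segment (q a) (q b))"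
    using assms
  proof (induction rule: rtranclp_induct)
    case base
    show ?case
    proof (rule exI[of _ "linepath (q u) (q u)"], intro conjI ballI)
      fix z assume "z \<in> path_image (linepath (q u) (q u))"
      then have "z \<in> closed_segment (q u) (q u)" by (simp only: path_image_linepath)
      then show "\<exists>a b. (R a b \<or> (a = u \<and> b = u)) \<and> z \<in> closed_segment (q a) (q b)" by blast
    qed (rule path_linepath pathstart_linepath pathfinish_linepath)+
  next
    case (step y z)
    then obtain g where g: "path g" "pathstart g = q u" "pathfinish g = q y"
      "\<forall>z\<in>path_image g. \<exists>a b. (R a b \<or> (a = u \<and> b = u)) \<and> z \<in> closed_segment (q a) (q b)" by blast
    show ?case
    proof (rule exI[of _ "g +++ linepath (q y) (q z)"], intro conjI ballI)
      show "path (g +++ linepath (q y) (q z))" "pathstart (g +++ linepath (q y) (q z)) = q u"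
        "pathfinish (g +++ linepath (q y) (q z)) = q z"
        using g by simp_all
      fix x assume "x \<in> path_image (g +++ linepath (q y) (q z))"
      then have "x \<in> path_image g \<or> x \<in> closed_segment (q y) (q z)"
        using path_image_join_subset[of g "linepath (q y) (q z)"] by auto
      then show "\<exists>a b. (R a b \<or> (a = u \<and> b = u)) \<and> x \<in> closed_segment (q a) (q b)"
        using g(4) step(2) by blast
    qed
  qed
  then show thesis using that by blast
qed

text \<open>Two pairs of equal or consecutive integers without a common element span disjoint
  intervals.\<close>

lemma unit_segments_meet_1d:
  fixes a a' b b' :: int and s t :: real
  assumes ab: "\<bar>a' - a\<bar> \<le> 1" "\<bar>b' - b\<bar> \<le> 1" and st: "0 \<le> s" "s \<le> 1" "0 \<le> t" "t \<le> 1"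
    and eq: "(1 - t) * of_int a + t * of_int a' = (1 - s) * of_int b + s * of_int b'"
  shows "a = b \<or> a = b' \<or> a' = b \<or> a' = b'"
proof (rule ccontr)
  assume ne: "\<not> ?thesis"
  have conv: "of_int m \<le> (1 - r) * of_int c + r * of_int c'" "(1 - r) * of_int c + r * of_int c' \<le> of_int M"
    if "m \<le> c" "m \<le> c'" "c \<le> M" "c' \<le> M" "0 \<le> r" "r \<le> 1" for m M c c' :: int and r :: real
  proof -
    have "(1 - r) * of_int m + r * of_int m \<le> (1 - r) * of_int c + r * of_int c'"
      using that by (intro add_mono mult_left_mono) auto
    then show "of_int m \<le> (1 - r) * of_int c + r * of_int c'" by (simp add: algebra_simps)
    have "(1 - r) * of_int c + r * of_int c' \<le> (1 - r) * of_int M + r * of_int M"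
      using that by (intro add_mono mult_left_mono) auto
    then show "(1 - r) * of_int c + r * of_int c' \<le> of_int M" by (simp add: algebra_simps)
  qed
  have "max a a' < min b b' \<or> max b b' < min a a'" using ne ab by linarith
  then show False
  proof
    assume l: "max a a' < min b b'"
    have "(1 - t) * of_int a + t * of_int a' \<le> of_int (max a a')" using st by (intro conv(2)[of "min a a'"]) auto
    moreover have "of_int (min b b') \<le> (1 - s) * of_int b + s * of_int b'" using st by (intro conv(1)[of _ _ _ "max b b'"]) auto
    ultimately have "(of_int (min b b') :: real) \<le> of_int (max a a')" using eq by linarith
    then show False using l by (simp only: of_int_le_iff)
  next
    assume l: "max b b' < min a a'"
    have "(1 - s) * of_int b + s * of_int b' \<le> of_int (max b b')" using st by (intro conv(2)[of "min b b'"]) auto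
    moreover have "of_int (min a a') \<le> (1 - t) * of_int a + t * of_int a'" using st by (intro conv(1)[of _ _ _ "max a a'"]) auto
    ultimately have "(of_int (min a a') :: real) \<le> of_int (max b b')" using eq by linarith
    then show False using l by (simp only: of_int_le_iff)
  qed
qed

lemma unit_segment_integer:
  fixes b b' k :: int and s :: real
  assumes "\<bar>b' - b\<bar> \<le> 1" "0 \<le> s" "s \<le> 1" and eq: "(1 - s) * of_int b + s * of_int b' = of_int k"
  shows "(b = k \<and> b' = k) \<or> (s = 0 \<and> b = k) \<or> (s = 1 \<and> b' = k)"
proof -
  have kb: "k = b \<or> k = b'" using unit_segments_meet_1d[of k k b' b s 0] assms by auto
  have e: "s * of_int (b' - b) = of_int (k - b)" using eq by (simp add: algebra_simps)
  from kb show ?thesis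
  proof
    assume k: "k = b"
    then have "s = 0 \<or> b' = b" using e by simp
    then show ?thesis using k by auto
  next
    assume k: "k = b'"
    then have "(1 - s) * of_int (b' - b) = (0::real)" using e by (simp add: algebra_simps)
    then have "s = 1 \<or> b' = b" by simp
    then show ?thesis using k by auto
  qed
qed

text \<open>The second segment meets the row of the first at one of its own ends, or else lies in
  that row and the question is one-dimensional.\<close>

lemma unit_segments_meet_horizontal:
  fixes u1 u1' u2 v1 v1' v2 v2' :: int and s t :: real
  assumes "\<bar>u1' - u1\<bar> \<le> 1" "\<bar>v1' - v1\<bar> \<le> 1" "\<bar>v2' - v2\<bar> \<le> 1" and st: "0 \<le> s" "s \<le> 1" "0 \<le> t" "t \<le> 1"
    and eq1: "(1 - t) * of_int u1 + t * of_int u1' = (1 - s) * of_int v1 + s * of_int v1'"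
    and eq2: "of_int u2 = (1 - s) * of_int v2 + s * of_int v2'"
  shows "(u1 = v1 \<and> u2 = v2) \<or> (u1 = v1' \<and> u2 = v2') \<or> (u1' = v1 \<and> u2 = v2) \<or> (u1' = v1' \<and> u2 = v2')"
proof -
  consider "v2 = u2" "v2' = u2" | "s = 0" "v2 = u2" | "s = 1" "v2' = u2"
    using unit_segment_integer[of v2' v2 s u2] assms by auto
  then show ?thesis
  proof cases
    case 1
    then show ?thesis using unit_segments_meet_1d[OF assms(1,2) st eq1] by auto
  next
    case 2
    then show ?thesis using unit_segment_integer[of u1' u1 t v1] assms by auto
  next
    case 3
    then show ?thesis using unit_segment_integer[of u1' u1 t v1'] assms by auto
  qed
qed

text \<open>The plane is \<open>real ^ 2\<close> here because the Fashoda theorem is formulated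
  there.\<close>

definition vec_of :: "int \<times> int \<Rightarrow> real ^ 2" where
  "vec_of v = vector [of_int (fst v), of_int (snd v)]"

lemma vec_of_nth [simp]: "vec_of v $ 1 = of_int (fst v)" "vec_of v $ 2 = of_int (snd v)"
  by (simp_all add: vec_of_def)

text \<open>A king move meets the grid line of a lattice edge only at lattice points unless it runs
  inside that line, so the two kinds of edges never cross properly. The diagonals of one face do
  cross, hence only one adjacency may contain them.\<close>

lemma unit_segments_meet:
  assumes u: "\<bar>fst u - fst u'\<bar> + \<bar>snd u - snd u'\<bar> \<le> 1" and v: "\<bar>fst v - fst v'\<bar> \<le> 1" "\<bar>snd v - snd v'\<bar> \<le> 1"
    and z: "z \<in> closed_segment (vec_of u) (vec_of u')" "z \<in> closed_segment (vec_of v) (vec_of v')"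
  shows "u = v \<or> u = v' \<or> u' = v \<or> u' = v'"
proof -
  obtain t where t: "0 \<le> t" "t \<le> 1" "z = (1 - t) *\<^sub>R vec_of u + t *\<^sub>R vec_of u'" using z(1) by (auto simp: closed_segment_def)
  obtain s where s: "0 \<le> s" "s \<le> 1" "z = (1 - s) *\<^sub>R vec_of v + s *\<^sub>R vec_of v'" using z(2) by (auto simp: closed_segment_def)
  have "z $ 1 = (1 - t) * of_int (fst u) + t * of_int (fst u')" "z $ 2 = (1 - t) * of_int (snd u) + t * of_int (snd u')"
    by (simp_all add: t(3))
  moreover have "z $ 1 = (1 - s) * of_int (fst v) + s * of_int (fst v')" "z $ 2 = (1 - s) * of_int (snd v) + s * of_int (snd v')"
    by (simp_all add: s(3))
  ultimately have e: "(1 - t) * of_int (fst u) + t * of_int (fst u') = (1 - s) * of_int (fst v) + s * of_int (fst v')"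
    "(1 - t) * of_int (snd u) + t * of_int (snd u') = (1 - s) * of_int (snd v) + s * of_int (snd v')" by auto
  have "snd u = snd u' \<or> fst u = fst u'" using u by linarith
  then show ?thesis
  proof
    assume h: "snd u = snd u'"
    have k: "of_int (snd u) = (1 - s) * of_int (snd v) + s * of_int (snd v')" using e(2) h by (simp add: algebra_simps)
    have "(fst u = fst v \<and> snd u = snd v) \<or> (fst u = fst v' \<and> snd u = snd v') \<or> (fst u' = fst v \<and> snd u = snd v) \<or> (fst u' = fst v' \<and> snd u = snd v')"
      by (rule unit_segments_meet_horizontal[OF _ _ _ s(1,2) t(1,2) e(1) k]) (use u v in linarith)+
    then show ?thesis unfolding prod_eq_iff using h by metis
  next
    assume h: "fst u = fst u'"
    have k: "of_int (fst u) = (1 - s) * of_int (fst v) + s * of_int (fst v')" using e(1) h by (simp add: algebra_simps)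
    have "(snd u = snd v \<and> fst u = fst v) \<or> (snd u = snd v' \<and> fst u = fst v') \<or> (snd u' = snd v \<and> fst u = fst v) \<or> (snd u' = snd v' \<and> fst u = fst v')"
      by (rule unit_segments_meet_horizontal[OF _ _ _ s(1,2) t(1,2) e(2) k]) (use u v in linarith)+
    then show ?thesis unfolding prod_eq_iff using h by metis
  qed
qed

lemma pathfinish_polyline: "ps \<noteq> [] \<Longrightarrow> pathfinish (polyline ps) = last ps"
  by (induction ps rule: polyline.induct) auto

section \<open>Crossings and the end of the level line\<close>

context sign_pattern
begin

text \<open>One chain joins the left to the right side of the box, the other the bottom to the top.
  By the Fashoda theorem their polygonal paths meet, hence the chains share a vertex, which would
  have both signs.\<close>

lemma no_double_crossing:
  assumes P: "pos_adj\<^sup>*\<^sup>* (1, j) (nx, j')" "inbox (1, j)" "\<not> N (1, j)"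
    and Q: "neg_adj\<^sup>*\<^sup>* (1, 1) (i, ny)"
  shows False
proof -
  have N11: "N (1, 1)" using N_bottom[of 1] nx_ge by simp
  obtain f where f: "path f" "pathstart f = vec_of (1, j)" "pathfinish f = vec_of (nx, j')"
    "\<And>z. z \<in> path_image f \<Longrightarrow> \<exists>a b. (pos_adj a b \<or> (a = (1, j) \<and> b = (1, j))) \<and> z \<in> closed_segment (vec_of a) (vec_of b)"
    using rtranclp_path[OF P(1), of vec_of] by blast
  obtain g where g: "path g" "pathstart g = vec_of (1, 1)" "pathfinish g = vec_of (i, ny)"
    "\<And>z. z \<in> path_image g \<Longrightarrow> \<exists>a b. (neg_adj a b \<or> (a = (1, 1) \<and> b = (1, 1))) \<and> z \<in> closed_segment (vec_of a) (vec_of b)"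
    using rtranclp_path[OF Q, of vec_of] by blast
  have inb: "vec_of a \<in> cbox (vec_of (1, 1)) (vec_of (nx, ny))" if "inbox a" for a
    using that by (auto simp: mem_box_cart forall_2 inbox_def)
  have seg: "z \<in> cbox (vec_of (1, 1)) (vec_of (nx, ny))"
    if "inbox a" "inbox b" "z \<in> closed_segment (vec_of a) (vec_of b)" for a b z
    using closed_segment_subset[OF inb[OF that(1)] inb[OF that(2)] convex_box(1)] that(3) by blast
  have fz: "\<exists>a b. inbox a \<and> inbox b \<and> \<not> N a \<and> \<not> N b \<and> \<bar>fst a - fst b\<bar> + \<bar>snd a - snd b\<bar> \<le> 1 \<and> z \<in> closed_segment (vec_of a) (vec_of b)"
    if z: "z \<in> path_image f" for z
  proof -
    obtain a b where "pos_adj a b \<or> (a = (1, j) \<and> b = (1, j))" "z \<in> closed_segment (vec_of a) (vec_of b)"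
      using f(4)[OF z] by blast
    then show ?thesis using P by (intro exI[of _ a] exI[of _ b]) (auto simp: pos_adj_def)
  qed
  have gz: "\<exists>a b. inbox a \<and> inbox b \<and> N a \<and> N b \<and> \<bar>fst a - fst b\<bar> \<le> 1 \<and> \<bar>snd a - snd b\<bar> \<le> 1 \<and> z \<in> closed_segment (vec_of a) (vec_of b)"
    if z: "z \<in> path_image g" for z
  proof -
    obtain a b where "neg_adj a b \<or> (a = (1, 1) \<and> b = (1, 1))" "z \<in> closed_segment (vec_of a) (vec_of b)"
      using g(4)[OF z] by blast
    then show ?thesis using N11 N_inbox[of a] N_inbox[of b] by (intro exI[of _ a] exI[of _ b]) (auto simp: neg_adj_def)
  qed
  obtain z where z: "z \<in> path_image f" "z \<in> path_image g"
  proof (rule fashoda[OF f(1) g(1), of "vec_of (1, 1)" "vec_of (nx, ny)"])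
    show "path_image f \<subseteq> cbox (vec_of (1, 1)) (vec_of (nx, ny))" using fz seg by blast
    show "path_image g \<subseteq> cbox (vec_of (1, 1)) (vec_of (nx, ny))" using gz seg by blast
  qed (use f g in auto)
  obtain a b where ab: "\<not> N a" "\<not> N b" "\<bar>fst a - fst b\<bar> + \<bar>snd a - snd b\<bar> \<le> 1" "z \<in> closed_segment (vec_of a) (vec_of b)"
    using fz[OF z(1)] by blast
  obtain c d where cd: "N c" "N d" "\<bar>fst c - fst d\<bar> \<le> 1" "\<bar>snd c - snd d\<bar> \<le> 1" "z \<in> closed_segment (vec_of c) (vec_of d)"
    using gz[OF z(2)] by blast
  from unit_segments_meet[OF ab(3) cd(3,4) ab(4) cd(5)] ab(1,2) cd(1,2) show False by auto
qed

lemma connected_iff: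
  assumes N: "\<And>v. N v \<longleftrightarrow> negv \<delta> L \<phi> (pt v)"
  shows "nonneg_connected \<delta> L \<phi> (arc_ab \<delta> L) (arc_cd \<delta> L) \<longleftrightarrow>
    (\<exists>j j'. 2 \<le> j \<and> j \<le> ny \<and> 1 \<le> j' \<and> j' \<le> ny - 1 \<and> pos_adj\<^sup>*\<^sup>* (1, j) (nx, j'))"
proof
  have nn: "0 \<le> \<phi> (pt v) \<longleftrightarrow> \<not> N v" if "inbox v" for v using that by (auto simp: N negv_def)
  {
    assume "nonneg_connected \<delta> L \<phi> (arc_ab \<delta> L) (arc_cd \<delta> L)"
    then obtain vs where vs: "vs \<noteq> []" "hd vs \<in> arc_ab \<delta> L" "last vs \<in> arc_cd \<delta> L" "set vs \<subseteq> Vset \<delta> L"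
        "successively (adjacent \<delta>) vs" "\<forall>v\<in>set vs. 0 \<le> \<phi> v" by (auto simp: nonneg_connected_def)
    have "\<exists>u v. hd vs = pt u \<and> last vs = pt v \<and> pos_adj\<^sup>*\<^sup>* u v"
      using vs(1,4,5,6)
    proof (induction vs)
      case (Cons z zs)
      obtain u where u: "z = pt u" "inbox u" using Cons.prems(2) by (auto simp: Vset_eq)
      show ?case
      proof (cases "zs = []")
        case True
        then show ?thesis using u by auto
      next
        case False
        have adj: "adjacent \<delta> z (hd zs)" "successively (adjacent \<delta>) zs"
          using Cons.prems(3) False by (auto simp: successively_Cons)
        obtain v w where v: "hd zs = pt v" "last zs = pt w" "pos_adj\<^sup>*\<^sup>* v w"
          using Cons.IH[OF False] Cons.prems adj(2) by auto
        have "hd zs \<in> set zs" using False by simp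
        then have "inbox v" "0 \<le> \<phi> (pt v)" "0 \<le> \<phi> (pt u)" using Cons.prems v u by auto
        then have "pos_adj u v" using adj(1) nn u v(1) by (auto simp: pos_adj_def adjacent_pt)
        then have "pos_adj\<^sup>*\<^sup>* u w" using v(3) by (rule converse_rtranclp_into_rtranclp)
        then show ?thesis using False u v by auto
      qed
    qed simp
    then obtain u v where uv: "hd vs = pt u" "last vs = pt v" "pos_adj\<^sup>*\<^sup>* u v" by blast
    then obtain j j' where "u = (1, j)" "2 \<le> j" "j \<le> ny" "v = (nx, j')" "1 \<le> j'" "j' \<le> ny - 1"
      using vs(2,3) by (auto simp: arc_ab_eq arc_cd_eq)
    then show "\<exists>j j'. 2 \<le> j \<and> j \<le> ny \<and> 1 \<le> j' \<and> j' \<le> ny - 1 \<and> pos_adj\<^sup>*\<^sup>* (1, j) (nx, j')"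
      using uv(3) by blast
  }
  {
    assume "\<exists>j j'. 2 \<le> j \<and> j \<le> ny \<and> 1 \<le> j' \<and> j' \<le> ny - 1 \<and> pos_adj\<^sup>*\<^sup>* (1, j) (nx, j')"
    then obtain j j' where j: "2 \<le> j" "j \<le> ny" "1 \<le> j'" "j' \<le> ny - 1" "pos_adj\<^sup>*\<^sup>* (1, j) (nx, j')" by blast
    have "\<exists>vs. vs \<noteq> [] \<and> hd vs = pt (1, j) \<and> last vs = pt v \<and> set vs \<subseteq> Vset \<delta> L \<and>
        successively (adjacent \<delta>) vs \<and> (\<forall>v\<in>set vs. 0 \<le> \<phi> v)" if "pos_adj\<^sup>*\<^sup>* (1, j) v" for v
      using that
    proof (induction rule: rtranclp_induct)
      case base
      have "inbox (1, j)" "\<not> N (1, j)" using j nx_ge N_left by (auto simp: inbox_def)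
      then show ?case using nn by (intro exI[of _ "[pt (1, j)]"]) auto
    next
      case (step y z)
      then obtain vs where "vs \<noteq> []" "hd vs = pt (1, j)" "last vs = pt y" "set vs \<subseteq> Vset \<delta> L"
        "successively (adjacent \<delta>) vs" "\<forall>v\<in>set vs. 0 \<le> \<phi> v" by blast
      then show ?case using step(2) nn
        by (intro exI[of _ "vs @ [pt z]"]) (auto simp: successively_append_iff pos_adj_def adjacent_pt)
    qed
    from this[OF j(5)] show "nonneg_connected \<delta> L \<phi> (arc_ab \<delta> L) (arc_cd \<delta> L)"
      unfolding nonneg_connected_def arc_ab_eq arc_cd_eq using j by auto
  }
qed

text \<open>The end is half a spacing from its flanking vertex, and the extreme column or row is
  within \<delta> of the side, which gives 3 \<delta> / 2 and leaves room up to 2 \<delta>.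
  Planarity serves the connected case, where it rules out an end at the top. Otherwise the line
  cannot end at the right, since its own left chain starts in \<open>[a, b)\<close> and would be a
  connection.\<close>

lemma level_line_endpoint:
  assumes N: "\<And>v. N v \<longleftrightarrow> negv \<delta> L \<phi> (pt v)"
  shows "nonneg_connected \<delta> L \<phi> (arc_ab \<delta> L) (arc_cd \<delta> L) \<Longrightarrow> L - 2 * \<delta> \<le> Re (level_line \<delta> L \<phi> 1)"
    and "\<not> nonneg_connected \<delta> L \<phi> (arc_ab \<delta> L) (arc_cd \<delta> L) \<Longrightarrow> 1 - 2 * \<delta> \<le> Im (level_line \<delta> L \<phi> 1)"
proof -
  have K: "(LEAST n. ll_hits \<delta> L (ll_state \<delta> L \<phi> n)) = hit_index"
    unfolding ll_hits_eq[OF N] hit_index_def state_def ..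
  obtain p e where s: "state hit_index = (p, e)" by (metis surj_pair)
  have e: "e \<in> directions" using iterate_directions[where N = N and n = hit_index] s by (simp add: state_def)
  have "level_line \<delta> L \<phi> 1 = pathfinish (level_line \<delta> L \<phi>)" by (simp add: pathfinish_def)
  also have "\<dots> = fst (ll_state \<delta> L \<phi> hit_index)"
    unfolding level_line_def K Let_def by (subst pathfinish_polyline) auto
  also have "\<dots> = dual p" unfolding ll_state_eq[OF N] using s by (simp add: state_def)
  finally have end_eq: "level_line \<delta> L \<phi> 1 = dual p" .
  have near: "Re (pt (back_left (p, e))) - \<delta> / 2 \<le> Re (dual p)" "Im (pt (back_right (p, e))) - \<delta> / 2 \<le> Im (dual p)"
    unfolding pt_flanks[OF e] using e delta by (auto simp: directions_def dir_def)
  have right: "L - 2 * \<delta> \<le> Re (dual p)" if "back_left (state hit_index) = (nx, j)" for j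
    using near(1) that nx_lower delta by (simp add: s pt_def)
  have top: "1 - 2 * \<delta> \<le> Im (dual p)" if "back_right (state hit_index) = (i, ny)" for i
    using near(2) that ny_lower delta by (simp add: s pt_def)
  show "L - 2 * \<delta> \<le> Re (level_line \<delta> L \<phi> 1)" if c: "nonneg_connected \<delta> L \<phi> (arc_ab \<delta> L) (arc_cd \<delta> L)"
  proof -
    obtain j j' where "2 \<le> j" "j \<le> ny" "pos_adj\<^sup>*\<^sup>* (1, j) (nx, j')"
      using c unfolding connected_iff[OF N] by blast
    moreover have "inbox (1, j)" "\<not> N (1, j)" using calculation nx_ge N_left by (auto simp: inbox_def)
    ultimately show ?thesis using hit_cases no_double_crossing right unfolding end_eq by blast
  qed
  show "1 - 2 * \<delta> \<le> Im (level_line \<delta> L \<phi> 1)" if "\<not> nonneg_connected \<delta> L \<phi> (arc_ab \<delta> L) (arc_cd \<delta> L)"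
    using hit_cases that ny_ge top unfolding end_eq connected_iff[OF N] by force
qed

end

section \<open>Boundary values of the field\<close>

lemma exponential_density_AE_pos: "AE t in density lborel (\<lambda>t. ennreal (exponential_density 1 t)). 0 < (t::real)"
proof -
  have "AE t in lborel. t \<noteq> (0::real)" by (rule AE_lborel_singleton)
  then show ?thesis
    by (subst AE_density) (auto simp: exponential_density_def elim!: eventually_mono)
qed

lemma prob_space_walk_step:
  "prob_space (measure_pmf (pmf_of_set {1, \<i>, -1, -\<i>}) \<Otimes>\<^sub>M density lborel (\<lambda>t. ennreal (exponential_density 1 t)))"
proof -
  interpret A: prob_space "measure_pmf (pmf_of_set {1, \<i>, -1, -\<i>})" by (rule prob_space_measure_pmf)
  interpret B: prob_space "density lborel (\<lambda>t. ennreal (exponential_density 1 t))"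
    by (rule prob_space_exponential_density) simp
  interpret pair_prob_space "measure_pmf (pmf_of_set {1, \<i>, -1, -\<i>})" "density lborel (\<lambda>t. ennreal (exponential_density 1 t))" ..
  show ?thesis by (rule prob_space_axioms)
qed

lemma prob_space_walk: "prob_space walk_space"
  unfolding walk_space_def by (rule prob_space_PiM) (rule prob_space_walk_step)

lemma AE_walk_first_time: "AE w in walk_space. 0 < snd (w 0)"
proof -
  interpret A: prob_space "measure_pmf (pmf_of_set {1, \<i>, -1, -\<i>})" by (rule prob_space_measure_pmf)
  interpret B: prob_space "density lborel (\<lambda>t. ennreal (exponential_density 1 t))"
    by (rule prob_space_exponential_density) simp
  interpret pair_prob_space "measure_pmf (pmf_of_set {1, \<i>, -1, -\<i>})" "density lborel (\<lambda>t. ennreal (exponential_density 1 t))" ..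
  have "AE p in measure_pmf (pmf_of_set {1, \<i>, -1, -\<i>}) \<Otimes>\<^sub>M density lborel (\<lambda>t. ennreal (exponential_density 1 t)). 0 < snd p"
  proof (rule AE_pair_measure)
    have "{p \<in> space (measure_pmf (pmf_of_set {1, \<i>, -1, -\<i>}) \<Otimes>\<^sub>M density lborel (\<lambda>t. ennreal (exponential_density 1 t))). 0 < snd p}
      = UNIV \<times> {0<..}" by (auto simp: space_pair_measure)
    then show "{p \<in> space (measure_pmf (pmf_of_set {1, \<i>, -1, -\<i>}) \<Otimes>\<^sub>M density lborel (\<lambda>t. ennreal (exponential_density 1 t))). 0 < snd p}
      \<in> sets (measure_pmf (pmf_of_set {1, \<i>, -1, -\<i>}) \<Otimes>\<^sub>M density lborel (\<lambda>t. ennreal (exponential_density 1 t)))"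
      by simp
    show "AE x in measure_pmf (pmf_of_set {1, \<i>, -1, -\<i>}). AE y in density lborel (\<lambda>t. ennreal (exponential_density 1 t)). 0 < snd (x, y)"
      using exponential_density_AE_pos by simp
  qed
  then show ?thesis
    unfolding walk_space_def by (intro AE_PiM_component[where P = "\<lambda>p. 0 < snd p"] prob_space_walk_step) auto
qed

section \<open>Measurability of the stopped walk\<close>

lemma measurable_walk_components:
  "(\<lambda>w. fst (w k)) \<in> borel_measurable walk_space" "(\<lambda>w. snd (w k)) \<in> borel_measurable walk_space"
proof -
  have c: "(\<lambda>w. w k) \<in> measurable walk_space (measure_pmf (pmf_of_set {1, \<i>, -1, -\<i>}) \<Otimes>\<^sub>M density lborel (\<lambda>t. ennreal (exponential_density 1 t)))"
    unfolding walk_space_def by (rule measurable_component_singleton) simp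
  from measurable_compose[OF c measurable_fst, THEN measurable_compose, of "\<lambda>x. x" borel]
  show "(\<lambda>w. fst (w k)) \<in> borel_measurable walk_space" by simp
  from measurable_compose[OF c measurable_snd, THEN measurable_compose, of "\<lambda>x. x" borel]
  show "(\<lambda>w. snd (w k)) \<in> borel_measurable walk_space" by simp
qed

lemma measurable_jump [measurable]:
  "(\<lambda>w. jump_chain \<delta> v w n) \<in> borel_measurable walk_space" "(\<lambda>w. jump_time w n) \<in> borel_measurable walk_space"
  unfolding jump_chain_def jump_time_def using measurable_walk_components by measurable

text \<open>The random time enters only through a jump index, so countably many measurable positions
  are glued.\<close>

lemma measurable_walk_at:
  assumes [measurable]: "\<tau> \<in> borel_measurable walk_space"
  shows "(\<lambda>w. walk \<delta> v w (\<tau> w)) \<in> borel_measurable walk_space"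
  unfolding walk_def
proof (rule measurable_compose_countable)
  show "(\<lambda>w. LEAST n. \<tau> w < jump_time w (Suc n)) \<in> measurable walk_space (count_space UNIV)"
    by measurable
qed measurable

text \<open>The path is a right-continuous step function, so that hitting may be tested at rational times.\<close>

lemma walk_right_constant: "\<exists>r>t. \<forall>s. t \<le> s \<longrightarrow> s < r \<longrightarrow> walk \<delta> v w s = walk \<delta> v w t"
proof (cases "\<exists>n. t < jump_time w (Suc n)")
  case True
  define n where "n = (LEAST n. t < jump_time w (Suc n))"
  have n: "t < jump_time w (Suc n)" unfolding n_def by (rule LeastI_ex[OF True])
  have "(LEAST m. s < jump_time w (Suc m)) = n" if "t \<le> s" "s < jump_time w (Suc n)" for s
  proof (rule Least_equality)
    fix m assume "s < jump_time w (Suc m)"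
    then have "t < jump_time w (Suc m)" using that by simp
    then show "n \<le> m" unfolding n_def by (rule Least_le)
  qed (rule that)
  then have "walk \<delta> v w s = walk \<delta> v w t" if "t \<le> s" "s < jump_time w (Suc n)" for s
    using that by (simp add: walk_def n_def[symmetric])
  then show ?thesis using n by blast
next
  case False
  \<comment> \<open>Beyond all jump times \<open>LEAST\<close> is applied to an everywhere false
    predicate, so the index is one fixed unspecified number and the path is constant.\<close>
  have "walk \<delta> v w s = walk \<delta> v w t" if "t \<le> s" for s
  proof -
    have "\<not> s < jump_time w (Suc n)" "\<not> t < jump_time w (Suc n)" for n using False that by (auto simp: not_less intro: order_trans)
    then show ?thesis by (simp add: walk_def)
  qed
  then show ?thesis using less_add_one[of t] by blast
qed

lemma hit_time_less_iff:
  "hit_time \<delta> L v w < ereal a \<longleftrightarrow> (\<exists>q::rat. 0 \<le> q \<and> of_rat q < a \<and> walk \<delta> v w (of_rat q) \<in> bdry \<delta> L)"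
proof
  assume "hit_time \<delta> L v w < ereal a"
  then obtain t where t: "0 \<le> t" "t < a" "walk \<delta> v w t \<in> bdry \<delta> L"
    by (auto simp: hit_time_def Inf_less_iff)
  obtain r where r: "t < r" "\<forall>s. t \<le> s \<longrightarrow> s < r \<longrightarrow> walk \<delta> v w s = walk \<delta> v w t"
    using walk_right_constant[of t \<delta> v w] by blast
  have "t < min r a" using t(2) r(1) by simp
  then obtain q where q: "t < of_rat q" "of_rat q < min r a" using of_rat_dense by blast
  then have "0 < (of_rat q :: real)" using t(1) by linarith
  then have "0 \<le> q" by (simp add: zero_less_of_rat_iff)
  then show "\<exists>q::rat. 0 \<le> q \<and> of_rat q < a \<and> walk \<delta> v w (of_rat q) \<in> bdry \<delta> L"
    using q r(2)[rule_format, of "of_rat q"] t(3) by auto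
next
  assume "\<exists>q::rat. 0 \<le> q \<and> of_rat q < a \<and> walk \<delta> v w (of_rat q) \<in> bdry \<delta> L"
  then obtain q :: rat where q: "0 \<le> q" "of_rat q < a" "walk \<delta> v w (of_rat q) \<in> bdry \<delta> L" by blast
  then have "ereal (of_rat q) \<in> ereal ` {t. 0 \<le> t \<and> walk \<delta> v w t \<in> bdry \<delta> L}" by (auto simp: zero_le_of_rat_iff)
  then have "hit_time \<delta> L v w \<le> ereal (of_rat q)" unfolding hit_time_def by (rule Inf_lower)
  also have "\<dots> < ereal a" using q by simp
  finally show "hit_time \<delta> L v w < ereal a" .
qed

lemma measurable_hit_time:
  assumes "finite (bdry \<delta> L)"
  shows "(\<lambda>w. real_of_ereal (hit_time \<delta> L v w)) \<in> borel_measurable walk_space"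
proof -
  have [measurable]: "bdry \<delta> L \<in> sets borel" using assms by (simp add: borel_closed finite_imp_closed)
  have [measurable]: "(\<lambda>w. walk \<delta> v w t) \<in> borel_measurable walk_space" for t
    by (rule measurable_walk_at) simp
  have "(\<lambda>w. hit_time \<delta> L v w) \<in> borel_measurable walk_space"
  proof (rule borel_measurable_ereal_iff_Iio[THEN iffD2], safe)
    fix a :: ereal
    show "hit_time \<delta> L v -` {..<a} \<inter> space walk_space \<in> sets walk_space"
    proof (cases a)
      case (real r)
      have "hit_time \<delta> L v -` {..<a} \<inter> space walk_space =
        {w \<in> space walk_space. \<exists>q::rat. 0 \<le> q \<and> of_rat q < r \<and> walk \<delta> v w (of_rat q) \<in> bdry \<delta> L}"
        by (auto simp: real hit_time_less_iff)
      also have "\<dots> \<in> sets walk_space" by measurable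
      finally show ?thesis .
    next
      case PInf
      have "hit_time \<delta> L v -` {..<a} \<inter> space walk_space =
        (\<Union>n::nat. {w \<in> space walk_space. \<exists>q::rat. 0 \<le> q \<and> of_rat q < real n \<and> walk \<delta> v w (of_rat q) \<in> bdry \<delta> L})"
      proof -
        have "hit_time \<delta> L v w < \<infinity> \<longleftrightarrow> (\<exists>n::nat. hit_time \<delta> L v w < ereal (real n))" for w
          by (simp add: less_PInf_Ex_of_nat[symmetric])
        then show ?thesis by (auto simp: PInf hit_time_less_iff)
      qed
      also have "\<dots> \<in> sets walk_space" by measurable
      finally show ?thesis .
    next
      case MInf
      then have "hit_time \<delta> L v -` {..<a} = {}" by auto
      then show ?thesis by simp
    qed
  qed
  then show ?thesis by measurable
qed

lemma hit_time_bdry: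
  assumes "v \<in> bdry \<delta> L" "0 < snd (w 0)"
  shows "hit_time \<delta> L v w = 0" "walk \<delta> v w 0 = v"
proof -
  have "(LEAST n. 0 < jump_time w (Suc n)) = 0"
    by (rule Least_eq_0) (use assms in \<open>simp add: jump_time_def\<close>)
  then show w: "walk \<delta> v w 0 = v" by (simp add: walk_def jump_chain_def)
  show "hit_time \<delta> L v w = 0"
  proof (rule antisym)
    have "ereal 0 \<in> ereal ` {t. 0 \<le> t \<and> walk \<delta> v w t \<in> bdry \<delta> L}" using w assms by auto
    then show "hit_time \<delta> L v w \<le> 0" unfolding hit_time_def zero_ereal_def by (rule Inf_lower)
    show "0 \<le> hit_time \<delta> L v w" unfolding hit_time_def by (rule Inf_greatest) auto
  qed
qed

text \<open>Started on the boundary, the walk is stopped at time 0 almost surely. Replacing the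
  integrand almost surely is where its measurability enters.\<close>

lemma harm_ext_bdry:
  assumes "v \<in> bdry \<delta> L" "finite (bdry \<delta> L)" and f: "f \<in> borel_measurable borel"
  shows "harm_ext \<delta> L f v = f v"
proof -
  interpret prob_space walk_space by (rule prob_space_walk)
  have "harm_ext \<delta> L f v = (\<integral>w. f v \<partial>walk_space)"
    unfolding harm_ext_def
  proof (rule integral_cong_AE)
    show "(\<lambda>w. f (walk \<delta> v w (real_of_ereal (hit_time \<delta> L v w)))) \<in> borel_measurable walk_space"
      by (rule measurable_compose[OF measurable_walk_at[OF measurable_hit_time[OF assms(2)]] f])
    show "AE w in walk_space. f (walk \<delta> v w (real_of_ereal (hit_time \<delta> L v w))) = f v"
      using AE_walk_first_time by eventually_elim (simp add: hit_time_bdry[OF assms(1)])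
  qed simp
  then show ?thesis by (simp add: prob_space)
qed

lemma green_bdry:
  assumes "v \<in> bdry \<delta> L"
  shows "green \<delta> L v u = 0"
proof -
  have "(\<integral>\<^sup>+ w. (\<integral>\<^sup>+ t. indicator {t. 0 \<le> t \<and> ereal t < hit_time \<delta> L v w \<and> walk \<delta> v w t = u} t \<partial>lborel) \<partial>walk_space)
     = (\<integral>\<^sup>+ w. 0 \<partial>walk_space)"
  proof (rule nn_integral_cong_AE)
    show "AE w in walk_space. (\<integral>\<^sup>+ t. indicator {t. 0 \<le> t \<and> ereal t < hit_time \<delta> L v w \<and> walk \<delta> v w t = u} t \<partial>lborel) = 0"
      using AE_walk_first_time
    proof eventually_elim
      case (elim w)
      have "{t. 0 \<le> t \<and> ereal t < hit_time \<delta> L v w \<and> walk \<delta> v w t = u} = {}"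
        using hit_time_bdry[of v \<delta> L w] assms elim by (auto simp: zero_ereal_def)
      then show ?case by simp
    qed
  qed
  then show ?thesis by (simp add: green_def)
qed

text \<open>A normal density would give variance \<open>\<sigma>\<^sup>2 > 0\<close>; a constant
  equals its mean.\<close>

lemma gaussian_rv_zero_variance:
  assumes "prob_space M" "gaussian_rv M X" and m: "(\<integral>w. X w \<partial>M) = m" and var: "(\<integral>w. (X w - m) * (X w - m) \<partial>M) = 0"
  shows "AE w in M. X w = m"
proof -
  interpret prob_space M by fact
  from assms(2) consider \<mu> \<sigma> where "0 < \<sigma>" "distributed M lborel X (\<lambda>x. ennreal (normal_density \<mu> \<sigma> x))"
    | \<mu> where "AE w in M. X w = \<mu>" by (auto simp: gaussian_rv_def)
  then show ?thesis
  proof cases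
    case (1 \<mu> \<sigma>)
    have "m = \<mu>" using normal_distributed_expectation[OF 1] m by simp
    then have "variance X = 0" using var m by (simp add: power2_eq_square)
    moreover have "variance X = \<sigma>\<^sup>2" by (rule normal_distributed_variance[OF 1])
    ultimately show ?thesis using 1 by simp
  next
    case (2 \<mu>)
    have "(\<integral>w. X w \<partial>M) = (\<integral>w. \<mu> \<partial>M)"
      using 2 assms(2) by (intro integral_cong_AE) (auto simp: gaussian_rv_def)
    then have "m = \<mu>" using m by (simp add: prob_space)
    then show ?thesis using 2 by simp
  qed
qed

text \<open>On the boundary the harmonic extension is \<open>f v\<close> and the Green function
  vanishes. This turns the Gaussian field into a pattern with prescribed boundary signs.\<close>

lemma gff_boundary_values:
  assumes gff: "discrete_gff \<delta> L f M \<phi>" and v: "v \<in> bdry \<delta> L" and fin: "finite (Vset \<delta> L)" and f: "f \<in> borel_measurable borel"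
  shows "AE w in M. \<phi> v w = f v"
proof -
  have gp: "gaussian_process M (Vset \<delta> L) \<phi> (harm_ext \<delta> L f) (green \<delta> L)" using gff by (simp add: discrete_gff_def)
  have vV: "v \<in> Vset \<delta> L" using v by (simp add: bdry_def)
  have fb: "finite (bdry \<delta> L)" using fin by (rule finite_subset[rotated]) (auto simp: bdry_def)
  have "\<forall>J a. finite J \<longrightarrow> J \<subseteq> Vset \<delta> L \<longrightarrow> gaussian_rv M (\<lambda>w. \<Sum>i\<in>J. a i * \<phi> i w)"
    using gp by (simp add: gaussian_process_def)
  from this[rule_format, of "{v}" "\<lambda>_. 1"] vV have g: "gaussian_rv M (\<phi> v)" by simp
  show ?thesis
  proof (rule gaussian_rv_zero_variance[OF _ g])
    show "prob_space M" using gp by (simp add: gaussian_process_def)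
    show "(\<integral>w. \<phi> v w \<partial>M) = f v" using gp vV harm_ext_bdry[OF v fb f] by (simp add: gaussian_process_def)
    have "(\<integral>w. (\<phi> v w - harm_ext \<delta> L f v) * (\<phi> v w - harm_ext \<delta> L f v) \<partial>M) = green \<delta> L v v"
      using gp vV by (simp add: gaussian_process_def)
    then show "(\<integral>w. (\<phi> v w - f v) * (\<phi> v w - f v) \<partial>M) = 0"
      unfolding harm_ext_bdry[OF v fb f] green_bdry[OF v] .
  qed
qed

section \<open>Functionals of the sign pattern\<close>

lemma ll_state_cong:
  assumes "\<And>v. negv \<delta> L \<phi> v \<longleftrightarrow> negv \<delta> L \<psi> v"
  shows "ll_state \<delta> L \<phi> n = ll_state \<delta> L \<psi> n"
proof -
  have "ll_dir \<delta> L \<phi> = ll_dir \<delta> L \<psi>" by (intro ext) (simp only: ll_dir_def assms)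
  then show ?thesis by (induction n) simp_all
qed

lemma level_line_cong:
  assumes "\<And>v. negv \<delta> L \<phi> v \<longleftrightarrow> negv \<delta> L \<psi> v"
  shows "level_line \<delta> L \<phi> = level_line \<delta> L \<psi>"
  unfolding level_line_def ll_state_cong[OF assms] ..

lemma nonneg_connected_cong:
  assumes "\<And>v. negv \<delta> L \<phi> v \<longleftrightarrow> negv \<delta> L \<psi> v"
  shows "nonneg_connected \<delta> L \<phi> A B \<longleftrightarrow> nonneg_connected \<delta> L \<psi> A B"
proof -
  have "(\<forall>v\<in>set vs. 0 \<le> \<phi> v) \<longleftrightarrow> (\<forall>v\<in>set vs. 0 \<le> \<psi> v)" if "set vs \<subseteq> Vset \<delta> L" for vs
  proof (rule ball_cong[OF refl])
    fix v assume "v \<in> set vs"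
    then show "0 \<le> \<phi> v \<longleftrightarrow> 0 \<le> \<psi> v" using assms[of v] that by (auto simp: negv_def not_less[symmetric])
  qed
  then show ?thesis unfolding nonneg_connected_def by (intro ex_cong1 conj_cong refl)
qed

text \<open>Such a functional factors through the set of negative vertices, which has finitely many
  values, so it is measurable even into the discrete sigma-algebra.\<close>

lemma measurable_sign_functional:
  assumes fin: "finite (Vset \<delta> L)" and \<phi>: "\<And>v. v \<in> Vset \<delta> L \<Longrightarrow> \<phi> v \<in> borel_measurable M"
    and H: "\<And>\<phi> \<psi>. (\<And>v. negv \<delta> L \<phi> v \<longleftrightarrow> negv \<delta> L \<psi> v) \<Longrightarrow> H \<phi> = H \<psi>"
  shows "(\<lambda>w. H (\<lambda>v. \<phi> v w)) \<in> measurable M (count_space UNIV)"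
proof -
  define S where "S w = {v \<in> Vset \<delta> L. \<phi> v w < 0}" for w
  have "S \<in> measurable M (count_space (Pow (Vset \<delta> L)))"
  proof (rule measurable_count_space_eq2[THEN iffD2], simp add: fin, intro conjI ballI)
    show "S \<in> space M \<rightarrow> Pow (Vset \<delta> L)" by (auto simp: S_def)
    fix A assume A: "A \<in> Pow (Vset \<delta> L)"
    have "S -` {A} \<inter> space M = {w \<in> space M. \<forall>v\<in>Vset \<delta> L. \<phi> v w < 0 \<longleftrightarrow> v \<in> A}"
    proof -
      have "S w = A \<longleftrightarrow> (\<forall>v\<in>Vset \<delta> L. \<phi> v w < 0 \<longleftrightarrow> v \<in> A)" for w
        using A unfolding S_def set_eq_iff by blast
      then show ?thesis by blast
    qed
    also have "\<dots> \<in> sets M"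
    proof (rule sets.sets_Collect_finite_All[OF _ fin])
      fix v assume v: "v \<in> Vset \<delta> L"
      have "{w \<in> space M. \<phi> v w < 0} \<in> sets M" using \<phi>[OF v] by (rule borel_measurable_less) simp
      then show "{w \<in> space M. \<phi> v w < 0 \<longleftrightarrow> v \<in> A} \<in> sets M"
        by (cases "v \<in> A") (auto intro: sets.sets_Collect_neg)
    qed
    finally show "S -` {A} \<inter> space M \<in> sets M" .
  qed
  \<comment> \<open>A representative field with negative set \<open>S w\<close>.\<close>
  then have "(\<lambda>w. H (\<lambda>v. if v \<in> S w then -1 else 0)) \<in> measurable M (count_space UNIV)"
    by (rule measurable_compose) simp
  moreover have "H (\<lambda>v. \<phi> v w) = H (\<lambda>v. if v \<in> S w then -1 else 0)" for w
    by (rule H) (auto simp: negv_def S_def)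
  ultimately show ?thesis by simp
qed

section \<open>Evaluation at the endpoint\<close>

lemma reparams_at_1:
  assumes "u \<in> reparams"
  shows "u 1 = 1" "continuous_on {0..1} u" "u ` {0..1} = {0..1}"
proof -
  obtain v where v: "homeomorphism {0..1} {0..1} u v" and m: "strict_mono_on {0..1} u"
    using assms by (auto simp: reparams_def)
  show c: "continuous_on {0..1} u" "u ` {0..1} = {0..1}" using v by (auto simp: homeomorphism_def)
  then have "1 \<in> u ` {0..1}" by simp
  then obtain x where x: "x \<in> {0..1}" "u x = 1" by auto
  have "u 1 \<le> 1" using c(2) by (metis atLeastAtMost_iff imageI order_refl zero_le_one)
  then show "u 1 = 1"
    using x strict_mono_onD[OF m x(1), of 1] by (cases "x = 1") auto
qed

text \<open>Reparametrizations are increasing and onto, so they fix 1 and every supremum dominates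
  the distance of the ends. Evaluation at the end is thus 1-Lipschitz.\<close>

lemma curve_dist_endpoint:
  assumes p: "path \<eta>1" "path \<eta>2" and d: "curve_dist \<eta>1 \<eta>2 < r"
  shows "cmod (\<eta>1 1 - \<eta>2 1) < r"
proof -
  let ?f = "\<lambda>(u1, u2). SUP t \<in> {0..1}. cmod (\<eta>1 (u1 t) - \<eta>2 (u2 t))"
  have "id \<in> reparams"
    by (auto simp: reparams_def strict_mono_on_def homeomorphism_def intro!: exI[of _ id])
  then have ne: "?f ` (reparams \<times> reparams) \<noteq> {}" by blast
  obtain u1 u2 where u: "u1 \<in> reparams" "u2 \<in> reparams" "(SUP t \<in> {0..1}. cmod (\<eta>1 (u1 t) - \<eta>2 (u2 t))) < r"
    using cInf_lessD[OF ne d[unfolded curve_dist_def]] by auto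
  have "continuous_on {0..1} (\<lambda>t. \<eta>1 (u1 t))" "continuous_on {0..1} (\<lambda>t. \<eta>2 (u2 t))"
    using reparams_at_1[OF u(1)] reparams_at_1[OF u(2)] p unfolding path_def
    by (auto intro!: continuous_on_compose2[of "{0..1}" \<eta>1 "{0..1}" u1] continuous_on_compose2[of "{0..1}" \<eta>2 "{0..1}" u2])
  then have "continuous_on {0..1} (\<lambda>t. cmod (\<eta>1 (u1 t) - \<eta>2 (u2 t)))" by (intro continuous_intros)
  then have "bdd_above ((\<lambda>t. cmod (\<eta>1 (u1 t) - \<eta>2 (u2 t))) ` {0..1})"
    by (intro bounded_imp_bdd_above compact_imp_bounded compact_continuous_image) auto
  then have "cmod (\<eta>1 (u1 1) - \<eta>2 (u2 1)) \<le> (SUP t \<in> {0..1}. cmod (\<eta>1 (u1 t) - \<eta>2 (u2 t)))"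
    by (rule cSUP_upper[rotated]) simp
  then show ?thesis using u(3) reparams_at_1(1)[OF u(1)] reparams_at_1(1)[OF u(2)] by simp
qed

lemma curve_functional_endpoint:
  fixes g :: "complex \<Rightarrow> real"
  assumes g: "continuous_on UNIV g" and b: "\<And>z. \<bar>g z\<bar> \<le> C"
  shows "curve_functional (\<lambda>\<eta>. g (\<eta> 1))"
  unfolding curve_functional_def
proof (intro conjI allI impI)
  show "\<exists>B. \<forall>\<eta>. path \<eta> \<longrightarrow> \<bar>g (\<eta> 1)\<bar> \<le> B" using b by blast
  fix \<eta> :: "real \<Rightarrow> complex" and \<epsilon> :: real assume \<eta>: "path \<eta>" "0 < \<epsilon>"
  obtain r where r: "0 < r" "\<And>z. dist z (\<eta> 1) < r \<Longrightarrow> dist (g z) (g (\<eta> 1)) < \<epsilon>"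
    using g \<eta>(2) unfolding continuous_on_iff by (metis UNIV_I)
  show "\<exists>r>0. \<forall>\<eta>'. path \<eta>' \<longrightarrow> curve_dist \<eta> \<eta>' < r \<longrightarrow> \<bar>g (\<eta> 1) - g (\<eta>' 1)\<bar> < \<epsilon>"
  proof (intro exI[of _ r] conjI allI impI)
    fix \<eta>' assume "path \<eta>'" "curve_dist \<eta> \<eta>' < r"
    then have "cmod (\<eta> 1 - \<eta>' 1) < r" using curve_dist_endpoint \<eta> by blast
    then have "dist (g (\<eta>' 1)) (g (\<eta> 1)) < \<epsilon>" by (intro r(2)) (simp add: dist_norm norm_minus_commute)
    then show "\<bar>g (\<eta> 1) - g (\<eta>' 1)\<bar> < \<epsilon>" by (simp add: dist_real_def abs_minus_commute)
  qed (rule r(1))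
qed

text \<open>The portmanteau bound for a closed half-plane, with a slack \<open>2 * \<delta>\<close>
  on the discrete side; \<open>l\<close> will be the real or the imaginary part.\<close>

lemma endpoint_portmanteau:
  fixes l :: "complex \<Rightarrow> real"
  assumes conv: "curve_weak_conv M \<eta> N \<gamma> (at_right 0)" and l: "continuous_on UNIV l"
    and N: "prob_space N" "(\<lambda>w. \<gamma> w 1) \<in> borel_measurable N"
    and d0: "0 < \<delta>0"
    and M: "\<And>\<delta>. 0 < \<delta> \<Longrightarrow> \<delta> \<le> \<delta>0 \<Longrightarrow> prob_space (M \<delta>)"
    and A: "\<And>\<delta>. 0 < \<delta> \<Longrightarrow> \<delta> \<le> \<delta>0 \<Longrightarrow> A \<delta> \<in> sets (M \<delta>)"
    and em: "\<And>\<delta>. 0 < \<delta> \<Longrightarrow> \<delta> \<le> \<delta>0 \<Longrightarrow> (\<lambda>w. \<eta> \<delta> w 1) \<in> borel_measurable (M \<delta>)"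
    and imp: "\<And>\<delta>. 0 < \<delta> \<Longrightarrow> \<delta> \<le> \<delta>0 \<Longrightarrow> AE w in M \<delta>. w \<in> A \<delta> \<longrightarrow> b - 2 * \<delta> \<le> l (\<eta> \<delta> w 1)"
    and e: "0 < e"
  shows "\<forall>\<^sub>F \<delta> in at_right 0. measure (M \<delta>) (A \<delta>) < measure N {w \<in> space N. b \<le> l (\<gamma> w 1)} + e"
proof -
  interpret N: prob_space N by fact
  have [measurable]: "(\<lambda>w. \<gamma> w 1) \<in> borel_measurable N" by (rule N(2))
  have [measurable]: "l \<in> borel_measurable borel" using l by (rule borel_measurable_continuous_onI)
  \<comment> \<open>Piecewise linear in \<open>b - l z\<close>: 1 up to 1 / (k + 1), 0 from 2 / (k +
    1) on. The plateau beyond the closed set absorbs the slack, and as k grows only the closed set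
    remains.\<close>
  define g where "g k z = max 0 (min 1 (2 - (b - l z) * real (Suc k)))" for k z
  have gc: "continuous_on UNIV (g k)" for k unfolding g_def by (intro continuous_intros l)
  have gb: "0 \<le> g k z" "g k z \<le> 1" for k z by (auto simp: g_def)
  have gm[measurable]: "g k \<in> borel_measurable borel" for k using gc by (rule borel_measurable_continuous_onI)
  have "(\<lambda>k. \<integral>w. g k (\<gamma> w 1) \<partial>N) \<longlonglongrightarrow> (\<integral>w. indicator {w \<in> space N. b \<le> l (\<gamma> w 1)} w \<partial>N)"
  proof (rule integral_dominated_convergence[where w = "\<lambda>_. 1"])
    show "AE w in N. (\<lambda>k. g k (\<gamma> w 1)) \<longlonglongrightarrow> indicator {w \<in> space N. b \<le> l (\<gamma> w 1)} w"
    proof (rule AE_I2)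
      fix w assume w: "w \<in> space N"
      show "(\<lambda>k. g k (\<gamma> w 1)) \<longlonglongrightarrow> indicator {w \<in> space N. b \<le> l (\<gamma> w 1)} w"
      proof (cases "b \<le> l (\<gamma> w 1)")
        case True
        then have "(b - l (\<gamma> w 1)) * real (Suc k) \<le> 0" for k by (intro mult_nonpos_nonneg) auto
        then have "g k (\<gamma> w 1) = 1" for k unfolding g_def by (smt (verit, best))
        then show ?thesis using True w by simp
      next
        case False
        define c where "c = b - l (\<gamma> w 1)"
        have c: "0 < c" using False by (simp add: c_def)
        obtain k0 :: nat where k0: "2 / c \<le> real k0" using real_arch_simple by blast
        have "g k (\<gamma> w 1) = 0" if "k \<ge> k0" for k
        proof -
          have "2 / c \<le> real (Suc k)" using k0 that by simp
          then have "2 \<le> c * real (Suc k)" using c by (simp add: pos_divide_le_eq mult.commute)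
          then show ?thesis unfolding g_def c_def[symmetric] by linarith
        qed
        then have "\<forall>\<^sub>F k in sequentially. g k (\<gamma> w 1) = 0" unfolding eventually_sequentially by blast
        then have "(\<lambda>k. g k (\<gamma> w 1)) \<longlonglongrightarrow> 0" by (rule tendsto_eventually)
        then show ?thesis using False by simp
      qed
    qed
  qed (use gb in auto)
  also have "(\<integral>w. indicator {w \<in> space N. b \<le> l (\<gamma> w 1)} w \<partial>N) = measure N {w \<in> space N. b \<le> l (\<gamma> w 1)}"
    by simp
  finally have "\<forall>\<^sub>F k in sequentially. (\<integral>w. g k (\<gamma> w 1) \<partial>N) < measure N {w \<in> space N. b \<le> l (\<gamma> w 1)} + e"
    by (rule order_tendstoD(2)) (use e in simp)
  then obtain k where k: "(\<integral>w. g k (\<gamma> w 1) \<partial>N) < measure N {w \<in> space N. b \<le> l (\<gamma> w 1)} + e"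
    using eventually_happens'[OF sequentially_bot] by blast
  have "curve_functional (\<lambda>\<eta>. g k (\<eta> 1))"
    by (rule curve_functional_endpoint[OF gc, of _ 1]) (use gb in auto)
  then have "((\<lambda>\<delta>. \<integral>w. g k (\<eta> \<delta> w 1) \<partial>M \<delta>) \<longlongrightarrow> (\<integral>w. g k (\<gamma> w 1) \<partial>N)) (at_right 0)"
    using conv unfolding curve_weak_conv_def by blast
  then have ev1: "\<forall>\<^sub>F \<delta> in at_right 0. (\<integral>w. g k (\<eta> \<delta> w 1) \<partial>M \<delta>) < measure N {w \<in> space N. b \<le> l (\<gamma> w 1)} + e"
    by (rule order_tendstoD(2)) (rule k)
  \<comment> \<open>Below this value, 2 \<delta> fits into the plateau of width 1 / (k + 1).\<close>
  define \<delta>1 where "\<delta>1 = min \<delta>0 (1 / (2 * real (Suc k)))"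
  have "0 < \<delta>1" using d0 by (simp add: \<delta>1_def)
  then have ev2: "\<forall>\<^sub>F \<delta> in at_right 0. 0 < \<delta> \<and> \<delta> < \<delta>1"
    unfolding eventually_at_right_field by blast
  show ?thesis
    using ev1 ev2
  proof eventually_elim
    case (elim \<delta>)
    have d: "0 < \<delta>" "\<delta> \<le> \<delta>0" "2 * \<delta> * real (Suc k) \<le> 1"
      using elim by (auto simp: \<delta>1_def field_simps)
    interpret M: prob_space "M \<delta>" by (rule M[OF d(1,2)])
    have [measurable]: "(\<lambda>w. \<eta> \<delta> w 1) \<in> borel_measurable (M \<delta>)" by (rule em[OF d(1,2)])
    have "measure (M \<delta>) (A \<delta>) = (\<integral>w. indicator (A \<delta>) w \<partial>M \<delta>)"
      using A[OF d(1,2)] by (simp add: sets.Int_space_eq2)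
    also have "\<dots> \<le> (\<integral>w. g k (\<eta> \<delta> w 1) \<partial>M \<delta>)"
    proof (rule integral_mono_AE)
      show "integrable (M \<delta>) (indicator (A \<delta>) :: _ \<Rightarrow> real)" using A[OF d(1,2)] by (simp add: M.emeasure_eq_measure)
      show "integrable (M \<delta>) (\<lambda>w. g k (\<eta> \<delta> w 1))"
        by (rule M.integrable_const_bound[where B = 1]) (use gb in auto)
      show "AE w in M \<delta>. indicator (A \<delta>) w \<le> g k (\<eta> \<delta> w 1)"
        using imp[OF d(1,2)]
      proof eventually_elim
        case (elim w)
        show ?case
        proof (cases "w \<in> A \<delta>")
          case True
          then have "(b - l (\<eta> \<delta> w 1)) * real (Suc k) \<le> 2 * \<delta> * real (Suc k)"
            using elim by (intro mult_right_mono) auto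
          then have "1 \<le> 2 - (b - l (\<eta> \<delta> w 1)) * real (Suc k)" using d(3) by linarith
          then have "g k (\<eta> \<delta> w 1) = 1" unfolding g_def by linarith
          then show ?thesis using True by simp
        qed (use gb in simp)
      qed
    qed
    finally show ?case using elim(1) by linarith
  qed
qed

section \<open>The crossing probability\<close>

text \<open>Half-open arcs give each corner the sign of the arc starting there: \<open>a\<close> and
  \<open>c\<close> positive, \<open>b\<close> and \<open>d\<close> negative.\<close>

lemma (in rect_lattice) alternating_sign_pattern:
  assumes lam: "0 < lam" and bv: "\<And>v. v \<in> bdry \<delta> L \<Longrightarrow> \<phi> v = alternating_bc \<delta> L lam v"
  shows "sign_pattern \<delta> L (\<lambda>v. negv \<delta> L \<phi> (pt v))"
proof unfold_locales
  show "inbox v" if "negv \<delta> L \<phi> (pt v)" for v using that by (simp add: negv_def)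
  show "\<not> negv \<delta> L \<phi> (pt (1, j))" if "2 \<le> j" "j \<le> ny" for j
  proof -
    have "pt (1, j) \<in> bdry \<delta> L" by (rule bdry_pt) (use that nx_ge in \<open>auto simp: inbox_def\<close>)
    moreover have "pt (1, j) \<in> arc_ab \<delta> L" using that by (auto simp: arc_ab_eq)
    ultimately show ?thesis using bv lam by (simp add: negv_def alternating_bc_def)
  qed
  show "\<not> negv \<delta> L \<phi> (pt (nx, j))" if "1 \<le> j" "j \<le> ny - 1" for j
  proof -
    have "pt (nx, j) \<in> bdry \<delta> L" by (rule bdry_pt) (use that nx_ge in \<open>auto simp: inbox_def\<close>)
    moreover have "pt (nx, j) \<in> arc_cd \<delta> L" using that by (auto simp: arc_cd_eq)
    ultimately show ?thesis using bv lam by (simp add: negv_def alternating_bc_def)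
  qed
  show "negv \<delta> L \<phi> (pt (i, 1))" if "1 \<le> i" "i \<le> nx - 1" for i
  proof -
    have b: "inbox (i, 1)" using that ny_ge by (simp add: inbox_def)
    then have "pt (i, 1) \<in> bdry \<delta> L" by (intro bdry_pt) auto
    moreover have "pt (i, 1) \<notin> arc_ab \<delta> L \<union> arc_cd \<delta> L" using that by (auto simp: arc_ab_eq arc_cd_eq)
    ultimately show ?thesis using bv lam b by (simp add: negv_def alternating_bc_def)
  qed
  show "negv \<delta> L \<phi> (pt (i, ny))" if "2 \<le> i" "i \<le> nx" for i
  proof -
    have b: "inbox (i, ny)" using that ny_ge by (simp add: inbox_def)
    then have "pt (i, ny) \<in> bdry \<delta> L" by (intro bdry_pt) auto
    moreover have "pt (i, ny) \<notin> arc_ab \<delta> L \<union> arc_cd \<delta> L" using that by (auto simp: arc_ab_eq arc_cd_eq)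
    ultimately show ?thesis using bv lam b by (simp add: negv_def alternating_bc_def)
  qed
qed

lemma rect_latticeI: "0 < \<delta> \<Longrightarrow> \<delta> \<le> min L 1 / 3 \<Longrightarrow> rect_lattice \<delta> L"
  by unfold_locales (auto simp: min_def split: if_splits)

lemma level_line_dichotomy:
  assumes \<delta>: "0 < \<delta>" "\<delta> \<le> min L 1 / 3" and lam: "0 < lam"
    and bv: "\<And>v. v \<in> bdry \<delta> L \<Longrightarrow> \<phi> v = alternating_bc \<delta> L lam v"
  shows "nonneg_connected \<delta> L \<phi> (arc_ab \<delta> L) (arc_cd \<delta> L) \<Longrightarrow> L - 2 * \<delta> \<le> Re (level_line \<delta> L \<phi> 1)"
    and "\<not> nonneg_connected \<delta> L \<phi> (arc_ab \<delta> L) (arc_cd \<delta> L) \<Longrightarrow> 1 - 2 * \<delta> \<le> Im (level_line \<delta> L \<phi> 1)"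
proof -
  interpret rect_lattice \<delta> L by (rule rect_latticeI[OF \<delta>])
  interpret sign_pattern \<delta> L "\<lambda>v. negv \<delta> L \<phi> (pt v)"
    by (rule alternating_sign_pattern[OF lam bv])
  show "nonneg_connected \<delta> L \<phi> (arc_ab \<delta> L) (arc_cd \<delta> L) \<Longrightarrow> L - 2 * \<delta> \<le> Re (level_line \<delta> L \<phi> 1)"
    and "\<not> nonneg_connected \<delta> L \<phi> (arc_ab \<delta> L) (arc_cd \<delta> L) \<Longrightarrow> 1 - 2 * \<delta> \<le> Im (level_line \<delta> L \<phi> 1)"
    by (rule level_line_endpoint[OF refl]; assumption)+
qed

section \<open>Transport of the field to its law\<close>

lemma gaussian_rv_distr:
  assumes T: "T \<in> measurable M N" and X: "X \<in> borel_measurable N" and g: "gaussian_rv M (\<lambda>w. X (T w))"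
  shows "gaussian_rv (distr M N T) X"
proof -
  from g consider \<mu> \<sigma> where "0 < \<sigma>" "distributed M lborel (\<lambda>w. X (T w)) (\<lambda>x. ennreal (normal_density \<mu> \<sigma> x))"
    | \<mu> where "AE w in M. X (T w) = \<mu>" by (auto simp: gaussian_rv_def)
  then show ?thesis
  proof cases
    case (1 \<mu> \<sigma>)
    have "distributed (distr M N T) lborel X (\<lambda>x. ennreal (normal_density \<mu> \<sigma> x))"
      using 1(2) T X by (simp add: distributed_def distr_distr comp_def)
    then show ?thesis using 1(1) X unfolding gaussian_rv_def by auto
  next
    case (2 \<mu>)
    have "AE w in distr M N T. X w = \<mu>" using 2 X by (subst AE_distr_iff[OF T]) auto
    then show ?thesis using X unfolding gaussian_rv_def by auto
  qed
qed

text \<open>\<open>level_line_constant\<close> speaks of fields on the sample space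
  \<open>complex \<Rightarrow> real\<close>, so a field on an arbitrary space is replaced by its
  law. Values off \<open>Vset\<close> are set to 0 since \<open>discrete_gff\<close> says nothing
  about measurability there.\<close>

lemma discrete_gff_distr:
  fixes \<delta> L :: real and \<phi> :: "complex \<Rightarrow> 'w \<Rightarrow> real"
  defines "T \<equiv> \<lambda>w v. if v \<in> Vset \<delta> L then \<phi> v w else 0"
  assumes gff: "discrete_gff \<delta> L f M \<phi>"
  shows "T \<in> measurable M (\<Pi>\<^sub>M v\<in>UNIV. borel)"
    and "discrete_gff \<delta> L f (distr M (\<Pi>\<^sub>M v\<in>UNIV. borel) T) (\<lambda>v \<omega>. \<omega> v)"
proof -
  let ?N = "\<Pi>\<^sub>M v\<in>(UNIV :: complex set). (borel :: real measure)"
  have gp: "prob_space M" "\<And>v. v \<in> Vset \<delta> L \<Longrightarrow> \<phi> v \<in> borel_measurable M"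
    "\<And>J a. finite J \<Longrightarrow> J \<subseteq> Vset \<delta> L \<Longrightarrow> gaussian_rv M (\<lambda>w. \<Sum>i\<in>J. a i * \<phi> i w)"
    "\<And>v. v \<in> Vset \<delta> L \<Longrightarrow> (\<integral>w. \<phi> v w \<partial>M) = harm_ext \<delta> L f v"
    "\<And>u v. u \<in> Vset \<delta> L \<Longrightarrow> v \<in> Vset \<delta> L \<Longrightarrow>
      (\<integral>w. (\<phi> u w - harm_ext \<delta> L f u) * (\<phi> v w - harm_ext \<delta> L f v) \<partial>M) = green \<delta> L u v"
    using gff by (auto simp: discrete_gff_def gaussian_process_def)
  show T[measurable]: "T \<in> measurable M ?N"
  proof (rule measurable_PiM_single')
    show "(\<lambda>w. T w v) \<in> borel_measurable M" for v
      using gp(2)[of v] by (cases "v \<in> Vset \<delta> L") (simp_all add: T_def)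
  qed (simp add: PiE_def extensional_def)
  have Tv: "T w v = \<phi> v w" if "v \<in> Vset \<delta> L" for w v using that by (simp add: T_def)
  have c[measurable]: "(\<lambda>\<omega>. \<omega> v) \<in> borel_measurable ?N" for v by (rule measurable_component_singleton) simp
  show "discrete_gff \<delta> L f (distr M ?N T) (\<lambda>v \<omega>. \<omega> v)"
    unfolding discrete_gff_def gaussian_process_def
  proof (intro conjI ballI allI impI)
    show "prob_space (distr M ?N T)" by (rule prob_space.prob_space_distr[OF gp(1) T])
    show "(\<lambda>\<omega>. \<omega> v) \<in> borel_measurable (distr M ?N T)" for v by simp
    fix J :: "complex set" and a assume J: "finite J" "J \<subseteq> Vset \<delta> L"
    show "gaussian_rv (distr M ?N T) (\<lambda>\<omega>. \<Sum>i\<in>J. a i * \<omega> i)"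
    proof (rule gaussian_rv_distr[OF T])
      show "(\<lambda>\<omega>. \<Sum>i\<in>J. a i * \<omega> i) \<in> borel_measurable ?N" by measurable
      have "(\<Sum>i\<in>J. a i * T w i) = (\<Sum>i\<in>J. a i * \<phi> i w)" for w
        by (intro sum.cong refl) (use J Tv in auto)
      then show "gaussian_rv M (\<lambda>w. \<Sum>i\<in>J. a i * T w i)" using gp(3)[OF J, of a] by simp
    qed
  next
    fix u assume u: "u \<in> Vset \<delta> L"
    show "(\<integral>\<omega>. \<omega> u \<partial>distr M ?N T) = harm_ext \<delta> L f u"
      using gp(4)[OF u] Tv[OF u] by (subst integral_distr[OF T]) simp_all
    fix v assume v: "v \<in> Vset \<delta> L"
    show "(\<integral>\<omega>. (\<omega> u - harm_ext \<delta> L f u) * (\<omega> v - harm_ext \<delta> L f v) \<partial>distr M ?N T) = green \<delta> L u v"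
      using gp(5)[OF u v] Tv[OF u] Tv[OF v] by (subst integral_distr[OF T]) simp_all
  qed
qed

theorem theorem1p3:
  fixes L lam0 xa xb xc xd :: real
    and M :: "real \<Rightarrow> 'w measure"
    and \<phi> :: "real \<Rightarrow> complex \<Rightarrow> 'w \<Rightarrow> real"
    and f :: "complex \<Rightarrow> complex"
  assumes "0 < L"
    and "level_line_constant lam0"
    and "\<And>\<delta>. 0 < \<delta> \<Longrightarrow> \<delta> \<le> min L 1 / 3 \<Longrightarrow>
           discrete_gff \<delta> L (alternating_bc \<delta> L lam0) (M \<delta>) (\<phi> \<delta>)"
    and "conformal_onto f (rect L) halfplane"
    and "(f \<longlongrightarrow> complex_of_real xa) (at corner_a within rect L)"
    and "(f \<longlongrightarrow> complex_of_real xb) (at corner_b within rect L)"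
    and "(f \<longlongrightarrow> complex_of_real xc) (at (corner_c L) within rect L)"
    and "(f \<longlongrightarrow> complex_of_real xd) (at (corner_d L) within rect L)"
    and "xa < xb" and "xb < xc" and "xc < xd"
  shows "((\<lambda>\<delta>. measure (M \<delta>)
             {w \<in> space (M \<delta>). nonneg_connected \<delta> L (\<lambda>v. \<phi> \<delta> v w) (arc_ab \<delta> L) (arc_cd \<delta> L)})
           \<longlongrightarrow> ((xb - xa) * (xd - xc)) / ((xc - xa) * (xd - xb))) (at_right 0)"
proof -
  note L = assms(1) and gff = assms(3)
  have lam: "0 < lam0" using assms(2) by (simp add: level_line_constant_def)
  obtain N :: "(real \<Rightarrow> real) measure" and \<eta> where sle: "sle4_rect N L \<eta>"
    and conv: "\<And>(M :: real \<Rightarrow> (complex \<Rightarrow> real) measure) \<phi>.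
        (\<forall>\<delta>. 0 < \<delta> \<longrightarrow> \<delta> \<le> min L 1 / 3 \<longrightarrow>
           discrete_gff \<delta> L (alternating_bc \<delta> L lam0) (M \<delta>) (\<phi> \<delta>)) \<Longrightarrow>
        curve_weak_conv M (\<lambda>\<delta> w. level_line \<delta> L (\<lambda>v. \<phi> \<delta> v w)) N \<eta> (at_right 0)"
    using assms(2) L unfolding level_line_constant_def by blast
  obtain F yL yR where F: "prob_space N" "yL < 0" "0 < yR" "conformal_onto F (rect L) halfplane"
    "(F \<longlongrightarrow> complex_of_real yL) (at corner_a within rect L)" "(F \<longlongrightarrow> 0) (at corner_b within rect L)"
    "(F \<longlongrightarrow> complex_of_real yR) (at (corner_c L) within rect L)"
    "filterlim F at_infinity (at (corner_d L) within rect L)"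
    "(\<lambda>w. \<eta> w 1) \<in> borel_measurable N"
    "measure N {w \<in> space N. L \<le> Re (\<eta> w 1)} \<le> - yL / (yR - yL)"
    "measure N {w \<in> space N. 1 \<le> Im (\<eta> w 1)} \<le> yR / (yR - yL)"
    by (rule sle4_endpoint_prob[OF L sle])
  \<comment> \<open>The bound for an end on the right side; the bound for the top side is then
    \<open>1 - c\<close>.\<close>
  define c where "c = - yL / (yR - yL)"
  have c1: "yR / (yR - yL) = 1 - c" using F(2,3) by (simp add: c_def field_simps)
  \<comment> \<open>In the coordinate \<open>F\<close>, with \<open>b\<close> at 0 and
    \<open>d\<close> at infinity, the cross-ratio is \<open>(0 - yL) / (yR - yL)\<close>.\<close>
  have c: "((xb - xa) * (xd - xc)) / ((xc - xa) * (xd - xb)) = c"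
    using cross_ratio_eq[OF L assms(4) F(4) assms(5-8) F(5) _ F(7,8), of 0] F(6) assms(9-11) by (simp add: c_def)
  define \<delta>0 where "\<delta>0 = min L 1 / 3"
  have d0: "0 < \<delta>0" using L by (simp add: \<delta>0_def)
  define T where "T \<delta> = (\<lambda>w v. if v \<in> Vset \<delta> L then \<phi> \<delta> v w else 0)" for \<delta>
  define M' where "M' \<delta> = distr (M \<delta>) (\<Pi>\<^sub>M v\<in>UNIV. borel) (T \<delta>)" for \<delta>
  have T: "T \<delta> \<in> measurable (M \<delta>) (\<Pi>\<^sub>M v\<in>UNIV. borel)"
    and gff': "discrete_gff \<delta> L (alternating_bc \<delta> L lam0) (M' \<delta>) (\<lambda>v \<omega>. \<omega> v)"
    if "0 < \<delta>" "\<delta> \<le> \<delta>0" for \<delta>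
    using discrete_gff_distr[OF gff[of \<delta>]] that by (simp_all add: \<delta>0_def T_def M'_def)
  have wc: "curve_weak_conv M' (\<lambda>\<delta> \<omega>. level_line \<delta> L \<omega>) N \<eta> (at_right 0)"
    using conv[of M' "\<lambda>_ v \<omega>. \<omega> v"] gff' by (simp add: \<delta>0_def)
  define conn where "conn \<delta> \<psi> = nonneg_connected \<delta> L \<psi> (arc_ab \<delta> L) (arc_cd \<delta> L)" for \<delta> \<psi>
  define E where "E \<delta> = {\<omega> \<in> space (M' \<delta>). conn \<delta> \<omega>}" for \<delta>
  have pM': "prob_space (M' \<delta>)" if "0 < \<delta>" "\<delta> \<le> \<delta>0" for \<delta>
    using gff'[OF that] by (simp add: discrete_gff_def gaussian_process_def)
  have fin: "finite (Vset \<delta> L)" if "0 < \<delta>" "\<delta> \<le> \<delta>0" for \<delta>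
    using rect_lattice.finite_Vset[OF rect_latticeI] that by (simp add: \<delta>0_def)
  have cm: "(\<lambda>\<omega>. \<omega> v) \<in> borel_measurable (M' \<delta>)" for v \<delta>
    unfolding M'_def by simp
  have Em: "E \<delta> \<in> sets (M' \<delta>)" if "0 < \<delta>" "\<delta> \<le> \<delta>0" for \<delta>
  proof -
    have "(\<lambda>\<omega>. conn \<delta> (\<lambda>v. \<omega> v)) \<in> measurable (M' \<delta>) (count_space UNIV)"
      unfolding conn_def
      by (rule measurable_sign_functional[OF fin[OF that] cm, where H = "\<lambda>\<psi>. nonneg_connected \<delta> L \<psi> (arc_ab \<delta> L) (arc_cd \<delta> L)"])
         (rule nonneg_connected_cong)
    from measurable_sets[OF this, of "{True}"] show ?thesis
      by (simp add: E_def vimage_def Int_def conj_commute)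
  qed
  have em: "(\<lambda>\<omega>. level_line \<delta> L \<omega> 1) \<in> borel_measurable (M' \<delta>)" if "0 < \<delta>" "\<delta> \<le> \<delta>0" for \<delta>
  proof -
    have "(\<lambda>\<omega>. level_line \<delta> L (\<lambda>v. \<omega> v) 1) \<in> measurable (M' \<delta>) (count_space UNIV)"
      by (rule measurable_sign_functional[OF fin[OF that] cm, where H = "\<lambda>\<psi>. level_line \<delta> L \<psi> 1"])
         (rule fun_cong[OF level_line_cong])
    from measurable_compose[OF this, of "\<lambda>x. x" borel] show ?thesis by simp
  qed
  have dich: "AE \<omega> in M' \<delta>. (conn \<delta> \<omega> \<longrightarrow> L - 2 * \<delta> \<le> Re (level_line \<delta> L \<omega> 1)) \<and>
      (\<not> conn \<delta> \<omega> \<longrightarrow> 1 - 2 * \<delta> \<le> Im (level_line \<delta> L \<omega> 1))" if d: "0 < \<delta>" "\<delta> \<le> \<delta>0" for \<delta>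
  proof -
    have d': "\<delta> \<le> min L 1 / 3" using d by (simp add: \<delta>0_def)
    interpret rect_lattice \<delta> L by (rule rect_latticeI[OF d(1) d'])
    have fb: "finite (bdry \<delta> L)" using finite_Vset by (rule finite_subset[rotated]) (auto simp: bdry_def)
    have "arc_ab \<delta> L \<union> arc_cd \<delta> L \<subseteq> Vset \<delta> L"
      using nx_ge by (auto simp: arc_ab_eq arc_cd_eq inbox_def)
    then have "finite (arc_ab \<delta> L \<union> arc_cd \<delta> L)" using finite_Vset by (rule finite_subset)
    then have ab: "arc_ab \<delta> L \<union> arc_cd \<delta> L \<in> sets borel" by (intro borel_closed finite_imp_closed)
    have bm: "alternating_bc \<delta> L lam0 \<in> borel_measurable borel"
      unfolding alternating_bc_def[abs_def] using ab by (intro measurable_If_set) simp_all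
    have "AE \<omega> in M' \<delta>. \<forall>v\<in>bdry \<delta> L. \<omega> v = alternating_bc \<delta> L lam0 v"
      using gff_boundary_values[OF gff'[OF d] _ finite_Vset bm] fb by (subst AE_finite_all) auto
    then show ?thesis
    proof eventually_elim
      case (elim \<omega>)
      then show ?case using level_line_dichotomy[OF d(1) d' lam, of \<omega>] by (auto simp: conn_def)
    qed
  qed
  have up: "\<forall>\<^sub>F \<delta> in at_right 0. measure (M' \<delta>) (E \<delta>) < c + e" if e: "0 < e" for e
  proof -
    have "\<forall>\<^sub>F \<delta> in at_right 0. measure (M' \<delta>) (E \<delta>) < measure N {w \<in> space N. L \<le> Re (\<eta> w 1)} + e"
    proof (rule endpoint_portmanteau[OF wc _ F(1,9) d0 pM' Em em _ e])
      show "AE \<omega> in M' \<delta>. \<omega> \<in> E \<delta> \<longrightarrow> L - 2 * \<delta> \<le> Re (level_line \<delta> L \<omega> 1)" if "0 < \<delta>" "\<delta> \<le> \<delta>0" for \<delta>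
        using dich[OF that] by eventually_elim (auto simp: E_def)
    qed (auto intro!: continuous_intros)
    then show ?thesis using F(10) by (elim eventually_mono) (simp add: c_def)
  qed
  have low: "\<forall>\<^sub>F \<delta> in at_right 0. c - e < measure (M' \<delta>) (E \<delta>)" if e: "0 < e" for e
  proof -
    have "\<forall>\<^sub>F \<delta> in at_right 0. measure (M' \<delta>) (space (M' \<delta>) - E \<delta>) < measure N {w \<in> space N. 1 \<le> Im (\<eta> w 1)} + e"
    proof (rule endpoint_portmanteau[OF wc _ F(1,9) d0 pM' _ em _ e])
      show "space (M' \<delta>) - E \<delta> \<in> sets (M' \<delta>)" if "0 < \<delta>" "\<delta> \<le> \<delta>0" for \<delta> using Em[OF that] by blast
      show "AE \<omega> in M' \<delta>. \<omega> \<in> space (M' \<delta>) - E \<delta> \<longrightarrow> 1 - 2 * \<delta> \<le> Im (level_line \<delta> L \<omega> 1)" if "0 < \<delta>" "\<delta> \<le> \<delta>0" for \<delta>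
        using dich[OF that] by eventually_elim (auto simp: E_def)
    qed (auto intro!: continuous_intros)
    moreover have "\<forall>\<^sub>F \<delta> in at_right 0. 0 < \<delta> \<and> \<delta> < \<delta>0"
      using d0 unfolding eventually_at_right_field by blast
    ultimately show ?thesis
    proof eventually_elim
      case (elim \<delta>)
      then have "measure (M' \<delta>) (space (M' \<delta>) - E \<delta>) = 1 - measure (M' \<delta>) (E \<delta>)"
        by (intro prob_space.prob_compl pM' Em) auto
      then show ?case using elim(1) F(11) c1 by linarith
    qed
  qed
  have "((\<lambda>\<delta>. measure (M' \<delta>) (E \<delta>)) \<longlongrightarrow> c) (at_right 0)"
  proof (rule tendstoI)
    fix e :: real assume "0 < e"
    from up[OF this] low[OF this] show "\<forall>\<^sub>F \<delta> in at_right 0. dist (measure (M' \<delta>) (E \<delta>)) c < e"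
      by eventually_elim (simp add: dist_real_def abs_less_iff)
  qed
  \<comment> \<open>Back from the law to the given field: the event depends only on signs inside
    \<open>Vset\<close>, where \<open>T \<delta> w\<close> and the field agree.\<close>
  moreover have "\<forall>\<^sub>F \<delta> in at_right 0. measure (M' \<delta>) (E \<delta>) =
      measure (M \<delta>) {w \<in> space (M \<delta>). nonneg_connected \<delta> L (\<lambda>v. \<phi> \<delta> v w) (arc_ab \<delta> L) (arc_cd \<delta> L)}"
    unfolding eventually_at_right_field
  proof (intro exI[of _ \<delta>0] conjI d0 allI impI)
    fix \<delta> assume d: "0 < \<delta>" "\<delta> < \<delta>0"
    have "measure (M' \<delta>) (E \<delta>) = measure (M \<delta>) (T \<delta> -` E \<delta> \<inter> space (M \<delta>))"
      using measure_distr[OF T[of \<delta>], of "E \<delta>"] Em[of \<delta>] d by (simp add: M'_def)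
    also have "T \<delta> -` E \<delta> \<inter> space (M \<delta>) = {w \<in> space (M \<delta>). conn \<delta> (T \<delta> w)}"
      using measurable_space[OF T[of \<delta>]] d by (auto simp: E_def M'_def)
    also have "\<dots> = {w \<in> space (M \<delta>). nonneg_connected \<delta> L (\<lambda>v. \<phi> \<delta> v w) (arc_ab \<delta> L) (arc_cd \<delta> L)}"
    proof -
      have "conn \<delta> (T \<delta> w) = nonneg_connected \<delta> L (\<lambda>v. \<phi> \<delta> v w) (arc_ab \<delta> L) (arc_cd \<delta> L)" for w
        unfolding conn_def by (rule nonneg_connected_cong) (auto simp: negv_def T_def)
      then show ?thesis by simp
    qed
    finally show "measure (M' \<delta>) (E \<delta>) =
      measure (M \<delta>) {w \<in> space (M \<delta>). nonneg_connected \<delta> L (\<lambda>v. \<phi> \<delta> v w) (arc_ab \<delta> L) (arc_cd \<delta> L)}" .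
  qed
  ultimately show ?thesis unfolding c by (rule Lim_transform_eventually)
qed

end
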